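(* Let $1\le p<2$ and let $\alpha\in(0,1/2)$ be a prescribed constant. There is a constant $c>0$ depending only on $\alpha$ and $p$ such that the following holds. Consider testing $H_0:\mu=0$ against $H_1:\mu\in K,\ \|\mu\|_p\ge\rho$, where $K\subset\mathbb{R}^d$ is a $p$-convex orthosymmetric set, from $N$ samples of $\mathcal N(\mu,\sigma^2\mathbf I_d)$ under the strong $\epsilon$-contamination model. If there exists a test whose type-I and type-II errors are both uniformly below $\alpha$, then necessarily $$\rho\ \ge\ c\,\sigma\max\left\{\frac{(k_{p,1}^\star)^{\frac1p-\frac14}}{\sqrt N},\ \frac{\sqrt\epsilon\,(k_{p,2}^\star)^{\frac1p-\frac14}}{N^{1/4}},\ \epsilon\,(k_{p,3}^\star)^{\frac1p-\frac12}\right\},$$ where $k_{p,1}^\star,k_{p,2}^\star,k_{p,3}^\star$ are the $\ell_p$ optimal dimensions.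
   Context: $p$-convex orthosymmetric (PCO) set: $K\subset\mathbb{R}^d$ such that (1) $K$ is convex; (2) $K^p:=\{(|\theta_1|^p,\dots,|\theta_d|^p)^\top:\theta\in K\}$ is convex; (3) $\theta\in K$ implies $(\eta_1\theta_1,\dots,\eta_d\theta_d)^\top\in K$ for all $\eta_i\in\{-1,1\}$. Model: $\tilde{\mathbf X}=\{\tilde X_1,\dots,\tilde X_N\}$ are i.i.d. $\mathcal N(\mu,\sigma^2\mathbf I_d)$ with unknown $\mu\in K$ and known $\sigma>0$; $\mathbb{P}_\mu$ is the probability law when the mean is $\mu$. Strong $\epsilon$-contamination: $\epsilon\in[0,c_0)$ is known, with $c_0<1/2$ a fixed small constant. An adversary $\mathcal C$ with full knowledge of the true distribution (and of $K$) inspects $\tilde{\mathbf X}$ and replaces up to $\epsilon N$ of the samples by arbitrary values (possibly randomly); only $\mathbf X=\mathcal C(\tilde{\mathbf X})$ is observed, and the set of corrupted indices is unknown. A test is a $\{0,1\}$-valued measurable function $\phi$ of the observed data. Type-I error: $\sup_{\mathcal C}\mathbb{P}_0(\phi(\mathcal C(\tilde{\mathbf X}))=1)$. Type-II error: $\sup_{\mu\in K,\|\mu\|_p\ge\rho}\sup_{\mathcal C}\mathbb{P}_\mu(\phi(\mathcal C(\tilde{\mathbf X}))=0)$. The alternative set is understood to be nonempty. Discretized Kolmogorov $k$-width in $\ell_p$: $\tilde D_{p,k}(K)=\inf_{P\in\tilde{\mathcal P}_k}\sup_{\theta\in K}\|\theta-P\theta\|_p$, where $\tilde{\mathcal P}_k$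 is the set of coordinate projections onto $k$ of the coordinate axes; $\tilde D_{p,k}=\infty$ for $k<0$, $\tilde D_{p,k}=0$ for $k>d$. $\ell_p$ optimal dimensions: $k_{p,1}^\star=\max\{j:0\le j\le d,\ \tilde D_{p,j-1}(K)>\frac{j^{1/p-1/4}}{\sqrt N}\sigma\}$, $k_{p,2}^\star=\max\{j:0\le j\le d,\ \tilde D_{p,j-1}(K)>\frac{\sqrt\epsilon\,j^{1/p-1/4}}{N^{1/4}}\sigma\}$, $k_{p,3}^\star=\max\{j:0\le j\le d,\ \tilde D_{p,j-1}(K)>\epsilon\sigma j^{1/p-1/2}\}$. Standing assumption of the paper: $\sup_{\theta\in K}\|\theta\|_2>\sigma/\sqrt N$. *)

theory Defs
  imports "HOL-Probability.Probability"
begin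

text \<open>The dimension \<open>d\<close> is a natural number rather than a type, because the constant in the lower
  bound has to be chosen uniformly in \<open>d\<close>. A vector of \<open>R^d\<close> is an extensional function on
  \<open>{..<d}\<close>, i.e. an element of \<open>space (vec_borel d)\<close>; a data set of \<open>N\<close> samples
  is an extensional function from \<open>{..<N}\<close> to such vectors.\<close>

definition vec_borel :: "nat \<Rightarrow> (nat \<Rightarrow> real) measure" where
  "vec_borel d = (\<Pi>\<^sub>M i\<in>{..<d}. borel)"

definition data_borel :: "nat \<Rightarrow> nat \<Rightarrow> (nat \<Rightarrow> nat \<Rightarrow> real) measure" where
  "data_borel d N = (\<Pi>\<^sub>M n\<in>{..<N}. vec_borel d)"

definition lp_norm :: "real \<Rightarrow> nat \<Rightarrow> (nat \<Rightarrow> real) \<Rightarrow> real" where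
  "lp_norm p d x = (\<Sum>i<d. \<bar>x i\<bar> powr p) powr (1 / p)"


subsection \<open>\<open>p\<close>-convex orthosymmetric sets\<close>

text \<open>The function type carries no real vector space structure, so \<^const>\<open>convex\<close> is not available.\<close>

definition convex_vecs :: "nat \<Rightarrow> (nat \<Rightarrow> real) set \<Rightarrow> bool" where
  "convex_vecs d A \<longleftrightarrow>
     (\<forall>x\<in>A. \<forall>y\<in>A. \<forall>u\<in>{0..1}. (\<lambda>i\<in>{..<d}. (1 - u) * x i + u * y i) \<in> A)"

definition pco_set :: "real \<Rightarrow> nat \<Rightarrow> (nat \<Rightarrow> real) set \<Rightarrow> bool" where
  "pco_set p d K \<longleftrightarrow>
     K \<subseteq> space (vec_borel d) \<and>
     convex_vecs d K \<and>
     convex_vecs d ((\<lambda>\<theta>. \<lambda>i\<in>{..<d}. \<bar>\<theta> i\<bar> powr p) ` K) \<and>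
     (\<forall>\<theta>\<in>K. \<forall>\<eta>. (\<forall>i<d. \<eta> i \<in> {-1, 1}) \<longrightarrow> (\<lambda>i\<in>{..<d}. \<eta> i * \<theta> i) \<in> K)"


subsection \<open>Kolmogorov widths and optimal dimensions\<close>

definition coord_proj :: "nat \<Rightarrow> nat set \<Rightarrow> (nat \<Rightarrow> real) \<Rightarrow> nat \<Rightarrow> real" where
  "coord_proj d S \<theta> = (\<lambda>i\<in>{..<d}. if i \<in> S then \<theta> i else 0)"

text \<open>Extended-real valued since \<open>K\<close> may be unbounded.\<close>

definition kolmogorov_width :: "real \<Rightarrow> nat \<Rightarrow> (nat \<Rightarrow> real) set \<Rightarrow> int \<Rightarrow> ereal" where
  "kolmogorov_width p d K k =
     (if k < 0 then \<infinity>
      else if k > int d then 0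
      else (INF S\<in>{S. S \<subseteq> {..<d} \<and> int (card S) = k}.
              SUP \<theta>\<in>K. ereal (lp_norm p d (\<lambda>i\<in>{..<d}. \<theta> i - coord_proj d S \<theta> i))))"

text \<open>The sets below contain \<open>j = 0\<close>: there the width is infinite and the threshold is
  \<open>0\<close> (note \<open>0 powr a = 0\<close>).\<close>

definition opt_dim1 :: "real \<Rightarrow> nat \<Rightarrow> (nat \<Rightarrow> real) set \<Rightarrow> nat \<Rightarrow> real \<Rightarrow> nat" where
  "opt_dim1 p d K N \<sigma> =
     Max {j. j \<le> d \<and> kolmogorov_width p d K (int j - 1)
                        > ereal (real j powr (1/p - 1/4) / sqrt (real N) * \<sigma>)}"

definition opt_dim2 :: "real \<Rightarrow> nat \<Rightarrow> (nat \<Rightarrow> real) set \<Rightarrow> nat \<Rightarrow> real \<Rightarrow> real \<Rightarrow> nat" where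
  "opt_dim2 p d K N \<sigma> \<epsilon> =
     Max {j. j \<le> d \<and> kolmogorov_width p d K (int j - 1)
                        > ereal (sqrt \<epsilon> * real j powr (1/p - 1/4) / real N powr (1/4) * \<sigma>)}"

definition opt_dim3 :: "real \<Rightarrow> nat \<Rightarrow> (nat \<Rightarrow> real) set \<Rightarrow> real \<Rightarrow> real \<Rightarrow> nat" where
  "opt_dim3 p d K \<sigma> \<epsilon> =
     Max {j. j \<le> d \<and> kolmogorov_width p d K (int j - 1)
                        > ereal (\<epsilon> * \<sigma> * real j powr (1/p - 1/2))}"


subsection \<open>Strongly contaminated Gaussian samples\<close>

definition gauss_vec :: "nat \<Rightarrow> real \<Rightarrow> (nat \<Rightarrow> real) \<Rightarrow> (nat \<Rightarrow> real) measure" where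
  "gauss_vec d \<sigma> \<mu> = (\<Pi>\<^sub>M i\<in>{..<d}. density lborel (\<lambda>t. ennreal (normal_density (\<mu> i) \<sigma> t)))"

definition clean_law :: "nat \<Rightarrow> nat \<Rightarrow> real \<Rightarrow> (nat \<Rightarrow> real) \<Rightarrow> (nat \<Rightarrow> nat \<Rightarrow> real) measure" where
  "clean_law d N \<sigma> \<mu> = (\<Pi>\<^sub>M n\<in>{..<N}. gauss_vec d \<sigma> \<mu>)"

text \<open>A (possibly randomized) adversary is a Markov kernel from clean to observed data sets,
  whose output almost surely differs from its input in at most \<open>\<epsilon> N\<close> samples.
  Knowledge of the true mean, of \<open>K\<close> and of the test is accounted for by taking the supremum
  over all adversaries after these objects are fixed.\<close>

definition adversaries ::
    "nat \<Rightarrow> nat \<Rightarrow> real \<Rightarrow> ((nat \<Rightarrow> nat \<Rightarrow> real) \<Rightarrow> (nat \<Rightarrow> nat \<Rightarrow> real) measure) set" where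
  "adversaries d N \<epsilon> =
     {C. C \<in> data_borel d N \<rightarrow>\<^sub>M prob_algebra (data_borel d N) \<and>
         (\<forall>x\<in>space (data_borel d N).
            AE y in C x. real (card {n\<in>{..<N}. y n \<noteq> x n}) \<le> \<epsilon> * real N)}"

definition observed_law ::
    "nat \<Rightarrow> nat \<Rightarrow> real \<Rightarrow> (nat \<Rightarrow> real) \<Rightarrow>
     ((nat \<Rightarrow> nat \<Rightarrow> real) \<Rightarrow> (nat \<Rightarrow> nat \<Rightarrow> real) measure) \<Rightarrow> (nat \<Rightarrow> nat \<Rightarrow> real) measure" where
  "observed_law d N \<sigma> \<mu> C = clean_law d N \<sigma> \<mu> \<bind> C"

definition is_test :: "nat \<Rightarrow> nat \<Rightarrow> ((nat \<Rightarrow> nat \<Rightarrow> real) \<Rightarrow> nat) \<Rightarrow> bool" where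
  "is_test d N \<phi> \<longleftrightarrow> \<phi> \<in> data_borel d N \<rightarrow>\<^sub>M count_space {0, 1}"

definition alternative :: "real \<Rightarrow> nat \<Rightarrow> (nat \<Rightarrow> real) set \<Rightarrow> real \<Rightarrow> (nat \<Rightarrow> real) set" where
  "alternative p d K \<rho> = {\<mu>\<in>K. lp_norm p d \<mu> \<ge> \<rho>}"

definition type1_error ::
    "nat \<Rightarrow> nat \<Rightarrow> real \<Rightarrow> real \<Rightarrow> ((nat \<Rightarrow> nat \<Rightarrow> real) \<Rightarrow> nat) \<Rightarrow> real" where
  "type1_error d N \<sigma> \<epsilon> \<phi> =
     (SUP C\<in>adversaries d N \<epsilon>.
        measure (observed_law d N \<sigma> (\<lambda>i\<in>{..<d}. 0) C) {x\<in>space (data_borel d N). \<phi> x = 1})"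

definition type2_error ::
    "real \<Rightarrow> nat \<Rightarrow> (nat \<Rightarrow> real) set \<Rightarrow> real \<Rightarrow> nat \<Rightarrow> real \<Rightarrow> real \<Rightarrow>
     ((nat \<Rightarrow> nat \<Rightarrow> real) \<Rightarrow> nat) \<Rightarrow> real" where
  "type2_error p d K \<rho> N \<sigma> \<epsilon> \<phi> =
     (SUP \<mu>\<in>alternative p d K \<rho>. SUP C\<in>adversaries d N \<epsilon>.
        measure (observed_law d N \<sigma> \<mu> C) {x\<in>space (data_borel d N). \<phi> x = 0})"

end

theory Submission
  imports Defs
begin

text \<open>The prior puts independent uniform signs on a single \<open>\<theta> \<in> K\<close>, so that it stays in \<open>K\<close> and
  keeps the \<open>\<ell>\<^sub>p\<close> norm. The width condition at \<open>j - 1\<close> and convexity of \<open>K\<^sup>p\<close> provide a \<open>\<theta>\<close> of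
  \<open>\<ell>\<^sub>p\<close> norm of order \<open>r\<close> all of whose entries are at most of order \<open>r j\<^sup>-\<^sup>1\<^sup>/\<^sup>p\<close>, which bounds
  \<open>\<Sum> \<theta>\<^sub>i\<^sup>2\<close> and \<open>\<Sum> \<theta>\<^sub>i\<^sup>4\<close>.

  Let \<open>L\<^sub>n\<close> be the likelihood ratio of the first \<open>n\<close> samples between the sign mixture and the null. The
  term without contamination is the usual second moment bound on \<open>L\<^sub>N\<close>. With contamination the adversary
  attacks the null: it reads the samples one by one and resamples the \<open>n\<close>-th one by a maximal
  coupling with its predictive law under the mixture given the (already modified) past. This
  produces exactly the mixture, and the expected number of changes is at most
  \<open>\<Sum>\<^sub>n E|L\<^sub>n - L\<^sub>n\<^sub>+\<^sub>1|\<close>, which Markov's inequality compares with \<open>\<epsilon> N\<close>. By Cauchy-Schwarz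
  \<open>E|L\<^sub>n - L\<^sub>n\<^sub>+\<^sub>1|\<^sup>2 \<le> E(L\<^sub>n\<^sub>+\<^sub>1\<^sup>2 / L\<^sub>n) - 1\<close>, an expectation that factorizes over the coordinates; with
  \<open>t\<^sub>i = \<theta>\<^sub>i\<^sup>2 / \<sigma>\<^sup>2\<close> each factor is at most \<open>exp(2 N t\<^sub>i\<^sup>2)\<close>, which gives the second term, and at most
  \<open>exp t\<^sub>i\<close>, which gives the third.\<close>


subsection \<open>Flat points of orthosymmetric sets\<close>


text \<open>Entries are replaced one at a time. A value between
  \<open>- \<bar>\<theta> n\<bar>\<close> and \<open>\<bar>\<theta> n\<bar>\<close> is a convex
  combination of the entry and its negative, so it is reached by mixing the current point with its
  reflection in coordinate \<open>n\<close>.\<close>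

lemma pco_solid:
  assumes K: "pco_set p d K" and \<theta>: "\<theta> \<in> K"
    and le: "\<And>i. i < d \<Longrightarrow> \<bar>\<psi> i\<bar> \<le> \<bar>\<theta> i\<bar>" and \<psi>: "\<psi> \<in> extensional {..<d}"
  shows "\<psi> \<in> K"
proof -
  have conv: "(\<lambda>i\<in>{..<d}. (1 - u) * x i + u * y i) \<in> K" if "x \<in> K" "y \<in> K" "0 \<le> u" "u \<le> 1" for x y u
    using K that unfolding pco_set_def convex_vecs_def by auto
  have flip: "(\<lambda>i\<in>{..<d}. \<eta> i * x i) \<in> K" if "x \<in> K" "\<And>i. \<eta> i \<in> {-1, 1}" for x and \<eta> :: "nat \<Rightarrow> real"
    using K that unfolding pco_set_def by blast
  define x where "x n = (\<lambda>i\<in>{..<d}. if i < n then \<psi> i else \<theta> i)" for n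
  have K_ext: "\<theta> \<in> extensional {..<d}"
    using K \<theta> unfolding pco_set_def vec_borel_def space_PiM by (auto simp: PiE_def)
  have "n \<le> d \<Longrightarrow> x n \<in> K" for n
  proof (induction n)
    case 0
    then show ?case using \<theta> K_ext by (simp add: x_def extensional_restrict)
  next
    case (Suc n)
    define y where "y = (\<lambda>i\<in>{..<d}. (if i = n then - 1 else 1) * x n i)"
    have y: "y \<in> K" unfolding y_def using Suc by (intro flip) auto
    \<comment> \<open>Solves \<open>(1 - 2 * u) * \<theta> n = \<psi> n\<close>; if
      \<open>\<theta> n = 0\<close>, then \<open>\<psi> n = 0\<close> as well and the point stays as
      it is.\<close>
    define u where "u = (if \<theta> n = 0 then 0 else (1 - \<psi> n / \<theta> n) / 2)"
    have "\<bar>\<psi> n / \<theta> n\<bar> \<le> 1" using le[of n] Suc.prems by (cases "\<theta> n = 0") (auto simp: abs_divide)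
    then have "\<psi> n / \<theta> n \<le> 1" "- 1 \<le> \<psi> n / \<theta> n" by linarith+
    then have u: "0 \<le> u" "u \<le> 1" unfolding u_def by auto
    have "\<theta> n = 0 \<Longrightarrow> \<psi> n = 0" using le[of n] Suc.prems by auto
    then have "x (Suc n) = (\<lambda>i\<in>{..<d}. (1 - u) * x n i + u * y i)"
      using Suc.prems by (intro ext) (auto simp: x_def y_def u_def less_Suc_eq field_simps)
    moreover have "x n \<in> K" using Suc by simp
    ultimately show ?case using conv[OF _ y u, of "x n"] by (simp only:)
  qed
  from this[of d] show ?thesis using \<psi> by (simp add: x_def extensional_restrict cong: restrict_cong)
qed

lemma zero_in_pco:
  assumes "pco_set p d K" "K \<noteq> {}"
  shows "(\<lambda>i\<in>{..<d}. 0) \<in> K"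
proof -
  obtain \<theta> where "\<theta> \<in> K" using assms(2) by blast
  then show ?thesis by (rule pco_solid[OF assms(1)]) auto
qed

text \<open>A near-maximizer of \<open>\<Sum> \<bar>\<theta>\<^sub>i\<bar>\<^sup>p\<close> under the entry bound has at most \<open>j - 1\<close> large entries. If its
  sum were small, mixing in \<open>K\<^sup>p\<close> with a point whose mass off those entries exceeds \<open>w\<close> would respect the
  entry bound and increase the sum by a fixed amount.\<close>

lemma pco_flat_point:
  assumes K: "pco_set p d K" and p: "1 \<le> p" and j: "1 \<le> j" "j \<le> d" and w: "0 < w"
    and width: "ereal (w powr (1/p)) < kolmogorov_width p d K (int j - 1)"
  shows "\<exists>\<theta>\<in>K. (\<forall>i<d. \<bar>\<theta> i\<bar> powr p \<le> w / j) \<and> w / 4 \<le> (\<Sum>i<d. \<bar>\<theta> i\<bar> powr p)"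
proof (rule ccontr)
  assume none: "\<not> ?thesis"
  define s where "s \<theta> = (\<Sum>i<d. \<bar>\<theta> i\<bar> powr p)" for \<theta> :: "nat \<Rightarrow> real"
  define B where "B = {\<theta>\<in>K. \<forall>i<d. \<bar>\<theta> i\<bar> powr p \<le> w / j}"
  have small: "s \<theta> < w / 4" if "\<theta> \<in> B" for \<theta>
    using none that unfolding s_def B_def by force
  \<comment> \<open>The width is an infimum over coordinate sets of size \<open>j - 1\<close>, so
    exceeding it yields a point with large mass outside every such set.\<close>
  have tail: "\<exists>\<theta>\<in>K. w < (\<Sum>i\<in>{..<d} - S. \<bar>\<theta> i\<bar> powr p)" if S: "S \<subseteq> {..<d}" "card S = j - 1" for S
  proof -
    have "ereal (w powr (1/p)) < (SUP \<theta>\<in>K. ereal (lp_norm p d (\<lambda>i\<in>{..<d}. \<theta> i - coord_proj d S \<theta> i)))"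
      using width S j unfolding kolmogorov_width_def
      by (auto simp: less_INF_D of_nat_diff split: if_splits intro: less_le_trans[OF _ INF_lower])
    then obtain \<theta> where \<theta>: "\<theta> \<in> K" "w powr (1/p) < lp_norm p d (\<lambda>i\<in>{..<d}. \<theta> i - coord_proj d S \<theta> i)"
      by (auto simp: less_SUP_iff)
    have "(\<Sum>i<d. \<bar>(\<lambda>i\<in>{..<d}. \<theta> i - coord_proj d S \<theta> i) i\<bar> powr p) = (\<Sum>i\<in>{..<d} - S. \<bar>\<theta> i\<bar> powr p)"
      by (rule sum.mono_neutral_cong_right) (auto simp: coord_proj_def)
    then have "w powr (1/p) < (\<Sum>i\<in>{..<d} - S. \<bar>\<theta> i\<bar> powr p) powr (1/p)" using \<theta> by (simp add: lp_norm_def)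
    moreover have "0 \<le> (\<Sum>i\<in>{..<d} - S. \<bar>\<theta> i\<bar> powr p)" by (intro sum_nonneg) auto
    ultimately have "w < (\<Sum>i\<in>{..<d} - S. \<bar>\<theta> i\<bar> powr p)"
      using powr_mono2[of "1/p" "\<Sum>i\<in>{..<d} - S. \<bar>\<theta> i\<bar> powr p" w] p by (auto simp: not_le[symmetric])
    then show ?thesis using \<theta> by blast
  qed
  obtain S0 where S0: "S0 \<subseteq> {..<d}" "card S0 = j - 1"
    using obtain_subset_with_card_n[of "j - 1" "{..<d}"] j by (metis card_lessThan diff_le_self le_trans)
  then have "K \<noteq> {}" using tail by blast
  then have z: "(\<lambda>i\<in>{..<d}. 0) \<in> B" unfolding B_def using zero_in_pco[OF K] w by auto
  define m where "m = Sup (s ` B)"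
  have bdd: "bdd_above (s ` B)" using small by (intro bdd_aboveI[of _ "w/4"]) (auto intro: less_imp_le)
  \<comment> \<open>This is what mixing adds to the sum: the weight \<open>1 / (2 * j)\<close> times
    \<open>w - s \<theta>\<close>, which is at least \<open>3 * w / 4\<close>.\<close>
  define gain where "gain = 3 * w / (8 * j)"
  have "gain > 0" using w j by (simp add: gain_def)
  then have "m - gain < m" by simp
  then obtain \<theta> where \<theta>: "\<theta> \<in> B" "m - gain < s \<theta>"
    unfolding m_def using less_cSup_iff[OF _ bdd] z by blast
  define S where "S = {i\<in>{..<d}. w / (2 * j) \<le> \<bar>\<theta> i\<bar> powr p}"
  have "card S * (w / (2 * j)) \<le> (\<Sum>i\<in>S. \<bar>\<theta> i\<bar> powr p)"
    using sum_bounded_below[of S "w / (2 * j)" "\<lambda>i. \<bar>\<theta> i\<bar> powr p"] by (simp add: S_def)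
  also have "\<dots> \<le> s \<theta>" unfolding s_def by (rule sum_mono2) (auto simp: S_def)
  also have "\<dots> < w / 4" using small \<theta> by blast
  \<comment> \<open>Fewer than \<open>j / 2\<close> entries are large, so they fit into a set
    \<open>S'\<close> of size \<open>j - 1\<close>, to which the width condition applies.\<close>
  finally have "real (2 * card S) < j" using w j by (simp add: field_simps)
  then have "card S \<le> j - 1" by linarith
  obtain S' where S': "S \<subseteq> S'" "S' \<subseteq> {..<d}" "card S' = j - 1"
  proof -
    have "S \<subseteq> {..<d}" "j - 1 \<le> card {..<d}" using j by (auto simp: S_def)
    then show ?thesis
      using exists_subset_between[of S "j - 1" "{..<d}"] \<open>card S \<le> j - 1\<close> that by blast
  qed
  then obtain \<phi> where \<phi>: "\<phi> \<in> K" "w < (\<Sum>i\<in>{..<d} - S'. \<bar>\<phi> i\<bar> powr p)" using tail by blast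
  define W where "W = (\<Sum>i\<in>{..<d} - S'. \<bar>\<phi> i\<bar> powr p)"
  have W: "w < W" "0 < W" using \<phi> w by (auto simp: W_def)
  \<comment> \<open>The part of \<open>\<phi>\<close> off \<open>S'\<close> has mass
    \<open>W > w\<close>; the factor multiplies all \<open>p\<close>-th powers by
    \<open>w / W\<close>, so the mass becomes exactly \<open>w\<close>.\<close>
  define \<psi> where "\<psi> = (\<lambda>i\<in>{..<d}. if i \<in> S' then 0 else (w / W) powr (1/p) * \<phi> i)"
  have sc: "(w / W) powr (1/p) \<le> 1" using W w p powr_mono2[of "1/p" "w/W" 1] by simp
  have "\<psi> \<in> K"
    by (rule pco_solid[OF K \<phi>(1)]) (use sc in \<open>auto simp: \<psi>_def abs_mult intro!: mult_left_le_one_le\<close>)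
  have \<psi>p: "\<bar>\<psi> i\<bar> powr p = (if i \<in> S' then 0 else w / W * \<bar>\<phi> i\<bar> powr p)" if "i < d" for i
    using that W w p by (auto simp: \<psi>_def abs_mult powr_mult powr_powr)
  have "s \<psi> = (\<Sum>i\<in>{..<d} - S'. w / W * \<bar>\<phi> i\<bar> powr p)"
    unfolding s_def by (rule sum.mono_neutral_cong_right) (auto simp: \<psi>p)
  also have "\<dots> = w / W * W" by (simp only: W_def sum_distrib_left)
  also have "\<dots> = w" using W by simp
  finally have s\<psi>: "s \<psi> = w" .
  have \<psi>le: "\<bar>\<psi> i\<bar> powr p \<le> w" if "i < d" for i
    unfolding s\<psi>[symmetric] s_def using that by (intro member_le_sum) auto
  \<comment> \<open>On \<open>S'\<close> the point \<open>\<psi>\<close> vanishes and mixing only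
    shrinks \<open>\<theta>\<close>. Off \<open>S'\<close> the \<open>p\<close>-th powers of
    \<open>\<theta>\<close> are at most \<open>w / (2 * j)\<close> and \<open>\<psi>\<close> adds at
    most \<open>u * w = w / (2 * j)\<close>, so the entry bound survives.\<close>
  define u where "u = 1 / (2 * real j)"
  have u: "0 < u" "u \<le> 1" using j by (auto simp: u_def)
  let ?F = "\<lambda>\<theta>. \<lambda>i\<in>{..<d}. \<bar>\<theta> i\<bar> powr p"
  have cv: "convex_vecs d (?F ` K)" using K by (simp add: pco_set_def)
  have F: "?F \<theta> \<in> ?F ` K" "?F \<psi> \<in> ?F ` K" using \<theta>(1) \<open>\<psi> \<in> K\<close> by (simp_all add: B_def)
  have "(\<lambda>i\<in>{..<d}. (1 - u) * ?F \<theta> i + u * ?F \<psi> i) \<in> ?F ` K"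
    using cv[unfolded convex_vecs_def, THEN bspec, OF F(1), THEN bspec, OF F(2), THEN bspec, of u] u by simp
  then obtain \<xi> where \<xi>: "\<xi> \<in> K" and
    eq: "(\<lambda>i\<in>{..<d}. (1 - u) * ?F \<theta> i + u * ?F \<psi> i) = ?F \<xi>" unfolding image_iff by blast
  have \<xi>p: "\<bar>\<xi> i\<bar> powr p = (1 - u) * \<bar>\<theta> i\<bar> powr p + u * \<bar>\<psi> i\<bar> powr p" if "i < d" for i
    using fun_cong[OF eq, of i] that by simp
  have "\<xi> \<in> B"
  proof -
    have "\<bar>\<xi> i\<bar> powr p \<le> w / j" if i: "i < d" for i
    proof (cases "i \<in> S'")
      case True
      have "(1 - u) * \<bar>\<theta> i\<bar> powr p \<le> \<bar>\<theta> i\<bar> powr p" using u by (simp add: mult_left_le_one_le)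
      then show ?thesis using \<xi>p[OF i] \<psi>p[OF i] True \<theta>(1) i by (force simp: B_def)
    next
      case False
      then have "\<bar>\<theta> i\<bar> powr p \<le> w / (2 * j)" using S' i by (auto simp: S_def)
      moreover have "(1 - u) * \<bar>\<theta> i\<bar> powr p \<le> \<bar>\<theta> i\<bar> powr p" using u by (simp add: mult_left_le_one_le)
      moreover have "u * \<bar>\<psi> i\<bar> powr p \<le> u * w" using u \<psi>le[OF i] by simp
      ultimately have "\<bar>\<xi> i\<bar> powr p \<le> w / (2 * j) + u * w" using \<xi>p[OF i] by linarith
      also have "\<dots> = w / j" using j by (simp add: u_def field_simps)
      finally show ?thesis .
    qed
    then show ?thesis using \<xi> by (simp add: B_def)
  qed
  have "s \<xi> = (1 - u) * s \<theta> + u * s \<psi>"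
    unfolding s_def by (simp add: \<xi>p sum.distrib sum_distrib_left)
  also have "\<dots> = s \<theta> + u * (w - s \<theta>)" by (simp add: s\<psi> algebra_simps)
  finally have "s \<xi> = s \<theta> + u * (w - s \<theta>)" .
  moreover have "u * (3 * w / 4) \<le> u * (w - s \<theta>)" using small[OF \<theta>(1)] u by (intro mult_left_mono) auto
  moreover have "u * (3 * w / 4) = gain" by (simp add: u_def gain_def)
  moreover have "s \<xi> \<le> m" unfolding m_def using \<open>\<xi> \<in> B\<close> bdd by (intro cSup_upper) auto
  ultimately show False using \<theta>(2) by linarith
qed

text \<open>The flat point for \<open>w = r powr p\<close> is shrunk until its sum of
  \<open>p\<close>-th powers is exactly \<open>w / 4\<close>, and then scaled by \<open>l\<close>.
  Higher moments follow by pulling powers of the largest entry out of this sum.\<close>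

lemma pco_flat_point_scaled:
  assumes K: "pco_set p d K" and p: "1 \<le> p" "p < 2" and j: "1 \<le> j" "j \<le> d" and r: "0 < r"
    and width: "ereal r < kolmogorov_width p d K (int j - 1)" and l: "0 < l" "l \<le> 1"
  shows "\<exists>\<theta>\<in>K. lp_norm p d \<theta> = l * 4 powr (-1/p) * r \<and>
           (\<Sum>i<d. (\<theta> i)^2) \<le> l^2 * r^2 * real j powr (1 - 2/p) / 4 \<and>
           (\<Sum>i<d. (\<theta> i)^4) \<le> l^4 * r^4 * real j powr (1 - 4/p) / 4"
proof -
  define w where "w = r powr p"
  have w: "0 < w" using r by (simp add: w_def)
  have wr: "w powr (1/p) = r" using r p by (simp add: w_def powr_powr)
  obtain \<theta> where \<theta>: "\<theta> \<in> K" and le: "\<And>i. i < d \<Longrightarrow> \<bar>\<theta> i\<bar> powr p \<le> w / j"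
    and ge: "w / 4 \<le> (\<Sum>i<d. \<bar>\<theta> i\<bar> powr p)"
    using pco_flat_point[OF K p(1) j w] width wr by auto
  define W where "W = (\<Sum>i<d. \<bar>\<theta> i\<bar> powr p)"
  have W: "0 < W" "w / 4 \<le> W" using ge w by (auto simp: W_def)
  define q where "q = (w / (4 * W)) powr (1/p)"
  have q: "0 < q" "q \<le> 1" using W w p powr_mono2[of "1/p" "w/(4*W)" 1] by (auto simp: q_def)
  have qp: "q powr p = w / (4 * W)" using W w p by (simp add: q_def powr_powr)
  define \<phi> where "\<phi> = (\<lambda>i\<in>{..<d}. q * \<theta> i)"
  have \<phi>s: "(\<Sum>i<d. \<bar>\<phi> i\<bar> powr p) = w / 4"
  proof -
    have "(\<Sum>i<d. \<bar>\<phi> i\<bar> powr p) = (\<Sum>i<d. q powr p * \<bar>\<theta> i\<bar> powr p)"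
      using q by (simp add: \<phi>_def abs_mult powr_mult)
    also have "\<dots> = q powr p * W" by (simp add: W_def sum_distrib_left)
    finally show ?thesis using W by (simp add: qp)
  qed
  have \<phi>h: "\<bar>\<phi> i\<bar> \<le> r * real j powr (-1/p)" if i: "i < d" for i
  proof -
    have "\<bar>\<theta> i\<bar> = (\<bar>\<theta> i\<bar> powr p) powr (1/p)" using p by (simp add: powr_powr)
    also have "\<dots> \<le> (w / j) powr (1/p)" using le[OF i] p by (intro powr_mono2) auto
    also have "\<dots> = r * real j powr (-1/p)"
      using w wr by (simp add: powr_divide powr_minus_divide)
    finally show ?thesis using q i mult_left_le_one_le[of "\<bar>\<theta> i\<bar>" q] by (simp add: \<phi>_def abs_mult)
  qed
  \<comment> \<open>Used for \<open>k = 2\<close> and \<open>k = 4\<close>. Even \<open>k\<close>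
    allows absolute values, and \<open>k \<ge> 2 > p\<close> makes the exponent \<open>k - p\<close>
    positive, so that the entry bound can be raised to it.\<close>
  have mom: "(\<Sum>i<d. (l * \<phi> i)^k) \<le> l^k * r^k * real j powr (1 - k/p) / 4" if k: "even k" "2 \<le> k" for k :: nat
  proof -
    let ?h = "r * real j powr (-1/p)"
    have h: "?h > 0" using r j by simp
    have "(\<phi> i)^k \<le> ?h powr (k - p) * \<bar>\<phi> i\<bar> powr p" if i: "i < d" for i
    proof (cases "\<phi> i = 0")
      case False
      have "(\<phi> i)^k = \<bar>\<phi> i\<bar> powr k" using False k by (simp add: powr_realpow power_even_abs)
      also have "\<dots> = \<bar>\<phi> i\<bar> powr (k - p) * \<bar>\<phi> i\<bar> powr p" by (simp add: powr_add[symmetric])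
      also have "\<dots> \<le> ?h powr (k - p) * \<bar>\<phi> i\<bar> powr p"
        using k p \<phi>h[OF i] by (intro mult_right_mono powr_mono2) auto
      finally show ?thesis .
    qed (use k in \<open>auto simp: zero_power\<close>)
    then have "(\<Sum>i<d. (\<phi> i)^k) \<le> (\<Sum>i<d. ?h powr (k - p) * \<bar>\<phi> i\<bar> powr p)" by (intro sum_mono) auto
    also have "\<dots> = ?h powr (k - p) * (w / 4)" by (simp add: sum_distrib_left[symmetric] \<phi>s)
    also have "?h powr (k - p) = r powr (k - p) * real j powr (1 - k/p)"
    proof -
      have "-1/p * (k - p) = 1 - k/p" using p by (simp add: field_simps)
      then show ?thesis using r j by (simp add: powr_mult powr_powr)
    qed
    also have "r powr (k - p) * real j powr (1 - k/p) * (w / 4) = r ^ k * real j powr (1 - k/p) / 4"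
      using r by (simp add: w_def powr_diff powr_realpow)
    finally have "(\<Sum>i<d. (\<phi> i)^k) \<le> r ^ k * real j powr (1 - k/p) / 4" .
    then have "l^k * (\<Sum>i<d. (\<phi> i)^k) \<le> l^k * (r ^ k * real j powr (1 - k/p) / 4)"
      using l by (intro mult_left_mono) auto
    then show ?thesis by (simp add: power_mult_distrib sum_distrib_left mult.assoc)
  qed
  define \<psi> where "\<psi> = (\<lambda>i\<in>{..<d}. l * \<phi> i)"
  have "\<psi> \<in> K"
  proof (rule pco_solid[OF K \<theta>])
    show "\<bar>\<psi> i\<bar> \<le> \<bar>\<theta> i\<bar>" if "i < d" for i
      using that q l by (auto simp: \<psi>_def \<phi>_def abs_mult intro!: mult_left_le_one_le mult_le_one simp flip: mult.assoc)
  qed (simp add: \<psi>_def)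
  moreover have "lp_norm p d \<psi> = l * 4 powr (-1/p) * r"
  proof -
    have "(\<Sum>i<d. \<bar>\<psi> i\<bar> powr p) = (\<Sum>i<d. l powr p * \<bar>\<phi> i\<bar> powr p)"
      using l by (simp add: \<psi>_def abs_mult powr_mult)
    also have "\<dots> = l powr p * (w / 4)" by (simp only: sum_distrib_left[symmetric] \<phi>s)
    finally have "lp_norm p d \<psi> = (l powr p * (w / 4)) powr (1/p)" by (simp only: lp_norm_def)
    also have "\<dots> = l * 4 powr (-1/p) * r" using l w p wr
      by (simp add: powr_mult powr_powr powr_divide powr_minus_divide)
    finally show ?thesis .
  qed
  moreover have "(\<Sum>i<d. (\<psi> i)^k) = (\<Sum>i<d. (l * \<phi> i)^k)" for k by (simp add: \<psi>_def)
  ultimately show ?thesis using mom[of 2] mom[of 4] by auto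
qed


subsection \<open>Sequential maximal coupling\<close>


text \<open>By Fubini coordinate \<open>n\<close> is integrated separately. On the right its
  original value is overwritten, so that integration contributes only total mass 1.\<close>

lemma nn_integral_resample:
  assumes I: "finite I" "n \<in> I" and M: "prob_space M"
    and h[measurable]: "h \<in> borel_measurable (PiM I (\<lambda>_. M))"
  shows "(\<integral>\<^sup>+x. h x \<partial>PiM I (\<lambda>_. M)) = (\<integral>\<^sup>+x. \<integral>\<^sup>+z. h (x(n := z)) \<partial>M \<partial>PiM I (\<lambda>_. M))"
proof -
  interpret M: prob_space M by fact
  interpret product_sigma_finite "\<lambda>_. M" by standard
  have ins: "(\<integral>\<^sup>+x. k x \<partial>PiM I (\<lambda>_. M)) = (\<integral>\<^sup>+x. \<integral>\<^sup>+z. k (x(n := z)) \<partial>M \<partial>PiM (I - {n}) (\<lambda>_. M))"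
    if "k \<in> borel_measurable (PiM I (\<lambda>_. M))" for k :: "_ \<Rightarrow> ennreal"
    using product_nn_integral_insert[of "I - {n}" n k] I that by (simp add: insert_absorb)
  have [measurable]: "(\<lambda>(x, z). x(n := z)) \<in> PiM I (\<lambda>_. M) \<Otimes>\<^sub>M M \<rightarrow>\<^sub>M PiM I (\<lambda>_. M)"
    unfolding case_prod_beta by (rule measurable_fun_upd[of I I n]) (use I in auto)
  have "(\<lambda>x. \<integral>\<^sup>+z. h (x(n := z)) \<partial>M) \<in> borel_measurable (PiM I (\<lambda>_. M))"
    by measurable
  then have "(\<integral>\<^sup>+x. \<integral>\<^sup>+z. h (x(n := z)) \<partial>M \<partial>PiM I (\<lambda>_. M))
      = (\<integral>\<^sup>+x. \<integral>\<^sup>+w. \<integral>\<^sup>+z. h (x(n := z)) \<partial>M \<partial>M \<partial>PiM (I - {n}) (\<lambda>_. M))"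
    by (subst ins) auto
  also have "\<dots> = (\<integral>\<^sup>+x. h x \<partial>PiM I (\<lambda>_. M))"
    by (subst ins[OF h]) (simp add: M.emeasure_space_1)
  finally show ?thesis ..
qed

lemma ennreal_diff_add_min:
  assumes "0 \<le> a" "0 \<le> b"
  shows "ennreal (a - b) + ennreal (min a b) = ennreal a"
  using assms by (cases "a \<le> b") (auto simp: min_def ennreal_neg simp flip: ennreal_plus)

text \<open>The kernel keeps coordinate \<open>n\<close> with probability \<open>min 1 (g / f)\<close> and otherwise redraws it from the
  normalized positive part of \<open>g - f\<close>. Since \<^const>\<open>ennreal\<close> sends negative numbers to \<open>0\<close>,
  \<open>ennreal (1 - g x / f x)\<close> is a positive part.\<close>

lemma rejection_kernel:
  fixes f g :: "('i \<Rightarrow> 'a) \<Rightarrow> real"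
  assumes I: "finite I" "n \<in> I" and M: "prob_space M"
  defines "P \<equiv> PiM I (\<lambda>_. M)"
  assumes f[measurable]: "f \<in> borel_measurable P" and g[measurable]: "g \<in> borel_measurable P"
    and f_pos: "\<And>x. x \<in> space P \<Longrightarrow> 0 < f x" and g_nonneg: "\<And>x. x \<in> space P \<Longrightarrow> 0 \<le> g x"
    and f_upd: "\<And>x z. x \<in> space P \<Longrightarrow> z \<in> space M \<Longrightarrow> f (x(n := z)) = f x"
    and g_upd: "\<And>x. x \<in> space P \<Longrightarrow> (\<integral>\<^sup>+z. ennreal (g (x(n := z))) \<partial>M) = ennreal (f x)"
  obtains T where "T \<in> P \<rightarrow>\<^sub>M prob_algebra P" "density P f \<bind> T = density P g"
    "\<And>h x. \<lbrakk>h \<in> borel_measurable P; x \<in> space P; \<And>z. z \<in> space M \<Longrightarrow> h (x(n := z)) \<le> h x + 1\<rbrakk>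
       \<Longrightarrow> (\<integral>\<^sup>+y. h y \<partial>T x) \<le> h x + ennreal (1 - g x / f x)"
proof -
  interpret M: prob_space M by fact
  interpret P: prob_space P unfolding P_def by (intro prob_space_PiM M)
  have sp: "space P \<noteq> {}" by (rule P.not_empty)
  have resample: "(\<integral>\<^sup>+x. h x \<partial>P) = (\<integral>\<^sup>+x. \<integral>\<^sup>+z. h (x(n := z)) \<partial>M \<partial>P)"
    if "h \<in> borel_measurable P" for h
    using that unfolding P_def by (rule nn_integral_resample[OF I M])
  have upd[measurable]: "(\<lambda>(x, z). x(n := z)) \<in> P \<Otimes>\<^sub>M M \<rightarrow>\<^sub>M P"
    unfolding case_prod_beta P_def by (rule measurable_fun_upd[of I I n]) (use I in auto)
  have upd_space: "x(n := z) \<in> space P" if "x \<in> space P" "z \<in> space M" for x z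
    using that I unfolding P_def space_PiM by (auto simp: PiE_iff extensional_def)
  \<comment> \<open>The mass of the positive part of \<open>g - f\<close> along the fibre through
    \<open>x\<close> in direction \<open>n\<close>. It normalizes the redraw density
    \<open>\<rho>\<close>; where it is 0, the density 1 is substituted so that the kernel stays a
    probability measure.\<close>
  define D where "D x = (\<integral>\<^sup>+z. ennreal (g (x(n := z)) - f x) \<partial>M)" for x
  define \<rho> where "\<rho> x z = (if D x = 0 then 1 else ennreal (g (x(n := z)) - f x) / D x)" for x z
  define a where "a x = ennreal (min 1 (g x / f x))" for x
  define b where "b x = ennreal (1 - g x / f x)" for x
  have [measurable]: "D \<in> borel_measurable P" unfolding D_def by measurable
  have [measurable]: "(\<lambda>(x, z). \<rho> x z) \<in> borel_measurable (P \<Otimes>\<^sub>M M)" unfolding \<rho>_def by measurable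
  have [measurable]: "a \<in> borel_measurable P" "b \<in> borel_measurable P" unfolding a_def b_def by measurable
  have ab: "a x + b x = 1" if "x \<in> space P" for x
    using f_pos[OF that] g_nonneg[OF that] unfolding a_def b_def
    by (cases "g x \<le> f x") (auto simp: min_def field_simps ennreal_neg simp flip: ennreal_plus)
  have fa: "ennreal (f x) * a x = ennreal (min (f x) (g x))" if "x \<in> space P" for x
    using f_pos[OF that] g_nonneg[OF that] unfolding a_def
    by (auto simp: min_def field_simps simp flip: ennreal_mult)
  have fb: "ennreal (f x) * b x = ennreal (f x - g x)" if "x \<in> space P" for x
  proof (cases "g x \<le> f x")
    case True
    then show ?thesis using f_pos[OF that] unfolding b_def
      by (subst ennreal_mult[symmetric]) (auto simp: field_simps)
  qed (use f_pos[OF that] in \<open>auto simp: b_def ennreal_neg field_simps\<close>)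
  have meas_x[measurable]: "(\<lambda>z. x(n := z)) \<in> M \<rightarrow>\<^sub>M P" if "x \<in> space P" for x
    using measurable_Pair2[OF upd that] by simp
  have D_fin: "D x < \<infinity>" if "x \<in> space P" for x
  proof -
    have "D x \<le> (\<integral>\<^sup>+z. ennreal (g (x(n := z))) \<partial>M)"
      unfolding D_def using f_pos[OF that] by (intro nn_integral_mono ennreal_leI) auto
    also have "\<dots> < \<infinity>" using g_upd[OF that] by simp
    finally show ?thesis .
  qed
  have \<rho>1: "(\<integral>\<^sup>+z. \<rho> x z \<partial>M) = 1" if x: "x \<in> space P" for x
  proof (cases "D x = 0")
    case False
    have [measurable]: "(\<lambda>z. x(n := z)) \<in> M \<rightarrow>\<^sub>M P" using x by measurable
    from False have "(\<integral>\<^sup>+z. \<rho> x z \<partial>M) = D x / D x"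
      by (simp add: \<rho>_def nn_integral_divide D_def[symmetric])
    then show ?thesis using False D_fin[OF x] by (simp add: ennreal_divide_self)
  qed (simp add: \<rho>_def M.emeasure_space_1)
  \<comment> \<open>The Boolean component is the coin that decides between keeping and redrawing,
    which makes both outcomes one image of a single density.\<close>
  define w where "w x = (\<lambda>(c, z). if c then a x else b x * \<rho> x z)" for x
  define T where "T x = distr (density (count_space (UNIV::bool set) \<Otimes>\<^sub>M M) (w x)) P
      (\<lambda>(c, z). if c then x else x(n := z))" for x
  have T_int: "(\<integral>\<^sup>+y. h y \<partial>T x) = a x * h x + b x * (\<integral>\<^sup>+z. h (x(n := z)) * \<rho> x z \<partial>M)"
    if x[measurable]: "x \<in> space P" and h[measurable]: "h \<in> borel_measurable P" for h x
  proof -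
    have [measurable]: "(\<lambda>z. x(n := z)) \<in> M \<rightarrow>\<^sub>M P" using x by measurable
    have [measurable]: "(\<lambda>z. \<rho> x z) \<in> borel_measurable M" using x by measurable
    have w'[measurable]: "w x \<in> borel_measurable (count_space (UNIV::bool set) \<Otimes>\<^sub>M M)"
      unfolding w_def by measurable
    have G[measurable]: "(\<lambda>(c, z). if c then x else x(n := z)) \<in> count_space (UNIV::bool set) \<Otimes>\<^sub>M M \<rightarrow>\<^sub>M P"
      by measurable
    have "(\<integral>\<^sup>+y. h y \<partial>T x) = (\<integral>\<^sup>+p. w x p * h (case p of (c, z) \<Rightarrow> if c then x else x(n := z))
        \<partial>(count_space (UNIV::bool set) \<Otimes>\<^sub>M M))"
      unfolding T_def by (simp add: nn_integral_distr nn_integral_density)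
    also have "\<dots> = (\<integral>\<^sup>+c. \<integral>\<^sup>+z. w x (c, z) * h (if c then x else x(n := z)) \<partial>M \<partial>count_space UNIV)"
      by (subst M.nn_integral_fst[symmetric]) auto
    also have "\<dots> = (\<integral>\<^sup>+z. a x * h x \<partial>M) + (\<integral>\<^sup>+z. b x * (h (x(n := z)) * \<rho> x z) \<partial>M)"
      by (subst nn_integral_count_space_finite) (auto simp: w_def UNIV_bool ac_simps)
    also have "\<dots> = a x * h x + b x * (\<integral>\<^sup>+z. h (x(n := z)) * \<rho> x z \<partial>M)"
      by (simp add: M.emeasure_space_1 nn_integral_cmult)
    finally show ?thesis .
  qed
  have sets_T[simp]: "sets (T x) = sets P" for x by (simp add: T_def)
  have T_em: "emeasure (T x) A = a x * indicator A x + b x * (\<integral>\<^sup>+z. indicator A (x(n := z)) * \<rho> x z \<partial>M)"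
    if "x \<in> space P" "A \<in> sets P" for x A
    using T_int[OF that(1), of "indicator A"] that by simp
  have T_prob: "prob_space (T x)" if "x \<in> space P" for x
  proof
    have "space (T x) = space P" by (rule sets_eq_imp_space_eq) simp
    then have "emeasure (T x) (space (T x)) = a x + b x * (\<integral>\<^sup>+z. \<rho> x z \<partial>M)"
      using that upd_space
      by (simp add: T_em cong: nn_integral_cong)
    then show "emeasure (T x) (space (T x)) = 1" using that \<rho>1 ab by simp
  qed
  have T: "T \<in> P \<rightarrow>\<^sub>M prob_algebra P"
  proof (rule measurable_prob_algebraI)
    show "T \<in> P \<rightarrow>\<^sub>M subprob_algebra P"
    proof (rule measurable_subprob_algebra)
      fix A assume [measurable]: "A \<in> sets P"
      show "(\<lambda>x. emeasure (T x) A) \<in> borel_measurable P"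
        by (subst measurable_cong[OF T_em]) auto
    qed (auto intro: T_prob prob_space_imp_subprob_space)
  qed (rule T_prob)
  have T': "T \<in> density P f \<rightarrow>\<^sub>M subprob_algebra P"
    using measurable_prob_algebraD[OF T] by simp
  have "density P f \<bind> T = density P g"
  proof (rule measure_eqI)
    have s: "sets (density P f \<bind> T) = sets P" by (rule sets_bind) (use sp in auto)
    then show "sets (density P f \<bind> T) = sets (density P g)" by simp
    fix A assume "A \<in> sets (density P f \<bind> T)"
    then have A[measurable]: "A \<in> sets P" using s by simp
    define \<Psi> where "\<Psi> x = (\<integral>\<^sup>+z. indicator A (x(n := z)) * \<rho> x z \<partial>M)" for x
    have [measurable]: "\<Psi> \<in> borel_measurable P" unfolding \<Psi>_def by measurable
    have D_upd: "D (x(n := z)) = D x" if "x \<in> space P" "z \<in> space M" for x z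
      using that by (simp add: D_def f_upd)
    have \<Psi>_upd: "\<Psi> (x(n := z)) = \<Psi> x" if "x \<in> space P" "z \<in> space M" for x z
      using that by (simp add: \<Psi>_def \<rho>_def f_upd D_upd cong: if_cong)
    have "emeasure (density P f \<bind> T) A = (\<integral>\<^sup>+x. f x * emeasure (T x) A \<partial>P)"
      by (subst emeasure_bind[OF _ T' A]) (use sp measurable_prob_algebraD[OF T] in
          \<open>auto simp: nn_integral_density intro!: nn_integral_density measurable_emeasure_kernel\<close>)
    also have "\<dots> = (\<integral>\<^sup>+x. ennreal (min (f x) (g x)) * indicator A x + ennreal (f x - g x) * \<Psi> x \<partial>P)"
      by (intro nn_integral_cong)
        (simp add: T_em distrib_left fa fb flip: mult.assoc \<Psi>_def)
    also have "\<dots> = (\<integral>\<^sup>+x. ennreal (min (f x) (g x)) * indicator A x \<partial>P) + (\<integral>\<^sup>+x. ennreal (f x - g x) * \<Psi> x \<partial>P)"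
      by (rule nn_integral_add) auto
    \<comment> \<open>Neither \<open>f\<close> nor \<open>\<Psi>\<close> depends on entry
      \<open>n\<close>, so resampling it averages only the deficit of \<open>g\<close> along the
      fibre.\<close>
    also have "(\<integral>\<^sup>+x. ennreal (f x - g x) * \<Psi> x \<partial>P) = (\<integral>\<^sup>+x. \<integral>\<^sup>+z. ennreal (f x - g (x(n := z))) * \<Psi> x \<partial>M \<partial>P)"
      by (subst resample) (auto intro!: nn_integral_cong simp: f_upd \<Psi>_upd)
    also have "\<dots> = (\<integral>\<^sup>+x. D x * \<Psi> x \<partial>P)"
    proof (intro nn_integral_cong)
      fix x assume x[measurable]: "x \<in> space P"
      have [measurable]: "(\<lambda>z. x(n := z)) \<in> M \<rightarrow>\<^sub>M P" using x by measurable
      \<comment> \<open>Along a fibre \<open>f\<close> and \<open>g\<close> have the same mass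
        \<open>f x\<close>, and so deficit and excess agree: both give \<open>f x\<close> when the
        common part \<open>?m\<close> is added. Finiteness of \<open>?m\<close> permits cancelling
        it.\<close>
      let ?m = "\<integral>\<^sup>+z. ennreal (min (f x) (g (x(n := z)))) \<partial>M"
      have "(\<integral>\<^sup>+z. ennreal (f x - g (x(n := z))) \<partial>M) + ?m
          = (\<integral>\<^sup>+z. ennreal (f x - g (x(n := z))) + ennreal (min (f x) (g (x(n := z)))) \<partial>M)"
        by (rule nn_integral_add[symmetric]) auto
      also have "\<dots> = (\<integral>\<^sup>+z. ennreal (f x) \<partial>M)"
        using f_pos[OF x] g_nonneg[OF upd_space[OF x]]
        by (intro nn_integral_cong ennreal_diff_add_min) auto
      finally have 1: "(\<integral>\<^sup>+z. ennreal (f x - g (x(n := z))) \<partial>M) + ?m = ennreal (f x)"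
        by (simp add: M.emeasure_space_1)
      have "D x + ?m
          = (\<integral>\<^sup>+z. ennreal (g (x(n := z)) - f x) + ennreal (min (g (x(n := z))) (f x)) \<partial>M)"
        unfolding D_def min.commute[of "f x"] by (rule nn_integral_add[symmetric]) auto
      also have "\<dots> = (\<integral>\<^sup>+z. ennreal (g (x(n := z))) \<partial>M)"
        using f_pos[OF x] g_nonneg[OF upd_space[OF x]]
        by (intro nn_integral_cong ennreal_diff_add_min) auto
      finally have 2: "D x + ?m = ennreal (f x)" using g_upd[OF x] by simp
      have 3: "?m \<noteq> \<top>"
      proof -
        have "?m \<le> (\<integral>\<^sup>+z. ennreal (f x) \<partial>M)" by (intro nn_integral_mono ennreal_leI) auto
        also have "\<dots> < \<infinity>" by (simp add: M.emeasure_space_1)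
        finally show ?thesis by simp
      qed
      have "(\<integral>\<^sup>+z. ennreal (f x - g (x(n := z))) \<partial>M) = D x"
        using ennreal_add_diff_cancel_right[OF 3] 1 2 by metis
      then show "(\<integral>\<^sup>+z. ennreal (f x - g (x(n := z))) * \<Psi> x \<partial>M) = D x * \<Psi> x"
        by (simp add: nn_integral_multc)
    qed
    also have "\<dots> = (\<integral>\<^sup>+x. \<integral>\<^sup>+z. ennreal (g (x(n := z)) - f x) * indicator A (x(n := z)) \<partial>M \<partial>P)"
    proof (intro nn_integral_cong)
      fix x assume x[measurable]: "x \<in> space P"
      have [measurable]: "(\<lambda>z. x(n := z)) \<in> M \<rightarrow>\<^sub>M P" using x by measurable
      show "D x * \<Psi> x = (\<integral>\<^sup>+z. ennreal (g (x(n := z)) - f x) * indicator A (x(n := z)) \<partial>M)"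
      proof (cases "D x = 0")
        case True
        then have "AE z in M. ennreal (g (x(n := z)) - f x) = 0"
          unfolding D_def by (subst (asm) nn_integral_0_iff_AE) auto
        then have "(\<integral>\<^sup>+z. ennreal (g (x(n := z)) - f x) * indicator A (x(n := z)) \<partial>M) = 0"
          by (subst nn_integral_0_iff_AE) auto
        then show ?thesis using True by simp
      next
        case False
        have "D x * \<Psi> x = (\<integral>\<^sup>+z. D x * (indicator A (x(n := z)) * \<rho> x z) \<partial>M)"
          unfolding \<Psi>_def using False by (subst nn_integral_cmult) (auto simp: \<rho>_def)
        also have "\<dots> = (\<integral>\<^sup>+z. ennreal (g (x(n := z)) - f x) * indicator A (x(n := z)) \<partial>M)"
        proof (intro nn_integral_cong)
          fix z
          have "D x * (ennreal (g (x(n := z)) - f x) / D x) = ennreal (g (x(n := z)) - f x)"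
            using False D_fin[OF x] by (simp add: ennreal_times_divide mult.commute[of "D x"] ennreal_mult_divide_eq)
          then show "D x * (indicator A (x(n := z)) * \<rho> x z) = ennreal (g (x(n := z)) - f x) * indicator A (x(n := z))"
            using False by (simp add: \<rho>_def ac_simps split: split_indicator)
        qed
        finally show ?thesis .
      qed
    qed
    \<comment> \<open>The resampling is undone; kept mass \<open>min f g\<close> and redrawn mass
      then add up to \<open>g\<close>.\<close>
    also have "\<dots> = (\<integral>\<^sup>+x. ennreal (g x - f x) * indicator A x \<partial>P)"
      by (subst (2) resample) (auto intro!: nn_integral_cong simp: f_upd)
    also have "(\<integral>\<^sup>+x. ennreal (min (f x) (g x)) * indicator A x \<partial>P) + \<dots>
        = (\<integral>\<^sup>+x. ennreal (min (f x) (g x)) * indicator A x + ennreal (g x - f x) * indicator A x \<partial>P)"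
      by (rule nn_integral_add[symmetric]) auto
    also have "\<dots> = (\<integral>\<^sup>+x. ennreal (g x) * indicator A x \<partial>P)"
    proof (intro nn_integral_cong)
      fix x assume x: "x \<in> space P"
      show "ennreal (min (f x) (g x)) * indicator A x + ennreal (g x - f x) * indicator A x
          = ennreal (g x) * indicator A x"
        using ennreal_diff_add_min[of "g x" "f x"] f_pos[OF x] g_nonneg[OF x]
        by (simp add: min.commute[of "f x"] add.commute split: split_indicator)
    qed
    also have "\<dots> = emeasure (density P g) A" by (simp add: emeasure_density)
    finally show "emeasure (density P f \<bind> T) A = emeasure (density P g) A" .
  qed
  \<comment> \<open>Only a redraw can raise \<open>h\<close>, by at most 1, and it happens with
    probability \<open>b x\<close>.\<close>
  moreover have "(\<integral>\<^sup>+y. h y \<partial>T x) \<le> h x + ennreal (1 - g x / f x)"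
    if h[measurable]: "h \<in> borel_measurable P" and x: "x \<in> space P"
      and le: "\<And>z. z \<in> space M \<Longrightarrow> h (x(n := z)) \<le> h x + 1" for h x
  proof -
    have "(\<integral>\<^sup>+z. h (x(n := z)) * \<rho> x z \<partial>M) \<le> (\<integral>\<^sup>+z. (h x + 1) * \<rho> x z \<partial>M)"
      by (intro nn_integral_mono mult_right_mono le) auto
    also have "\<dots> = h x + 1" using x \<rho>1 by (subst nn_integral_cmult) auto
    finally have "(\<integral>\<^sup>+y. h y \<partial>T x) \<le> a x * h x + b x * (h x + 1)"
      using x h by (simp add: T_int add_left_mono mult_left_mono)
    also have "\<dots> = (a x + b x) * h x + b x" by (simp add: algebra_simps)
    also have "\<dots> = h x + b x" using ab x by simp
    finally show ?thesis by (simp add: b_def)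
  qed
  ultimately show ?thesis using T that by blast
qed

text \<open>Induction on \<open>k\<close>: after the first \<open>k\<close> samples have been
  treated, the output has density \<open>L k\<close>, and the rejection kernel at entry
  \<open>k\<close> moves it to \<open>L (Suc k)\<close>. The function \<open>h\<close> stands for
  the number of changed samples, of which only the growth by at most 1 per overwritten entry
  matters.\<close>

lemma sequential_coupling:
  fixes L :: "nat \<Rightarrow> (nat \<Rightarrow> 'a) \<Rightarrow> real" and N :: nat
  assumes M: "prob_space M"
  defines "P \<equiv> PiM {..<N} (\<lambda>_. M)"
  assumes L: "\<And>n. n \<le> N \<Longrightarrow> L n \<in> borel_measurable P"
    and L_pos: "\<And>n x. x \<in> space P \<Longrightarrow> 0 < L n x"
    and L_0: "\<And>x. x \<in> space P \<Longrightarrow> L 0 x = 1"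
    and L_upd: "\<And>n x z. n < N \<Longrightarrow> x \<in> space P \<Longrightarrow> z \<in> space M \<Longrightarrow> L n (x(n := z)) = L n x"
    and L_Suc: "\<And>n x. n < N \<Longrightarrow> x \<in> space P \<Longrightarrow>
      (\<integral>\<^sup>+z. ennreal (L (Suc n) (x(n := z))) \<partial>M) = ennreal (L n x)"
    and h[measurable]: "case_prod h \<in> borel_measurable (P \<Otimes>\<^sub>M P)"
    and h_refl: "\<And>x. x \<in> space P \<Longrightarrow> h x x = 0"
    and h_upd: "\<And>x y n z. \<lbrakk>x \<in> space P; y \<in> space P; n < N; z \<in> space M\<rbrakk> \<Longrightarrow> h x (y(n := z)) \<le> h x y + 1"
    and "k \<le> N"
  shows "\<exists>C \<in> P \<rightarrow>\<^sub>M prob_algebra P. P \<bind> C = density P (L k) \<and>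
    (\<integral>\<^sup>+x. \<integral>\<^sup>+y. h x y \<partial>C x \<partial>P) \<le> (\<Sum>n<k. \<integral>\<^sup>+x. ennreal (L n x - L (Suc n) x) \<partial>P)"
  using \<open>k \<le> N\<close>
proof (induction k)
  case 0
  interpret P: prob_space P unfolding P_def by (intro prob_space_PiM M)
  have 1: "return P \<in> P \<rightarrow>\<^sub>M prob_algebra P"
    by (rule measurable_prob_algebraI) (auto intro: prob_space_return)
  have [measurable]: "L 0 \<in> borel_measurable P" by (simp add: L)
  have 2: "P \<bind> return P = density P (L 0)"
  proof -
    have "density P (L 0) = density P (\<lambda>_. 1)" by (rule density_cong) (auto simp: L_0)
    then show ?thesis by (simp add: bind_return' density_1)
  qed
  have "(\<integral>\<^sup>+x. \<integral>\<^sup>+y. h x y \<partial>return P x \<partial>P) = (\<integral>\<^sup>+x. h x x \<partial>P)"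
    by (intro nn_integral_cong nn_integral_return) auto
  also have "\<dots> = 0" by (simp add: h_refl cong: nn_integral_cong)
  finally show ?case using 1 2 by (intro bexI[of _ "return P"]) auto
next
  case (Suc k)
  interpret P: prob_space P unfolding P_def by (intro prob_space_PiM M)
  have "k \<le> N" using Suc.prems by simp
  from Suc.IH[OF this] obtain C where C[measurable]: "C \<in> P \<rightarrow>\<^sub>M prob_algebra P"
    and CL: "P \<bind> C = density P (L k)"
    and Ch: "(\<integral>\<^sup>+x. \<integral>\<^sup>+y. h x y \<partial>C x \<partial>P) \<le> (\<Sum>n<k. \<integral>\<^sup>+x. ennreal (L n x - L (Suc n) x) \<partial>P)"
    by blast
  have k: "k < N" using Suc by simp
  have [measurable]: "L k \<in> borel_measurable P" "L (Suc k) \<in> borel_measurable P" using k by (simp_all add: L)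
  obtain T where T[measurable]: "T \<in> P \<rightarrow>\<^sub>M prob_algebra P" and TL: "density P (L k) \<bind> T = density P (L (Suc k))"
    and Th: "\<And>h x. \<lbrakk>h \<in> borel_measurable P; x \<in> space P; \<And>z. z \<in> space M \<Longrightarrow> h (x(k := z)) \<le> h x + 1\<rbrakk>
       \<Longrightarrow> (\<integral>\<^sup>+y. h y \<partial>T x) \<le> h x + ennreal (1 - L (Suc k) x / L k x)"
    by (rule rejection_kernel[of "{..<N}" k M "L k" "L (Suc k)"])
       (use k M L_pos L_upd L_Suc L in \<open>auto simp: P_def intro: less_imp_le\<close>)
  have C': "C \<in> P \<rightarrow>\<^sub>M subprob_algebra P" and T': "T \<in> P \<rightarrow>\<^sub>M subprob_algebra P"
    by (auto intro: measurable_prob_algebraD)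
  define C2 where "C2 x = C x \<bind> T" for x
  have "C2 \<in> P \<rightarrow>\<^sub>M prob_algebra P" unfolding C2_def by measurable
  moreover have "P \<bind> C2 = density P (L (Suc k))"
    unfolding C2_def using bind_assoc[OF C' T'] CL TL by simp
  moreover have "(\<integral>\<^sup>+x. \<integral>\<^sup>+y. h x y \<partial>C2 x \<partial>P) \<le> (\<Sum>n<Suc k. \<integral>\<^sup>+x. ennreal (L n x - L (Suc n) x) \<partial>P)"
  proof -
    let ?b = "\<lambda>y. ennreal (1 - L (Suc k) y / L k y)"
    have sets_C: "sets (C x) = sets P" if "x \<in> space P" for x
      using sets_kernel[OF C' that] .
    have "(\<integral>\<^sup>+x. \<integral>\<^sup>+y. h x y \<partial>C2 x \<partial>P) \<le> (\<integral>\<^sup>+x. (\<integral>\<^sup>+y. h x y \<partial>C x) + (\<integral>\<^sup>+y. ?b y \<partial>C x) \<partial>P)"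
    proof (intro nn_integral_mono)
      fix x assume x[measurable]: "x \<in> space P"
      have hx[measurable]: "h x \<in> borel_measurable P" by measurable
      have "(\<integral>\<^sup>+y. h x y \<partial>C2 x) = (\<integral>\<^sup>+y. \<integral>\<^sup>+y'. h x y' \<partial>T y \<partial>C x)"
        unfolding C2_def
        by (rule nn_integral_bind[OF hx]) (use T' sets_C[OF x] in \<open>simp cong: measurable_cong_sets\<close>)
      also have "\<dots> \<le> (\<integral>\<^sup>+y. h x y + ?b y \<partial>C x)"
        using x k h_upd sets_eq_imp_space_eq[OF sets_C[OF x]] by (intro nn_integral_mono Th) auto
      also have "\<dots> = (\<integral>\<^sup>+y. h x y \<partial>C x) + (\<integral>\<^sup>+y. ?b y \<partial>C x)"
        by (rule nn_integral_add) (use sets_C[OF x] in \<open>simp_all cong: measurable_cong_sets\<close>)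
      finally show "(\<integral>\<^sup>+y. h x y \<partial>C2 x) \<le> (\<integral>\<^sup>+y. h x y \<partial>C x) + (\<integral>\<^sup>+y. ?b y \<partial>C x)" .
    qed
    also have "\<dots> = (\<integral>\<^sup>+x. \<integral>\<^sup>+y. h x y \<partial>C x \<partial>P) + (\<integral>\<^sup>+x. \<integral>\<^sup>+y. ?b y \<partial>C x \<partial>P)"
      by (rule nn_integral_add)
         (auto intro!: nn_integral_measurable_subprob_algebra2[where N = P] C')
    \<comment> \<open>The kernel acts on the already modified data, whose law has density
      \<open>L k\<close>; this density cancels the denominator of the redraw probability.\<close>
    also have "(\<integral>\<^sup>+x. \<integral>\<^sup>+y. ?b y \<partial>C x \<partial>P) = (\<integral>\<^sup>+y. ?b y \<partial>density P (L k))"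
      unfolding CL[symmetric] by (rule nn_integral_bind[symmetric, OF _ C']) auto
    also have "\<dots> = (\<integral>\<^sup>+y. ennreal (L k y - L (Suc k) y) \<partial>P)"
    proof (subst nn_integral_density)
      show "(\<integral>\<^sup>+x. ennreal (L k x) * ?b x \<partial>P) = (\<integral>\<^sup>+y. ennreal (L k y - L (Suc k) y) \<partial>P)"
      proof (intro nn_integral_cong)
        fix x assume "x \<in> space P"
        then have p: "0 < L k x" by (rule L_pos)
        show "ennreal (L k x) * ?b x = ennreal (L k x - L (Suc k) x)"
        proof (cases "L (Suc k) x \<le> L k x")
          case True
          then show ?thesis using p by (subst ennreal_mult[symmetric]) (auto simp: field_simps)
        qed (use p in \<open>auto simp: ennreal_neg field_simps\<close>)
      qed
    qed auto
    finally show ?thesis using Ch by (simp add: add_right_mono order_trans)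
  qed
  ultimately show ?case by blast
qed


subsection \<open>Gaussian likelihood ratios\<close>


text \<open>Both measures agree on boxes, where the integral of a product factorizes, and boxes
  determine a finite product measure.\<close>

lemma PiM_density:
  fixes f :: "'i \<Rightarrow> 'a \<Rightarrow> ennreal"
  assumes I: "finite I" and M: "\<And>i. prob_space (M i)"
    and f: "\<And>i. i \<in> I \<Longrightarrow> f i \<in> borel_measurable (M i)"
    and fM: "\<And>i. i \<in> I \<Longrightarrow> prob_space (density (M i) (f i))"
  shows "PiM I (\<lambda>i. density (M i) (f i)) = density (PiM I M) (\<lambda>x. \<Prod>i\<in>I. f i (x i))"
proof -
  \<comment> \<open>Outside \<open>I\<close> the factors are reset to \<open>M i\<close>, so that
    the whole family consists of probability spaces.\<close>
  define D where "D i = (if i \<in> I then density (M i) (f i) else M i)" for i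
  interpret M: product_sigma_finite M
    by (rule product_sigma_finite.intro) (rule prob_space_imp_sigma_finite[OF M])
  interpret D: product_sigma_finite D
    by (rule product_sigma_finite.intro) (auto simp: D_def intro: prob_space_imp_sigma_finite M fM)
  have [measurable]: "(\<lambda>x. \<Prod>i\<in>I. f i (x i)) \<in> borel_measurable (PiM I M)"
    using f by (intro borel_measurable_prod_ennreal measurable_compose[OF measurable_component_singleton]) auto
  have "density (PiM I M) (\<lambda>x. \<Prod>i\<in>I. f i (x i)) = PiM I D"
  proof (rule D.PiM_eqI[OF I])
    show "sets (density (PiM I M) (\<lambda>x. \<Prod>i\<in>I. f i (x i))) = sets (PiM I D)"
      unfolding sets_density by (rule sets_PiM_cong) (auto simp: D_def)
    fix A assume "\<And>i. i \<in> I \<Longrightarrow> A i \<in> sets (D i)"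
    then have A[measurable]: "\<And>i. i \<in> I \<Longrightarrow> A i \<in> sets (M i)" by (simp add: D_def)
    have box: "Pi\<^sub>E I A \<in> sets (PiM I M)" using I A by (intro sets_PiM_I_finite) auto
    have "emeasure (density (PiM I M) (\<lambda>x. \<Prod>i\<in>I. f i (x i))) (Pi\<^sub>E I A)
        = (\<integral>\<^sup>+x. (\<Prod>i\<in>I. f i (x i)) * indicator (Pi\<^sub>E I A) x \<partial>PiM I M)"
      using box by (simp add: emeasure_density)
    also have "\<dots> = (\<integral>\<^sup>+x. (\<Prod>i\<in>I. f i (x i) * indicator (A i) (x i)) \<partial>PiM I M)"
    proof (rule nn_integral_cong)
      fix x assume "x \<in> space (PiM I M)"
      then have "indicator (Pi\<^sub>E I A) x = (\<Prod>i\<in>I. indicator (A i) (x i) :: ennreal)"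
        using I by (auto simp: space_PiM PiE_iff indicator_def prod_zero_iff)
      then show "(\<Prod>i\<in>I. f i (x i)) * indicator (Pi\<^sub>E I A) x = (\<Prod>i\<in>I. f i (x i) * indicator (A i) (x i))"
        by (simp add: prod.distrib)
    qed
    also have "\<dots> = (\<Prod>i\<in>I. \<integral>\<^sup>+t. f i t * indicator (A i) t \<partial>M i)"
      using I f by (intro M.product_nn_integral_prod) auto
    also have "\<dots> = (\<Prod>i\<in>I. emeasure (D i) (A i))"
      using f by (intro prod.cong) (auto simp: D_def emeasure_density)
    finally show "emeasure (density (PiM I M) (\<lambda>x. \<Prod>i\<in>I. f i (x i))) (Pi\<^sub>E I A) = (\<Prod>i\<in>I. emeasure (D i) (A i))" .
  qed
  moreover have "PiM I D = PiM I (\<lambda>i. density (M i) (f i))"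
    by (rule PiM_cong) (auto simp: D_def)
  ultimately show ?thesis by simp
qed

text \<open>Rows are samples and columns are coordinates. All entries are independent, so functions
  of different columns factorize; the induction removes the last row, whose entries factorize among
  themselves.\<close>

lemma nn_integral_columns:
  fixes g :: "nat \<Rightarrow> (nat \<Rightarrow> 'a) \<Rightarrow> ennreal" and d N :: nat
  assumes G: "prob_space G"
    and g: "\<And>i. i < d \<Longrightarrow> g i \<in> borel_measurable (PiM {..<N} (\<lambda>_. G))"
  shows "(\<integral>\<^sup>+x. (\<Prod>i<d. g i (\<lambda>m\<in>{..<N}. x m i)) \<partial>PiM {..<N} (\<lambda>_. PiM {..<d} (\<lambda>_. G)))
    = (\<Prod>i<d. \<integral>\<^sup>+c. g i c \<partial>PiM {..<N} (\<lambda>_. G))"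
  using g
proof (induction N arbitrary: g)
  case 0
  interpret M: prob_space "PiM {} (\<lambda>_::nat. PiM {..<d} (\<lambda>_. G))" by (intro prob_space_PiM G)
  interpret G: prob_space "PiM {} (\<lambda>_::nat. G)" by (intro prob_space_PiM G)
  show ?case
    using M.emeasure_space_1 G.emeasure_space_1
    by (simp add: space_PiM restrict_def PiM_empty nn_integral_count_space_finite)
next
  case (Suc N)
  note Suc.prems[measurable]
  let ?M = "PiM {..<d} (\<lambda>_. G)"
  interpret G: prob_space G by fact
  interpret M: prob_space ?M by (intro prob_space_PiM G)
  interpret Gs: product_sigma_finite "\<lambda>_. G" by standard
  interpret Ms: product_sigma_finite "\<lambda>_. ?M" by standard
  have N: "{..<Suc N} = insert N {..<N}" by auto
  define g' where "g' i c = (\<integral>\<^sup>+t. g i (c(N := t)) \<partial>G)" for i c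
  have upd[measurable]: "(\<lambda>(c, t). c(N := t)) \<in> PiM {..<N} (\<lambda>_. G) \<Otimes>\<^sub>M G \<rightarrow>\<^sub>M PiM {..<Suc N} (\<lambda>_. G)"
    unfolding case_prod_beta by (rule measurable_fun_upd[of _ "{..<N}" N]) auto
  have g'[measurable]: "g' i \<in> borel_measurable (PiM {..<N} (\<lambda>_. G))" if "i < d" for i
    using that unfolding g'_def by measurable
  have col: "(\<lambda>x. \<lambda>m\<in>J. x m i) \<in> PiM J (\<lambda>_. ?M) \<rightarrow>\<^sub>M PiM J (\<lambda>_. G)" if "i < d" for i and J :: "nat set"
    using that
    by (intro measurable_restrict measurable_compose[OF measurable_component_singleton, where L = G]) auto
  have "(\<integral>\<^sup>+x. (\<Prod>i<d. g i (\<lambda>m\<in>{..<Suc N}. x m i)) \<partial>PiM {..<Suc N} (\<lambda>_. ?M))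
      = (\<integral>\<^sup>+x. \<integral>\<^sup>+z. (\<Prod>i<d. g i (\<lambda>m\<in>{..<Suc N}. (x(N := z)) m i)) \<partial>?M \<partial>PiM {..<N} (\<lambda>_. ?M))"
  proof (subst N, rule Ms.product_nn_integral_insert)
    show "(\<lambda>x. \<Prod>i<d. g i (\<lambda>m\<in>{..<Suc N}. x m i)) \<in> borel_measurable (PiM (insert N {..<N}) (\<lambda>_. ?M))"
      unfolding N[symmetric] using Suc.prems
      by (intro borel_measurable_prod_ennreal measurable_compose[OF col]) auto
  qed auto
  also have "\<dots> = (\<integral>\<^sup>+x. (\<Prod>i<d. g' i (\<lambda>m\<in>{..<N}. x m i)) \<partial>PiM {..<N} (\<lambda>_. ?M))"
  proof (rule nn_integral_cong)
    fix x assume x: "x \<in> space (PiM {..<N} (\<lambda>_. ?M))"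
    have c: "(\<lambda>m\<in>{..<N}. x m i) \<in> space (PiM {..<N} (\<lambda>_. G))" if "i < d" for i
      using measurable_space[OF col[OF that] x] .
    have "(\<integral>\<^sup>+z. (\<Prod>i<d. g i (\<lambda>m\<in>{..<Suc N}. (x(N := z)) m i)) \<partial>?M)
        = (\<integral>\<^sup>+z. (\<Prod>i<d. g i ((\<lambda>m\<in>{..<N}. x m i)(N := z i))) \<partial>?M)"
      by (intro nn_integral_cong prod.cong refl arg_cong[where f = "g _"]) (auto simp: restrict_def)
    also have "\<dots> = (\<Prod>i<d. \<integral>\<^sup>+t. g i ((\<lambda>m\<in>{..<N}. x m i)(N := t)) \<partial>G)"
    proof (rule Gs.product_nn_integral_prod)
      fix i assume "i \<in> {..<d}"
      then have i: "i < d" by simp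
      show "(\<lambda>t. g i ((\<lambda>m\<in>{..<N}. x m i)(N := t))) \<in> borel_measurable G"
        using measurable_compose[OF measurable_Pair2[OF upd c[OF i]] Suc.prems[OF i]]
        by (simp only: prod.case)
    qed simp
    finally show "(\<integral>\<^sup>+z. (\<Prod>i<d. g i (\<lambda>m\<in>{..<Suc N}. (x(N := z)) m i)) \<partial>?M)
        = (\<Prod>i<d. g' i (\<lambda>m\<in>{..<N}. x m i))" by (simp add: g'_def)
  qed
  also have "\<dots> = (\<Prod>i<d. \<integral>\<^sup>+c. g' i c \<partial>PiM {..<N} (\<lambda>_. G))" by (rule Suc.IH) (rule g')
  also have "\<dots> = (\<Prod>i<d. \<integral>\<^sup>+c. g i c \<partial>PiM {..<Suc N} (\<lambda>_. G))"
  proof (rule prod.cong[OF refl])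
    fix i assume "i \<in> {..<d}"
    then show "(\<integral>\<^sup>+c. g' i c \<partial>PiM {..<N} (\<lambda>_. G)) = (\<integral>\<^sup>+c. g i c \<partial>PiM {..<Suc N} (\<lambda>_. G))"
      unfolding g'_def N using Suc.prems[of i] unfolding N
      by (subst Gs.product_nn_integral_insert) auto
  qed
  finally show ?case .
qed

section \<open>One-dimensional Gaussian tilts\<close>

text \<open>The likelihood ratio of \<open>N(a, \<sigma>\<^sup>2)\<close> with respect to \<open>N(0, \<sigma>\<^sup>2)\<close>.\<close>

definition tilt :: "real \<Rightarrow> real \<Rightarrow> real \<Rightarrow> real" where
  "tilt \<sigma> a x = exp ((a * x - a\<^sup>2 / 2) / \<sigma>\<^sup>2)"

abbreviation normal0 :: "real \<Rightarrow> real measure" where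
  "normal0 \<sigma> \<equiv> density lborel (\<lambda>t. ennreal (normal_density 0 \<sigma> t))"

lemma tilt_pos[simp]: "0 < tilt \<sigma> a x" and tilt_nonneg[simp]: "0 \<le> tilt \<sigma> a x"
  by (simp_all add: tilt_def)

lemma borel_measurable_tilt[measurable]: "tilt \<sigma> a \<in> borel_measurable borel"
  unfolding tilt_def by measurable

lemma normal_density_tilt:
  assumes "0 < \<sigma>"
  shows "normal_density a \<sigma> x = normal_density 0 \<sigma> x * tilt \<sigma> a x"
proof -
  have "- (x - a)\<^sup>2 / (2 * \<sigma>\<^sup>2) = - x\<^sup>2 / (2 * \<sigma>\<^sup>2) + (a * x - a\<^sup>2 / 2) / \<sigma>\<^sup>2"
    using assms by (simp add: field_simps power2_eq_square)
  then show ?thesis by (simp add: normal_density_def tilt_def exp_add[symmetric])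
qed

lemma density_normal0_tilt:
  assumes "0 < \<sigma>"
  shows "density (normal0 \<sigma>) (\<lambda>x. ennreal (tilt \<sigma> a x)) = density lborel (\<lambda>t. ennreal (normal_density a \<sigma> t))"
  by (subst density_density_eq) (auto simp: normal_density_tilt[OF assms, of a] ennreal_mult)

lemma prob_space_normal0: "0 < \<sigma> \<Longrightarrow> prob_space (normal0 \<sigma>)"
  by (rule prob_space_normal_density)

lemma nn_integral_tilt:
  assumes "0 < \<sigma>"
  shows "(\<integral>\<^sup>+x. ennreal (tilt \<sigma> a x) \<partial>normal0 \<sigma>) = 1"
proof -
  interpret prob_space "density (normal0 \<sigma>) (\<lambda>x. ennreal (tilt \<sigma> a x))"
    unfolding density_normal0_tilt[OF assms] by (rule prob_space_normal_density[OF assms])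
  from emeasure_space_1 show ?thesis by (simp add: emeasure_density)
qed

text \<open>Together with \<open>tilt_mult_minus\<close> this makes quadratic expressions in the
  tilts by \<open>a\<close> and \<open>- a\<close> linear in tilts, each of which has mean 1 under
  the centered Gaussian.\<close>

lemma tilt_square: "(tilt \<sigma> a x)\<^sup>2 = exp (a\<^sup>2 / \<sigma>\<^sup>2) * tilt \<sigma> (2 * a) x"
proof -
  have "2 * ((a * x - a\<^sup>2 / 2) / \<sigma>\<^sup>2) = a\<^sup>2 / \<sigma>\<^sup>2 + (2 * a * x - (2 * a)\<^sup>2 / 2) / \<sigma>\<^sup>2"
    by (simp only: times_divide_eq_right add_divide_distrib[symmetric])
      (simp add: power2_eq_square algebra_simps)
  then show ?thesis unfolding tilt_def exp_double[symmetric] by (simp add: exp_add)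
qed

lemma tilt_mult_minus: "tilt \<sigma> a x * tilt \<sigma> (- a) x = exp (- a\<^sup>2 / \<sigma>\<^sup>2)"
proof -
  have "(a * x - a\<^sup>2 / 2) / \<sigma>\<^sup>2 + ((- a) * x - (- a)\<^sup>2 / 2) / \<sigma>\<^sup>2 = - a\<^sup>2 / \<sigma>\<^sup>2"
    by (simp add: add_divide_distrib[symmetric])
  then show ?thesis by (simp add: tilt_def exp_add[symmetric])
qed

section \<open>Sign-symmetrized likelihood ratios of one column\<close>

text \<open>The likelihood ratio of the first \<open>n\<close> entries of \<open>c\<close> under the mean \<open>a\<close> or \<open>- a\<close>, each with
  probability \<open>1/2\<close> for the whole sequence.\<close>

definition sym_ratio :: "real \<Rightarrow> real \<Rightarrow> nat \<Rightarrow> (nat \<Rightarrow> real) \<Rightarrow> real" where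
  "sym_ratio \<sigma> a n c = ((\<Prod>m<n. tilt \<sigma> a (c m)) + (\<Prod>m<n. tilt \<sigma> (- a) (c m))) / 2"

lemma sym_ratio_pos: "0 < sym_ratio \<sigma> a n c"
  unfolding sym_ratio_def by (intro divide_pos_pos add_pos_pos prod_pos) auto

lemma borel_measurable_prod_tilt:
  fixes n N :: nat
  assumes "n \<le> N"
  shows "(\<lambda>c. \<Prod>m<n. tilt \<sigma> a (c m)) \<in> borel_measurable (PiM {..<N} (\<lambda>_. normal0 \<sigma>))"
  using assms
  by (intro borel_measurable_prod measurable_compose[OF measurable_component_singleton[of _ "{..<N}"]]) auto

lemma borel_measurable_sym_ratio:
  "n \<le> N \<Longrightarrow> sym_ratio \<sigma> a n \<in> borel_measurable (PiM {..<N} (\<lambda>_. normal0 \<sigma>))"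
  unfolding sym_ratio_def using borel_measurable_prod_tilt by measurable

lemma nn_integral_prod_tilt:
  fixes n N :: nat
  assumes \<sigma>: "0 < \<sigma>" and n: "n \<le> N"
  shows "(\<integral>\<^sup>+c. ennreal (\<Prod>m<n. tilt \<sigma> a (c m)) \<partial>PiM {..<N} (\<lambda>_. normal0 \<sigma>)) = 1"
proof -
  interpret G: prob_space "normal0 \<sigma>" by (rule prob_space_normal0[OF \<sigma>])
  interpret product_sigma_finite "\<lambda>_. normal0 \<sigma>" by standard
  \<comment> \<open>Padding with the factor 1 makes the product run over all \<open>N\<close>
    coordinates of the measure.\<close>
  let ?f = "\<lambda>m t. if m < n then ennreal (tilt \<sigma> a t) else 1"
  have "(\<integral>\<^sup>+c. ennreal (\<Prod>m<n. tilt \<sigma> a (c m)) \<partial>PiM {..<N} (\<lambda>_. normal0 \<sigma>))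
      = (\<integral>\<^sup>+c. (\<Prod>m<N. ?f m (c m)) \<partial>PiM {..<N} (\<lambda>_. normal0 \<sigma>))"
  proof (rule nn_integral_cong)
    fix c :: "nat \<Rightarrow> real"
    have "ennreal (\<Prod>m<n. tilt \<sigma> a (c m)) = (\<Prod>m<n. ?f m (c m))" by (simp add: prod_ennreal)
    also have "\<dots> = (\<Prod>m<N. ?f m (c m))" using n by (intro prod.mono_neutral_left) auto
    finally show "ennreal (\<Prod>m<n. tilt \<sigma> a (c m)) = (\<Prod>m<N. ?f m (c m))" .
  qed
  also have "\<dots> = (\<Prod>m<N. \<integral>\<^sup>+t. ?f m t \<partial>normal0 \<sigma>)"
    by (rule product_nn_integral_prod) auto
  also have "\<dots> = 1"
    using nn_integral_tilt[OF \<sigma>, of a] G.emeasure_space_1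
    by (intro prod.neutral ballI) (case_tac "x < n", auto)
  finally show ?thesis .
qed

lemma nn_integral_sym_ratio:
  assumes \<sigma>: "0 < \<sigma>" and n: "n \<le> N"
  shows "(\<integral>\<^sup>+c. ennreal (sym_ratio \<sigma> a n c) \<partial>PiM {..<N} (\<lambda>_. normal0 \<sigma>)) = 1"
proof -
  note borel_measurable_prod_tilt[OF n, measurable]
  have "(\<integral>\<^sup>+c. ennreal (sym_ratio \<sigma> a n c) \<partial>PiM {..<N} (\<lambda>_. normal0 \<sigma>))
    = (\<integral>\<^sup>+c. (ennreal (\<Prod>m<n. tilt \<sigma> a (c m)) + ennreal (\<Prod>m<n. tilt \<sigma> (-a) (c m))) / 2
        \<partial>PiM {..<N} (\<lambda>_. normal0 \<sigma>))"
    by (intro nn_integral_cong)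
       (simp add: sym_ratio_def prod_nonneg add_nonneg_nonneg divide_ennreal[symmetric] flip: ennreal_plus)
  also have "\<dots> = (1 + 1) / 2"
    by (simp add: nn_integral_divide nn_integral_add nn_integral_prod_tilt[OF \<sigma> n])
  also have "\<dots> = 1" by (simp add: ennreal_divide_self)
  finally show ?thesis .
qed

text \<open>\<open>A\<close> and \<open>B\<close> will be the tilt products of the two signs over
  the past entries, so this integrates out one further entry. The product of opposite tilts is
  constant, which gives the cross term its
  \<open>exp (- a\<^sup>2 / \<sigma>\<^sup>2)\<close>.\<close>

lemma nn_integral_quadratic_tilt:
  assumes \<sigma>: "0 < \<sigma>" and AB: "0 \<le> A" "0 \<le> B"
  shows "(\<integral>\<^sup>+t. ennreal ((A * tilt \<sigma> a t + B * tilt \<sigma> (- a) t)\<^sup>2) \<partial>normal0 \<sigma>)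
    = ennreal ((A\<^sup>2 + B\<^sup>2) * exp (a\<^sup>2 / \<sigma>\<^sup>2) + 2 * A * B * exp (- a\<^sup>2 / \<sigma>\<^sup>2))"
proof -
  interpret G: prob_space "normal0 \<sigma>" by (rule prob_space_normal0[OF \<sigma>])
  let ?e = "exp (a\<^sup>2 / \<sigma>\<^sup>2)"
  have "(A * tilt \<sigma> a t + B * tilt \<sigma> (- a) t)\<^sup>2
      = A\<^sup>2 * ?e * tilt \<sigma> (2 * a) t + B\<^sup>2 * ?e * tilt \<sigma> (2 * - a) t + 2 * A * B * exp (- a\<^sup>2 / \<sigma>\<^sup>2)" for t
  proof -
    have "(A * tilt \<sigma> a t + B * tilt \<sigma> (- a) t)\<^sup>2
      = A\<^sup>2 * (tilt \<sigma> a t)\<^sup>2 + B\<^sup>2 * (tilt \<sigma> (-a) t)\<^sup>2 + 2 * A * B * (tilt \<sigma> a t * tilt \<sigma> (- a) t)"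
      by (simp add: power2_eq_square algebra_simps)
    then show ?thesis unfolding tilt_square tilt_mult_minus by simp
  qed
  then have "(\<integral>\<^sup>+t. ennreal ((A * tilt \<sigma> a t + B * tilt \<sigma> (- a) t)\<^sup>2) \<partial>normal0 \<sigma>)
    = (\<integral>\<^sup>+t. ennreal (A\<^sup>2 * ?e) * ennreal (tilt \<sigma> (2 * a) t) + ennreal (B\<^sup>2 * ?e) * ennreal (tilt \<sigma> (2 * - a) t)
        + ennreal (2 * A * B * exp (- a\<^sup>2 / \<sigma>\<^sup>2)) \<partial>normal0 \<sigma>)"
    using AB by (intro nn_integral_cong) (simp add: ennreal_mult[symmetric] flip: ennreal_plus)
  also have "\<dots> = ennreal (A\<^sup>2 * ?e) + ennreal (B\<^sup>2 * ?e) + ennreal (2 * A * B * exp (- a\<^sup>2 / \<sigma>\<^sup>2))"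
    by (simp add: nn_integral_add nn_integral_cmult nn_integral_tilt[OF \<sigma>] G.emeasure_space_1[simplified])
  also have "\<dots> = ennreal ((A\<^sup>2 + B\<^sup>2) * ?e + 2 * A * B * exp (- a\<^sup>2 / \<sigma>\<^sup>2))"
    using AB by (simp add: algebra_simps flip: ennreal_plus)
  finally show ?thesis .
qed

lemma prod_tilt_minus:
  fixes n :: nat
  shows "(\<Prod>m<n. tilt \<sigma> a (c m)) * (\<Prod>m<n. tilt \<sigma> (- a) (c m)) = exp (- (n * (a\<^sup>2 / \<sigma>\<^sup>2)))"
proof -
  have "(\<Prod>m<n. tilt \<sigma> a (c m)) * (\<Prod>m<n. tilt \<sigma> (- a) (c m)) = (\<Prod>m<n. exp (- a\<^sup>2 / \<sigma>\<^sup>2))"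
    by (simp only: prod.distrib[symmetric] tilt_mult_minus)
  then show ?thesis by (simp add: exp_of_nat_mult[symmetric])
qed

text \<open>With \<open>w = N * (a\<^sup>2 / \<sigma>\<^sup>2)\<close>, both squares have mean
  \<open>exp w\<close> and the cross product is the constant \<open>exp (- w)\<close>; their weights
  in the square of the average give \<open>cosh w\<close>.\<close>

lemma nn_integral_sym_ratio_square:
  assumes \<sigma>: "0 < \<sigma>"
  shows "(\<integral>\<^sup>+c. ennreal ((sym_ratio \<sigma> a N c)\<^sup>2) \<partial>PiM {..<N} (\<lambda>_. normal0 \<sigma>)) = ennreal (cosh (N * (a\<^sup>2 / \<sigma>\<^sup>2)))"
proof -
  define w where "w = N * (a\<^sup>2 / \<sigma>\<^sup>2)"
  note borel_measurable_prod_tilt[OF order_refl, measurable]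
  interpret prob_space "PiM {..<N} (\<lambda>_. normal0 \<sigma>)" by (intro prob_space_PiM prob_space_normal0 \<sigma>)
  have sq: "(\<Prod>m<N. tilt \<sigma> b (c m))\<^sup>2 = exp w * (\<Prod>m<N. tilt \<sigma> (2 * b) (c m))" if "b\<^sup>2 = a\<^sup>2" for b c
    using that unfolding prod_power_distrib tilt_square prod.distrib
    by (simp add: w_def exp_of_nat_mult[symmetric])
  have "(sym_ratio \<sigma> a N c)\<^sup>2 = exp w / 4 * (\<Prod>m<N. tilt \<sigma> (2 * a) (c m))
      + exp w / 4 * (\<Prod>m<N. tilt \<sigma> (2 * - a) (c m)) + exp (- w) / 2" for c
  proof -
    have "(sym_ratio \<sigma> a N c)\<^sup>2 = ((\<Prod>m<N. tilt \<sigma> a (c m))\<^sup>2 + (\<Prod>m<N. tilt \<sigma> (- a) (c m))\<^sup>2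
        + 2 * ((\<Prod>m<N. tilt \<sigma> a (c m)) * (\<Prod>m<N. tilt \<sigma> (- a) (c m)))) / 4"
      by (simp add: sym_ratio_def power2_eq_square field_simps)
    then show ?thesis unfolding prod_tilt_minus w_def[symmetric] by (simp add: sq field_simps)
  qed
  then have "(\<integral>\<^sup>+c. ennreal ((sym_ratio \<sigma> a N c)\<^sup>2) \<partial>PiM {..<N} (\<lambda>_. normal0 \<sigma>))
    = (\<integral>\<^sup>+c. ennreal (exp w / 4) * ennreal (\<Prod>m<N. tilt \<sigma> (2 * a) (c m))
      + ennreal (exp w / 4) * ennreal (\<Prod>m<N. tilt \<sigma> (2 * - a) (c m)) + ennreal (exp (- w) / 2)
       \<partial>PiM {..<N} (\<lambda>_. normal0 \<sigma>))"
    by (intro nn_integral_cong) (simp add: prod_nonneg ennreal_mult[symmetric] flip: ennreal_plus)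
  also have "\<dots> = ennreal (exp w / 4) + ennreal (exp w / 4) + ennreal (exp (- w) / 2)"
    by (simp add: nn_integral_add nn_integral_cmult nn_integral_prod_tilt[OF \<sigma> order_refl] emeasure_space_1)
  also have "\<dots> = ennreal (cosh w)" by (simp add: cosh_def flip: ennreal_plus)
  finally show ?thesis by (simp add: w_def)
qed

text \<open>Integrating out entry \<open>n\<close> leaves \<open>L e\<^sup>t - e\<^sup>-\<^sup>n\<^sup>t (sinh t) / L\<close> with \<open>L\<close> the ratio of the first \<open>n\<close>
  entries; as \<open>1 / L \<ge> 2 - L\<close>, this is below an affine function of \<open>L\<close>, and \<open>L\<close> has mean \<open>1\<close>.\<close>

lemma nn_integral_sym_ratio_chi_square:
  fixes a :: real
  assumes \<sigma>: "0 < \<sigma>" and n: "n < N"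
  defines "t \<equiv> a\<^sup>2 / \<sigma>\<^sup>2"
  shows "(\<integral>\<^sup>+c. ennreal ((sym_ratio \<sigma> a (Suc n) c)\<^sup>2 / sym_ratio \<sigma> a n c) \<partial>PiM {..<N} (\<lambda>_. normal0 \<sigma>))
    \<le> ennreal (exp t - exp (- (n * t)) * sinh t)"
proof -
  let ?G = "normal0 \<sigma>" and ?P = "PiM {..<N} (\<lambda>_. normal0 \<sigma>)"
  let ?A = "\<lambda>c. \<Prod>m<n. tilt \<sigma> a (c m)" and ?B = "\<lambda>c. \<Prod>m<n. tilt \<sigma> (- a) (c m)" and ?L = "sym_ratio \<sigma> a n"
  define s where "s = exp (- (n * t)) * sinh t"
  have t: "0 \<le> t" by (simp add: t_def)
  then have s: "0 \<le> s" by (simp add: s_def)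
  have "n \<le> N" "Suc n \<le> N" using n by auto
  note borel_measurable_sym_ratio[OF this(1), measurable] borel_measurable_sym_ratio[OF this(2), measurable]
  interpret P: prob_space ?P by (intro prob_space_PiM prob_space_normal0 \<sigma>)
  define u where "u c = (exp t + s) * ?L c - 2 * s" for c
  have inner: "(\<integral>\<^sup>+z. ennreal ((sym_ratio \<sigma> a (Suc n) (c(n := z)))\<^sup>2 / ?L (c(n := z))) \<partial>?G) \<le> ennreal (u c)"
    and u: "0 \<le> u c" for c
  proof -
    have L: "0 < ?L c" by (rule sym_ratio_pos)
    have upd: "?L (c(n := z)) = ?L c" for z by (simp add: sym_ratio_def)
    have upd_Suc: "sym_ratio \<sigma> a (Suc n) (c(n := z)) = (?A c * tilt \<sigma> a z + ?B c * tilt \<sigma> (- a) z) / 2" for z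
      by (simp add: sym_ratio_def mult.commute)
    have "(\<integral>\<^sup>+z. ennreal ((sym_ratio \<sigma> a (Suc n) (c(n := z)))\<^sup>2 / ?L (c(n := z))) \<partial>?G)
        = (\<integral>\<^sup>+z. ennreal (1 / (4 * ?L c)) * ennreal ((?A c * tilt \<sigma> a z + ?B c * tilt \<sigma> (- a) z)\<^sup>2) \<partial>?G)"
      unfolding upd upd_Suc using L
      by (intro nn_integral_cong) (simp add: ennreal_mult[symmetric] power_divide)
    also have "\<dots> = ennreal (((?A c)\<^sup>2 + (?B c)\<^sup>2) * exp t + 2 * ?A c * ?B c * exp (- t)) * ennreal (1 / (4 * ?L c))"
      unfolding t_def by (subst nn_integral_cmult, measurable)
        (subst nn_integral_quadratic_tilt[OF \<sigma>], auto simp: prod_nonneg mult.commute)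
    also have "\<dots> = ennreal ((((?A c)\<^sup>2 + (?B c)\<^sup>2) * exp t + 2 * ?A c * ?B c * exp (- t)) / (4 * ?L c))"
      using L by (subst ennreal_mult[symmetric]) (auto simp: prod_nonneg)
    also have "((?A c)\<^sup>2 + (?B c)\<^sup>2) * exp t + 2 * ?A c * ?B c * exp (- t) = 4 * ((?L c)\<^sup>2 * exp t - s)"
    proof -
      have "((?A c)\<^sup>2 + (?B c)\<^sup>2) * exp t + 2 * ?A c * ?B c * exp (- t)
          = 4 * ((?L c)\<^sup>2 * exp t) - 4 * ((?A c * ?B c) * sinh t)"
        by (simp add: sym_ratio_def power2_eq_square sinh_def field_simps)
      then show ?thesis unfolding prod_tilt_minus by (simp add: s_def t_def)
    qed
    also have "4 * ((?L c)\<^sup>2 * exp t - s) / (4 * ?L c) = ?L c * exp t - s * (1 / ?L c)"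
      using L by (simp add: field_simps power2_eq_square)
    finally have eq: "(\<integral>\<^sup>+z. ennreal ((sym_ratio \<sigma> a (Suc n) (c(n := z)))\<^sup>2 / ?L (c(n := z))) \<partial>?G)
        = ennreal (?L c * exp t - s * (1 / ?L c))" .
    have "0 \<le> (?L c - 1)\<^sup>2 / ?L c" using L by simp
    also have "(?L c - 1)\<^sup>2 / ?L c = ?L c + 1 / ?L c - 2"
      using L by (simp add: field_simps power2_eq_square)
    finally have "s * (2 - ?L c) \<le> s * (1 / ?L c)" using s by (intro mult_left_mono) auto
    then have le: "?L c * exp t - s * (1 / ?L c) \<le> u c" by (simp add: u_def algebra_simps)
    then show "(\<integral>\<^sup>+z. ennreal ((sym_ratio \<sigma> a (Suc n) (c(n := z)))\<^sup>2 / ?L (c(n := z))) \<partial>?G) \<le> ennreal (u c)"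
      unfolding eq by (rule ennreal_leI)
    \<comment> \<open>By the arithmetic-geometric mean inequality \<open>(?L c)\<^sup>2\<close> is
      at least \<open>?A c * ?B c\<close>. This makes \<open>u\<close> nonnegative, so that
      \<open>ennreal (u c)\<close> loses nothing by truncation.\<close>
    have AB: "?A c * ?B c = exp (- (n * t))" unfolding prod_tilt_minus t_def by simp
    have "exp (- (n * t)) \<le> (?L c)\<^sup>2"
    proof -
      have "0 \<le> ((?A c - ?B c) / 2)\<^sup>2" by simp
      also have "\<dots> = (?L c)\<^sup>2 - ?A c * ?B c" by (simp add: sym_ratio_def power2_eq_square field_simps)
      finally show ?thesis by (simp add: AB)
    qed
    then have "s \<le> (?L c)\<^sup>2 * exp t"
      unfolding s_def using t exp_gt_zero[of t] exp_gt_zero[of "- t"]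
      by (intro mult_mono) (auto simp: sinh_def simp del: exp_gt_zero)
    then have "0 \<le> ?L c * exp t - s * (1 / ?L c)" using L by (simp add: field_simps power2_eq_square)
    then show "0 \<le> u c" using le by simp
  qed
  have [measurable]: "u \<in> borel_measurable ?P" unfolding u_def by measurable
  have "(\<integral>\<^sup>+c. ennreal ((sym_ratio \<sigma> a (Suc n) c)\<^sup>2 / ?L c) \<partial>?P)
      = (\<integral>\<^sup>+c. \<integral>\<^sup>+z. ennreal ((sym_ratio \<sigma> a (Suc n) (c(n := z)))\<^sup>2 / ?L (c(n := z))) \<partial>?G \<partial>?P)"
    by (rule nn_integral_resample) (use n prob_space_normal0[OF \<sigma>] in auto)
  also have "\<dots> \<le> (\<integral>\<^sup>+c. ennreal (u c) \<partial>?P)" by (rule nn_integral_mono) (rule inner)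
  \<comment> \<open>Adding the constant \<open>2 * s\<close> turns the integrand into a multiple of
    \<open>?L\<close>, whose mean is 1; the constant is finite and can be subtracted again.\<close>
  also have "\<dots> = (\<integral>\<^sup>+c. ennreal (u c) \<partial>?P) + ennreal (2 * s) - ennreal (2 * s)" by simp
  also have "(\<integral>\<^sup>+c. ennreal (u c) \<partial>?P) + ennreal (2 * s) = (\<integral>\<^sup>+c. ennreal (u c) + ennreal (2 * s) \<partial>?P)"
    by (simp add: nn_integral_add P.emeasure_space_1)
  also have "\<dots> = (\<integral>\<^sup>+c. ennreal (exp t + s) * ennreal (?L c) \<partial>?P)"
    using u s by (intro nn_integral_cong)
      (simp add: u_def ennreal_mult[symmetric] sym_ratio_pos less_imp_le flip: ennreal_plus)
  also have "\<dots> = ennreal (exp t + s)"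
    using nn_integral_sym_ratio[OF \<sigma>, of n N a] n by (simp add: nn_integral_cmult)
  also have "ennreal (exp t + s) - ennreal (2 * s) = ennreal (exp t - s)"
    using s by (subst ennreal_minus) auto
  finally show ?thesis by (simp add: s_def)
qed

section \<open>Elementary bounds for exponential and hyperbolic functions\<close>

text \<open>Averages \<open>exp t \<le> 1 + t + t\<^sup>2\<close> and
  \<open>exp (- t) \<le> 1 - t + t\<^sup>2\<close>; the latter comes from
  \<open>(1 - t + t\<^sup>2) * (1 + t) = 1 + t^3\<close>.\<close>

lemma cosh_le_one_plus_square:
  fixes t :: real
  assumes t: "0 \<le> t" "t \<le> 1"
  shows "cosh t \<le> 1 + t\<^sup>2"
proof -
  have "1 \<le> (1 - t + t\<^sup>2) * (1 + t)" using t by (simp add: algebra_simps power2_eq_square)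
  also have "\<dots> \<le> (1 - t + t\<^sup>2) * exp t"
    using exp_ge_add_one_self[of t] t by (intro mult_left_mono) (auto intro: add_nonneg_nonneg)
  finally have "exp (- t) \<le> 1 - t + t\<^sup>2" by (simp add: exp_minus field_simps)
  then show ?thesis using exp_bound[OF t] by (simp add: cosh_def)
qed

lemma cosh_le_exp_square:
  fixes x :: real
  assumes "0 \<le> x"
  shows "cosh x \<le> exp (x\<^sup>2)"
proof (cases "x \<le> 1")
  case True
  then have "cosh x \<le> 1 + x\<^sup>2" using assms by (rule cosh_le_one_plus_square[rotated])
  then show ?thesis using exp_ge_add_one_self[of "x\<^sup>2"] by linarith
next
  case False
  then have "x \<le> x\<^sup>2" by (simp add: power2_eq_square)
  then have "exp x \<le> exp (x\<^sup>2)" by simp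
  moreover have "exp (- x) \<le> exp x" using assms by simp
  ultimately show ?thesis unfolding cosh_def by (simp del: exp_le_cancel_iff)
qed

text \<open>For \<open>N * t \<ge> 1\<close> the term \<open>exp t\<close> alone is small enough,
  since \<open>t \<le> N * t\<^sup>2\<close>. Otherwise the form
  \<open>cosh t + (1 - exp (- (n * t))) * sinh t\<close> shows that the linear terms in
  \<open>t\<close> cancel: \<open>cosh t\<close> exceeds 1 by at most \<open>t\<^sup>2\<close>, and
  the other summand is at most \<open>n * t * (2 * t)\<close>.\<close>

lemma exp_minus_sinh_le:
  fixes t :: real and n N :: nat
  assumes t: "0 \<le> t" and n: "n < N"
  shows "exp t - exp (- (real n * t)) * sinh t \<le> exp (2 * N * t\<^sup>2)"
proof (cases "1 \<le> N * t")
  case True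
  then have "t * 1 \<le> t * (N * t)" using t by (intro mult_left_mono) auto
  moreover have "t * (N * t) = N * t\<^sup>2" by (simp add: power2_eq_square)
  moreover have "0 \<le> N * t\<^sup>2" by simp
  ultimately have "t \<le> 2 * N * t\<^sup>2" by linarith
  then have "exp t \<le> exp (2 * N * t\<^sup>2)" by simp
  moreover have "0 \<le> exp (- (n * t)) * sinh t" using t by simp
  ultimately show ?thesis by linarith
next
  case False
  have "t * 1 \<le> t * N" using n t by (intro mult_left_mono) auto
  then have t1: "t \<le> 1" using False by (simp add: mult.commute)
  have e: "exp t \<le> 1 + t + t\<^sup>2" using exp_bound[OF t t1] .
  have "1 - t \<le> exp (- t)" using exp_ge_add_one_self[of "- t"] by simp
  then have sh: "sinh t \<le> t + t\<^sup>2 / 2" using e by (simp add: sinh_def)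
  have ch: "cosh t \<le> 1 + t\<^sup>2" by (rule cosh_le_one_plus_square[OF t t1])
  have "exp t - exp (- (n * t)) * sinh t = cosh t + (1 - exp (- (n * t))) * sinh t"
    by (simp add: cosh_def sinh_def field_simps)
  also have "\<dots> \<le> (1 + t\<^sup>2) + (n * t) * (t + t\<^sup>2 / 2)"
    using ch sh t exp_ge_add_one_self[of "- (n * t)"] by (intro add_mono mult_mono) auto
  also have "\<dots> \<le> (1 + t\<^sup>2) + (n * t) * (2 * t)"
  proof -
    have "t\<^sup>2 \<le> t" using t t1 by (simp add: power2_eq_square mult_left_le)
    then show ?thesis using t by (intro add_left_mono mult_left_mono) auto
  qed
  also have "\<dots> = 1 + (1 + 2 * n) * t\<^sup>2" by (simp add: power2_eq_square algebra_simps)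
  also have "\<dots> \<le> 1 + (2 * N) * t\<^sup>2" using n by (intro add_left_mono mult_right_mono) auto
  also have "\<dots> \<le> exp (2 * N * t\<^sup>2)" using exp_ge_add_one_self[of "2 * N * t\<^sup>2"] by simp
  finally show ?thesis .
qed


subsection \<open>From couplings to adversaries\<close>


lemma sets_data_borel:
  assumes "sets M = sets (vec_borel d)"
  shows "sets (PiM {..<N} (\<lambda>_. M)) = sets (data_borel d N)"
  unfolding data_borel_def using assms by (intro sets_PiM_cong) auto

text \<open>Samples are extensional, so they are equal exactly when their \<open>d\<close> real
  entries are; the count is then a finite sum of indicators of measurable events.\<close>

lemma measurable_hamming:
  fixes N :: nat
  assumes M: "sets M = sets (vec_borel d)"
  defines "P \<equiv> PiM {..<N} (\<lambda>_. M)"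
  shows "(\<lambda>(x, y). card {n\<in>{..<N}. y n \<noteq> x n}) \<in> P \<Otimes>\<^sub>M P \<rightarrow>\<^sub>M count_space (UNIV :: nat set)"
proof -
  have sM: "space M = space (vec_borel d)" by (rule sets_eq_imp_space_eq[OF M])
  have [measurable]: "(\<lambda>z. z i) \<in> borel_measurable M" if "i < d" for i
    using that by (subst measurable_cong_sets[OF M refl]) (simp add: vec_borel_def)
  have eq: "(case p of (x, y) \<Rightarrow> card {n\<in>{..<N}. y n \<noteq> x n})
      = (\<Sum>n<N. if \<forall>i\<in>{..<d}. snd p n i = fst p n i then 0 else 1)" if "p \<in> space (P \<Otimes>\<^sub>M P)" for p
  proof -
    have "y n = x n \<longleftrightarrow> (\<forall>i\<in>{..<d}. y n i = x n i)" if "p = (x, y)" "n < N" for x y n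
    proof -
      have "x n \<in> extensional {..<d}" "y n \<in> extensional {..<d}"
        using \<open>p \<in> _\<close> that by (auto simp: P_def space_pair_measure space_PiM sM vec_borel_def PiE_iff)
      then show ?thesis by (metis extensionalityI)
    qed
    then show ?thesis
      by (auto simp: case_prod_beta sum.If_cases Int_def intro!: arg_cong[where f = card])
  qed
  have coord[measurable]: "(\<lambda>x. x n i) \<in> borel_measurable P" if "n \<in> {..<N}" "i \<in> {..<d}" for n i
    unfolding P_def using that by (intro measurable_compose[OF measurable_component_singleton, where L = borel]) auto
  have [measurable]: "Measurable.pred (P \<Otimes>\<^sub>M P) (\<lambda>p. \<forall>i\<in>{..<d}. snd p n i = fst p n i)" if "n \<in> {..<N}" for n
  proof (intro pred_intros_finite)
    fix i assume "i \<in> {..<d}"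
    then have [measurable]: "(\<lambda>p. snd p n i) \<in> borel_measurable (P \<Otimes>\<^sub>M P)" "(\<lambda>p. fst p n i) \<in> borel_measurable (P \<Otimes>\<^sub>M P)"
      using that coord by (auto intro: measurable_compose[OF measurable_fst] measurable_compose[OF measurable_snd])
    show "Measurable.pred (P \<Otimes>\<^sub>M P) (\<lambda>p. snd p n i = fst p n i)" by measurable
  qed simp
  show ?thesis
    by (subst measurable_cong[OF eq]) measurable
qed

text \<open>The sequential coupling controls only the expected number of changes, whereas an
  adversary has a hard budget. Whenever the coupling overspends, the clean data are returned
  instead; by Markov's inequality this has probability at most
  \<open>N * (\<epsilon> * \<delta>) / (\<epsilon> * N) = \<delta>\<close>.\<close>

lemma adversary_by_coupling:
  fixes L :: "nat \<Rightarrow> (nat \<Rightarrow> nat \<Rightarrow> real) \<Rightarrow> real" and N :: nat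
  assumes M: "prob_space M" "sets M = sets (vec_borel d)"
  defines "P \<equiv> PiM {..<N} (\<lambda>_. M)"
  assumes L: "\<And>n. n \<le> N \<Longrightarrow> L n \<in> borel_measurable P"
    and L_pos: "\<And>n x. x \<in> space P \<Longrightarrow> 0 < L n x"
    and L_0: "\<And>x. x \<in> space P \<Longrightarrow> L 0 x = 1"
    and L_upd: "\<And>n x z. n < N \<Longrightarrow> x \<in> space P \<Longrightarrow> z \<in> space M \<Longrightarrow> L n (x(n := z)) = L n x"
    and L_Suc: "\<And>n x. n < N \<Longrightarrow> x \<in> space P \<Longrightarrow>
      (\<integral>\<^sup>+z. ennreal (L (Suc n) (x(n := z))) \<partial>M) = ennreal (L n x)"
    and \<epsilon>: "0 < \<epsilon>" and \<delta>: "0 \<le> \<delta>" and N: "1 \<le> N"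
    and step: "\<And>n. n < N \<Longrightarrow> (\<integral>\<^sup>+x. ennreal (L n x - L (Suc n) x) \<partial>P) \<le> ennreal (\<epsilon> * \<delta>)"
  shows "\<exists>C\<in>adversaries d N \<epsilon>. \<forall>A\<in>sets P.
    emeasure (density P (L N)) A \<le> emeasure (P \<bind> C) A + ennreal \<delta>"
proof -
  interpret P: prob_space P unfolding P_def by (intro prob_space_PiM M)
  have sets_P: "sets P = sets (data_borel d N)" unfolding P_def by (rule sets_data_borel[OF M(2)])
  define hd where "hd x y = card {n\<in>{..<N}. y n \<noteq> x n}" for x y :: "nat \<Rightarrow> nat \<Rightarrow> real"
  have hd[measurable]: "(\<lambda>(x, y). hd x y) \<in> P \<Otimes>\<^sub>M P \<rightarrow>\<^sub>M count_space UNIV"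
    unfolding hd_def P_def by (rule measurable_hamming[OF M(2)])
  define h where "h x y = ennreal (real (hd x y))" for x y
  have h[measurable]: "(\<lambda>(x, y). h x y) \<in> borel_measurable (P \<Otimes>\<^sub>M P)" unfolding h_def by measurable
  have "\<exists>C \<in> P \<rightarrow>\<^sub>M prob_algebra P. P \<bind> C = density P (L N) \<and>
    (\<integral>\<^sup>+x. \<integral>\<^sup>+y. h x y \<partial>C x \<partial>P) \<le> (\<Sum>n<N. \<integral>\<^sup>+x. ennreal (L n x - L (Suc n) x) \<partial>P)"
    unfolding P_def
  proof (rule sequential_coupling[OF M(1)], unfold P_def[symmetric])
    show "h x x = 0" for x by (simp add: h_def hd_def)
    fix x y :: "nat \<Rightarrow> nat \<Rightarrow> real" and n z
    have "{m\<in>{..<N}. (y(n := z)) m \<noteq> x m} \<subseteq> insert n {m\<in>{..<N}. y m \<noteq> x m}" by auto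
    then have "hd x (y(n := z)) \<le> card (insert n {m\<in>{..<N}. y m \<noteq> x m})"
      unfolding hd_def by (intro card_mono) auto
    also have "\<dots> \<le> hd x y + 1" unfolding hd_def using card_insert_le_m1 by (simp add: card_insert_if)
    finally have "real (hd x (y(n := z))) \<le> real (hd x y) + 1" by simp
    then have "h x (y(n := z)) \<le> ennreal (real (hd x y) + 1)" unfolding h_def by (rule ennreal_leI)
    then show "h x (y(n := z)) \<le> h x y + 1" by (simp add: h_def)
  qed (fact h L L_pos L_0 L_upd L_Suc order_refl)+
  then obtain C where C[measurable]: "C \<in> P \<rightarrow>\<^sub>M prob_algebra P" and CL: "P \<bind> C = density P (L N)"
    and Ch: "(\<integral>\<^sup>+x. \<integral>\<^sup>+y. h x y \<partial>C x \<partial>P) \<le> (\<Sum>n<N. \<integral>\<^sup>+x. ennreal (L n x - L (Suc n) x) \<partial>P)"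
    by blast
  have C': "C \<in> P \<rightarrow>\<^sub>M subprob_algebra P" by (rule measurable_prob_algebraD[OF C])
  have sets_C: "sets (C x) = sets P" if "x \<in> space P" for x using sets_kernel[OF C' that] .
  note Ch
  also have "(\<Sum>n<N. \<integral>\<^sup>+x. ennreal (L n x - L (Suc n) x) \<partial>P) \<le> (\<Sum>n<N. ennreal (\<epsilon> * \<delta>))"
    by (intro sum_mono step) auto
  also have "\<dots> = ennreal (N * (\<epsilon> * \<delta>))"
    using \<epsilon> \<delta> by (simp add: ennreal_mult ennreal_of_nat_eq_real_of_nat)
  finally have Eh: "(\<integral>\<^sup>+x. \<integral>\<^sup>+y. h x y \<partial>C x \<partial>P) \<le> ennreal (N * (\<epsilon> * \<delta>))" .
  \<comment> \<open>The fallback \<open>x\<close> is at distance 0 from itself, so every value of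
    \<open>F x\<close> is within the budget.\<close>
  define F where "F x y = (if real (hd x y) \<le> \<epsilon> * N then y else x)" for x y
  have F[measurable]: "(\<lambda>(x, y). F x y) \<in> P \<Otimes>\<^sub>M P \<rightarrow>\<^sub>M P" unfolding F_def by measurable
  define C2 where "C2 x = distr (C x) P (F x)" for x
  have C2[measurable]: "C2 \<in> P \<rightarrow>\<^sub>M prob_algebra P"
    unfolding C2_def by (rule measurable_distr_prob_space2[OF C F])
  have Fx: "F x \<in> C x \<rightarrow>\<^sub>M P" if x: "x \<in> space P" for x
    using measurable_Pair2[OF F x] by (simp add: measurable_cong_sets[OF sets_C[OF x] refl])
  have "C2 \<in> adversaries d N \<epsilon>"
    unfolding adversaries_def
  proof (intro CollectI conjI ballI)
    show "C2 \<in> data_borel d N \<rightarrow>\<^sub>M prob_algebra (data_borel d N)"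
      \<comment> \<open>Kernels on \<open>P\<close> and on \<open>data_borel d N\<close> are the
        same, because only the sigma-algebra enters.\<close>
      using C2
      by (simp add: prob_algebra_def subprob_algebra_cong[OF sets_P] measurable_cong_sets[OF sets_P refl])
    fix x assume "x \<in> space (data_borel d N)"
    then have x: "x \<in> space P" by (simp add: sets_eq_imp_space_eq[OF sets_P])
    have [measurable]: "(\<lambda>y. hd x y) \<in> P \<rightarrow>\<^sub>M count_space UNIV"
      using measurable_Pair2[OF hd x] by simp
    have "hd x x = 0" by (simp add: hd_def)
    then have hF: "real (hd x (F x y)) \<le> \<epsilon> * N" for y using \<epsilon> by (simp add: F_def)
    have set: "{y \<in> space P. real (hd x y) \<le> \<epsilon> * N} \<in> sets P" by measurable
    have "AE y in C2 x. real (hd x y) \<le> \<epsilon> * N"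
      unfolding C2_def AE_distr_iff[OF Fx[OF x] set] by (rule AE_I2) (rule hF)
    then show "AE y in C2 x. real (card {n \<in> {..<N}. y n \<noteq> x n}) \<le> \<epsilon> * real N"
      by (simp add: hd_def)
  qed
  moreover have "emeasure (density P (L N)) A \<le> emeasure (P \<bind> C2) A + ennreal \<delta>" if A[measurable]: "A \<in> sets P" for A
  proof -
    have sp: "space P \<noteq> {}" by (rule P.not_empty)
    have "emeasure (density P (L N)) A = (\<integral>\<^sup>+x. emeasure (C x) A \<partial>P)"
      unfolding CL[symmetric] by (rule emeasure_bind[OF sp C' A])
    also have "\<dots> \<le> (\<integral>\<^sup>+x. emeasure (C2 x) A + ennreal (1 / (\<epsilon> * N)) * (\<integral>\<^sup>+y. h x y \<partial>C x) \<partial>P)"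
    proof (rule nn_integral_mono)
      fix x assume x[measurable]: "x \<in> space P"
      have AC[measurable]: "A \<in> sets (C x)" using A sets_C[OF x] by simp
      have hC[measurable]: "h x \<in> borel_measurable (C x)"
        using measurable_Pair2[OF h x] by (simp add: measurable_cong_sets[OF sets_C[OF x] refl])
      have FA: "F x -` A \<inter> space (C x) \<in> sets (C x)" by (rule measurable_sets[OF Fx[OF x] A])
      have "emeasure (C x) A = (\<integral>\<^sup>+y. indicator A y \<partial>C x)" by simp
      \<comment> \<open>Markov's inequality in pointwise form: where \<open>F\<close> alters the
        output, \<open>h x y / (\<epsilon> * N)\<close> exceeds 1.\<close>
      also have "\<dots> \<le> (\<integral>\<^sup>+y. indicator (F x -` A \<inter> space (C x)) y + ennreal (1 / (\<epsilon> * N)) * h x y \<partial>C x)"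
      proof (rule nn_integral_mono)
        fix y assume y: "y \<in> space (C x)"
        show "indicator A y \<le> indicator (F x -` A \<inter> space (C x)) y + ennreal (1 / (\<epsilon> * N)) * h x y"
        proof (cases "real (hd x y) \<le> \<epsilon> * N")
          case False
          then have "1 \<le> 1 / (\<epsilon> * N) * real (hd x y)" using \<epsilon> N by (simp add: field_simps)
          then have "ennreal 1 \<le> ennreal (1 / (\<epsilon> * N)) * h x y"
            unfolding h_def using \<epsilon> by (subst ennreal_mult[symmetric]) (auto intro!: ennreal_leI simp del: ennreal_1)
          then show ?thesis by (auto split: split_indicator intro: order_trans[OF _ add_increasing])
        qed (use y in \<open>auto simp: F_def split: split_indicator\<close>)
      qed
      also have "\<dots> = emeasure (C x) (F x -` A \<inter> space (C x)) + ennreal (1 / (\<epsilon> * N)) * (\<integral>\<^sup>+y. h x y \<partial>C x)"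
        using FA by (simp add: nn_integral_add nn_integral_cmult)
      also have "emeasure (C x) (F x -` A \<inter> space (C x)) = emeasure (C2 x) A"
        unfolding C2_def by (rule emeasure_distr[symmetric, OF Fx[OF x] A])
      finally show "emeasure (C x) A \<le> emeasure (C2 x) A + ennreal (1 / (\<epsilon> * N)) * (\<integral>\<^sup>+y. h x y \<partial>C x)" .
    qed
    also have "\<dots> = (\<integral>\<^sup>+x. emeasure (C2 x) A \<partial>P) + ennreal (1 / (\<epsilon> * N)) * (\<integral>\<^sup>+x. \<integral>\<^sup>+y. h x y \<partial>C x \<partial>P)"
    proof -
      have [measurable]: "(\<lambda>x. \<integral>\<^sup>+y. h x y \<partial>C x) \<in> borel_measurable P"
        by (rule nn_integral_measurable_subprob_algebra2[OF h C'])
      have [measurable]: "(\<lambda>x. emeasure (C2 x) A) \<in> borel_measurable P"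
        by (rule measurable_emeasure_kernel[OF measurable_prob_algebraD[OF C2] A])
      show ?thesis by (simp add: nn_integral_add nn_integral_cmult)
    qed
    also have "(\<integral>\<^sup>+x. emeasure (C2 x) A \<partial>P) = emeasure (P \<bind> C2) A"
      by (rule emeasure_bind[symmetric, OF sp measurable_prob_algebraD[OF C2] A])
    also have "ennreal (1 / (\<epsilon> * N)) * (\<integral>\<^sup>+x. \<integral>\<^sup>+y. h x y \<partial>C x \<partial>P) \<le> ennreal (1 / (\<epsilon> * N)) * ennreal (N * (\<epsilon> * \<delta>))"
      by (intro mult_left_mono Eh) auto
    also have "\<dots> = ennreal \<delta>" using \<epsilon> \<delta> N by (subst ennreal_mult[symmetric]) auto
    finally show ?thesis by (simp add: add_left_mono)
  qed
  ultimately show ?thesis by blast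
qed

text \<open>A linearized Cauchy-Schwarz inequality:
  \<open>v \<le> \<tau> / 2 * f + v\<^sup>2 / (2 * \<tau> * f)\<close> with
  \<open>v = \<bar>f - g\<bar>\<close>. Since \<open>f\<close> and \<open>g\<close> have integral 1,
  the integral of \<open>v\<^sup>2 / f\<close> is that of \<open>g\<^sup>2 / f\<close> minus 1,
  hence at most \<open>\<tau>\<^sup>2\<close>.\<close>

lemma l1_le_chi_square:
  fixes f g :: "'a \<Rightarrow> real"
  assumes f: "f \<in> borel_measurable P" "\<And>x. x \<in> space P \<Longrightarrow> 0 < f x" "(\<integral>\<^sup>+x. ennreal (f x) \<partial>P) = 1"
    and g: "g \<in> borel_measurable P" "\<And>x. x \<in> space P \<Longrightarrow> 0 \<le> g x" "(\<integral>\<^sup>+x. ennreal (g x) \<partial>P) = 1"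
    and chi: "(\<integral>\<^sup>+x. ennreal ((g x)\<^sup>2 / f x) \<partial>P) \<le> ennreal (1 + \<tau>\<^sup>2)" and \<tau>: "0 < \<tau>"
  shows "(\<integral>\<^sup>+x. ennreal \<bar>f x - g x\<bar> \<partial>P) \<le> ennreal \<tau>"
proof -
  note f(1)[measurable] g(1)[measurable]
  have int: "integrable P u" "integral\<^sup>L P u = enn2real (\<integral>\<^sup>+x. ennreal (u x) \<partial>P)"
    if [measurable]: "u \<in> borel_measurable P" and "\<And>x. x \<in> space P \<Longrightarrow> 0 \<le> u x" "(\<integral>\<^sup>+x. ennreal (u x) \<partial>P) < \<infinity>" for u :: "'a \<Rightarrow> real"
    using that by (auto intro!: integrableI_nonneg integral_eq_nn_integral AE_I2)
  have F: "integrable P f" "integral\<^sup>L P f = 1" using int[of f] f by (auto intro: less_imp_le)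
  have G: "integrable P g" "integral\<^sup>L P g = 1" using int[of g] g by auto
  define q where "q x = (g x)\<^sup>2 / f x" for x
  have qm[measurable]: "q \<in> borel_measurable P" unfolding q_def by measurable
  have q0: "0 \<le> q x" if "x \<in> space P" for x using f(2)[OF that] by (simp add: q_def)
  have "(\<integral>\<^sup>+x. ennreal (q x) \<partial>P) < \<infinity>" using chi by (auto simp: q_def intro: le_less_trans)
  note Q = int[OF qm q0 this]
  have "integral\<^sup>L P q \<le> 1 + \<tau>\<^sup>2"
  proof -
    have "enn2real (\<integral>\<^sup>+x. ennreal (q x) \<partial>P) \<le> 1 + \<tau>\<^sup>2"
      using chi by (intro enn2real_leI) (simp_all add: q_def)
    then show ?thesis using Q(2) by simp
  qed
  \<comment> \<open>The expansion of \<open>v\<^sup>2 / f\<close> is written out so that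
    \<open>b\<close> is a combination of three integrable functions.\<close>
  define b where "b x = \<tau> / 2 * f x + 1 / (2 * \<tau>) * (f x - 2 * g x + q x)" for x
  have le: "\<bar>f x - g x\<bar> \<le> b x" if x: "x \<in> space P" for x
  proof -
    define v where "v = \<bar>f x - g x\<bar>"
    have "0 \<le> (\<tau> * f x - v)\<^sup>2 / (2 * \<tau> * f x)" using f(2)[OF x] \<tau> by simp
    also have "\<dots> = \<tau> / 2 * f x + 1 / (2 * \<tau>) * (v\<^sup>2 / f x) - v"
      using f(2)[OF x] \<tau> by (simp add: field_simps power2_eq_square)
    also have "v\<^sup>2 / f x = f x - 2 * g x + q x"
      using f(2)[OF x] by (simp add: v_def q_def field_simps power2_eq_square)
    finally show ?thesis by (simp add: b_def v_def)
  qed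
  have "(\<integral>\<^sup>+x. ennreal \<bar>f x - g x\<bar> \<partial>P) \<le> (\<integral>\<^sup>+x. ennreal (b x) \<partial>P)"
    by (intro nn_integral_mono ennreal_leI le)
  also have "\<dots> = ennreal (integral\<^sup>L P b)"
  proof (rule nn_integral_eq_integral)
    show "integrable P b" unfolding b_def using F G Q by auto
    show "AE x in P. 0 \<le> b x" using le by (intro AE_I2) (meson abs_ge_zero order_trans)
  qed
  also have "integral\<^sup>L P b = \<tau> / 2 + 1 / (2 * \<tau>) * (integral\<^sup>L P q - 1)"
    unfolding b_def using F G Q by simp
  also have "\<dots> \<le> \<tau> / 2 + 1 / (2 * \<tau>) * \<tau>\<^sup>2"
    using \<open>integral\<^sup>L P q \<le> _\<close> \<tau> by (intro add_left_mono mult_left_mono) auto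
  also have "\<dots> = \<tau>" using \<tau> by (simp add: power2_eq_square)
  finally show ?thesis by (simp add: ennreal_leI)
qed


subsection \<open>The symmetric two-point mixture\<close>


text \<open>The likelihood ratio of the first \<open>n\<close> samples for independent uniform signs
  on the entries of \<open>\<theta>\<close>. One sign serves a whole column, so the product is over
  columns and not over samples.\<close>

definition mix_ratio :: "nat \<Rightarrow> real \<Rightarrow> (nat \<Rightarrow> real) \<Rightarrow> nat \<Rightarrow> (nat \<Rightarrow> nat \<Rightarrow> real) \<Rightarrow> real" where
  "mix_ratio d \<sigma> \<theta> n x = (\<Prod>i<d. sym_ratio \<sigma> (\<theta> i) n (\<lambda>m. x m i))"

abbreviation gauss0 :: "nat \<Rightarrow> real \<Rightarrow> (nat \<Rightarrow> real) measure" where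
  "gauss0 d \<sigma> \<equiv> PiM {..<d} (\<lambda>_. normal0 \<sigma>)"

abbreviation null_law :: "nat \<Rightarrow> nat \<Rightarrow> real \<Rightarrow> (nat \<Rightarrow> nat \<Rightarrow> real) measure" where
  "null_law d N \<sigma> \<equiv> PiM {..<N} (\<lambda>_. gauss0 d \<sigma>)"

lemma clean_law_zero: "clean_law d N \<sigma> (\<lambda>i\<in>{..<d}. 0) = null_law d N \<sigma>"
proof -
  have "gauss_vec d \<sigma> (\<lambda>i\<in>{..<d}. 0) = gauss0 d \<sigma>"
    unfolding gauss_vec_def by (rule PiM_cong) auto
  then show ?thesis by (simp add: clean_law_def)
qed

lemma sets_gauss0: "sets (gauss0 d \<sigma>) = sets (vec_borel d)"
  unfolding vec_borel_def by (rule sets_PiM_cong) auto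

lemma prob_space_gauss0: "0 < \<sigma> \<Longrightarrow> prob_space (gauss0 d \<sigma>)"
  by (intro prob_space_PiM prob_space_normal0)

lemma prob_space_null_law: "0 < \<sigma> \<Longrightarrow> prob_space (null_law d N \<sigma>)"
  by (intro prob_space_PiM prob_space_gauss0)

lemma sets_clean_law: "sets (clean_law d N \<sigma> \<mu>) = sets (data_borel d N)"
  unfolding clean_law_def data_borel_def gauss_vec_def vec_borel_def
  by (intro sets_PiM_cong) auto

lemma prob_space_clean_law: "0 < \<sigma> \<Longrightarrow> prob_space (clean_law d N \<sigma> \<mu>)"
  unfolding clean_law_def gauss_vec_def by (intro prob_space_PiM prob_space_normal_density)

text \<open>\<open>PiM_density\<close> is applied twice, first across the coordinates of one sample
  and then across samples.\<close>

lemma clean_law_eq_density: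
  assumes \<sigma>: "0 < \<sigma>"
  shows "clean_law d N \<sigma> \<mu>
    = density (null_law d N \<sigma>) (\<lambda>x. ennreal (\<Prod>m<N. \<Prod>i<d. tilt \<sigma> (\<mu> i) (x m i)))"
proof -
  have G: "gauss_vec d \<sigma> \<mu> = density (gauss0 d \<sigma>) (\<lambda>z. \<Prod>i<d. ennreal (tilt \<sigma> (\<mu> i) (z i)))"
  proof -
    have "gauss_vec d \<sigma> \<mu> = PiM {..<d} (\<lambda>i. density (normal0 \<sigma>) (\<lambda>x. ennreal (tilt \<sigma> (\<mu> i) x)))"
      by (simp only: gauss_vec_def density_normal0_tilt[OF \<sigma>])
    also have "\<dots> = density (gauss0 d \<sigma>) (\<lambda>z. \<Prod>i<d. ennreal (tilt \<sigma> (\<mu> i) (z i)))"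
    proof (rule PiM_density)
      show "prob_space (density (normal0 \<sigma>) (\<lambda>x. ennreal (tilt \<sigma> (\<mu> i) x)))" for i
        unfolding density_normal0_tilt[OF \<sigma>] by (rule prob_space_normal_density[OF \<sigma>])
    qed (auto intro: prob_space_normal0 \<sigma>)
    finally show ?thesis .
  qed
  have "clean_law d N \<sigma> \<mu> = density (null_law d N \<sigma>) (\<lambda>x. \<Prod>m<N. \<Prod>i<d. ennreal (tilt \<sigma> (\<mu> i) (x m i)))"
    unfolding clean_law_def G
  proof (rule PiM_density)
    show "prob_space (density (gauss0 d \<sigma>) (\<lambda>z. \<Prod>i<d. ennreal (tilt \<sigma> (\<mu> i) (z i))))"
      unfolding G[symmetric] unfolding gauss_vec_def by (intro prob_space_PiM prob_space_normal_density \<sigma>)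
    show "(\<lambda>z. \<Prod>i<d. ennreal (tilt \<sigma> (\<mu> i) (z i))) \<in> borel_measurable (gauss0 d \<sigma>)"
      by measurable
  qed (auto intro: prob_space_gauss0 \<sigma>)
  then show ?thesis by (simp add: prod_ennreal prod_nonneg)
qed

lemma sym_ratio_restrict:
  fixes n N :: nat
  shows "n \<le> N \<Longrightarrow> sym_ratio \<sigma> a n (\<lambda>m\<in>{..<N}. x m i) = sym_ratio \<sigma> a n (\<lambda>m. x m i)"
  by (simp add: sym_ratio_def)

lemma measurable_column:
  "i < d \<Longrightarrow> (\<lambda>x. \<lambda>m\<in>{..<N}. x m i) \<in> null_law d N \<sigma> \<rightarrow>\<^sub>M PiM {..<N} (\<lambda>_. normal0 \<sigma>)"
  by (intro measurable_restrict measurable_compose[OF measurable_component_singleton, where L = "normal0 \<sigma>"]) auto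

lemma borel_measurable_mix_ratio:
  assumes "n \<le> N"
  shows "mix_ratio d \<sigma> \<theta> n \<in> borel_measurable (null_law d N \<sigma>)"
proof -
  have "(\<lambda>x. \<Prod>i<d. sym_ratio \<sigma> (\<theta> i) n (\<lambda>m\<in>{..<N}. x m i)) \<in> borel_measurable (null_law d N \<sigma>)"
    using assms by (intro borel_measurable_prod measurable_compose[OF measurable_column borel_measurable_sym_ratio]) auto
  then show ?thesis unfolding mix_ratio_def[abs_def] using assms by (simp only: sym_ratio_restrict)
qed

lemma mix_ratio_pos: "0 < mix_ratio d \<sigma> \<theta> n x"
  unfolding mix_ratio_def by (intro prod_pos sym_ratio_pos)

lemma mix_ratio_0: "mix_ratio d \<sigma> \<theta> 0 x = 1"
  by (simp add: mix_ratio_def sym_ratio_def)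

lemma mix_ratio_upd: "mix_ratio d \<sigma> \<theta> n (x(n := z)) = mix_ratio d \<sigma> \<theta> n x"
  by (simp add: mix_ratio_def sym_ratio_def)

text \<open>The martingale property of likelihood ratios: the entries of the new sample are
  independent and each tilt has mean 1, so the last factor of every tilt product disappears.\<close>

lemma nn_integral_mix_ratio_Suc:
  assumes \<sigma>: "0 < \<sigma>"
  shows "(\<integral>\<^sup>+z. ennreal (mix_ratio d \<sigma> \<theta> (Suc n) (x(n := z))) \<partial>gauss0 d \<sigma>) = ennreal (mix_ratio d \<sigma> \<theta> n x)"
proof -
  interpret G: prob_space "normal0 \<sigma>" by (rule prob_space_normal0[OF \<sigma>])
  interpret product_sigma_finite "\<lambda>_. normal0 \<sigma>" by standard
  let ?A = "\<lambda>a i. \<Prod>m<n. tilt \<sigma> a (x m i)"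
  have "(\<integral>\<^sup>+z. ennreal (mix_ratio d \<sigma> \<theta> (Suc n) (x(n := z))) \<partial>gauss0 d \<sigma>)
      = (\<integral>\<^sup>+z. (\<Prod>i<d. ennreal (?A (\<theta> i) i / 2) * ennreal (tilt \<sigma> (\<theta> i) (z i))
          + ennreal (?A (- \<theta> i) i / 2) * ennreal (tilt \<sigma> (- \<theta> i) (z i))) \<partial>gauss0 d \<sigma>)"
  proof (rule nn_integral_cong)
    fix z
    have "ennreal (mix_ratio d \<sigma> \<theta> (Suc n) (x(n := z)))
        = (\<Prod>i<d. ennreal (sym_ratio \<sigma> (\<theta> i) (Suc n) (\<lambda>m. (x(n := z)) m i)))"
      unfolding mix_ratio_def by (rule prod_ennreal[symmetric]) (simp add: sym_ratio_pos less_imp_le)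
    also have "\<dots> = (\<Prod>i<d. ennreal (?A (\<theta> i) i / 2) * ennreal (tilt \<sigma> (\<theta> i) (z i))
          + ennreal (?A (- \<theta> i) i / 2) * ennreal (tilt \<sigma> (- \<theta> i) (z i)))"
    proof (rule prod.cong[OF refl])
      fix i
      have "sym_ratio \<sigma> (\<theta> i) (Suc n) (\<lambda>m. (x(n := z)) m i)
          = ?A (\<theta> i) i / 2 * tilt \<sigma> (\<theta> i) (z i) + ?A (- \<theta> i) i / 2 * tilt \<sigma> (- \<theta> i) (z i)"
        by (simp add: sym_ratio_def field_simps)
      then show "ennreal (sym_ratio \<sigma> (\<theta> i) (Suc n) (\<lambda>m. (x(n := z)) m i))
          = ennreal (?A (\<theta> i) i / 2) * ennreal (tilt \<sigma> (\<theta> i) (z i))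
          + ennreal (?A (- \<theta> i) i / 2) * ennreal (tilt \<sigma> (- \<theta> i) (z i))"
        by (simp only: ennreal_mult[symmetric] ennreal_plus[symmetric] prod_nonneg tilt_nonneg
              divide_nonneg_nonneg mult_nonneg_nonneg zero_le_numeral)
    qed
    finally show "ennreal (mix_ratio d \<sigma> \<theta> (Suc n) (x(n := z)))
        = (\<Prod>i<d. ennreal (?A (\<theta> i) i / 2) * ennreal (tilt \<sigma> (\<theta> i) (z i))
          + ennreal (?A (- \<theta> i) i / 2) * ennreal (tilt \<sigma> (- \<theta> i) (z i)))" .
  qed
  also have "\<dots> = (\<Prod>i<d. \<integral>\<^sup>+t. ennreal (?A (\<theta> i) i / 2) * ennreal (tilt \<sigma> (\<theta> i) t)
          + ennreal (?A (- \<theta> i) i / 2) * ennreal (tilt \<sigma> (- \<theta> i) t) \<partial>normal0 \<sigma>)"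
    by (rule product_nn_integral_prod) auto
  also have "\<dots> = (\<Prod>i<d. ennreal (?A (\<theta> i) i / 2) + ennreal (?A (- \<theta> i) i / 2))"
    by (simp add: nn_integral_add nn_integral_cmult nn_integral_tilt[OF \<sigma>])
  also have "\<dots> = (\<Prod>i<d. ennreal (sym_ratio \<sigma> (\<theta> i) n (\<lambda>m. x m i)))"
  proof (rule prod.cong[OF refl])
    fix i
    show "ennreal (?A (\<theta> i) i / 2) + ennreal (?A (- \<theta> i) i / 2) = ennreal (sym_ratio \<sigma> (\<theta> i) n (\<lambda>m. x m i))"
      unfolding sym_ratio_def add_divide_distrib by (rule ennreal_plus[symmetric]) (auto intro: prod_nonneg)
  qed
  also have "\<dots> = ennreal (mix_ratio d \<sigma> \<theta> n x)"
    unfolding mix_ratio_def by (rule prod_ennreal) (simp add: sym_ratio_pos less_imp_le)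
  finally show ?thesis .
qed

lemma prod_mono_ennreal:
  fixes f g :: "'i \<Rightarrow> ennreal"
  assumes "\<And>i. i \<in> I \<Longrightarrow> f i \<le> g i"
  shows "(\<Prod>i\<in>I. f i) \<le> (\<Prod>i\<in>I. g i)"
  using assms by (induction I rule: infinite_finite_induct) (auto intro!: mult_mono)

lemma nn_integral_mix_columns:
  assumes \<sigma>: "0 < \<sigma>"
    and g: "\<And>i. i < d \<Longrightarrow> g i \<in> borel_measurable (PiM {..<N} (\<lambda>_. normal0 \<sigma>))"
      "\<And>i c. i < d \<Longrightarrow> 0 \<le> g i c"
    and h: "\<And>x. h x = (\<Prod>i<d. g i (\<lambda>m\<in>{..<N}. x m i))"
  shows "(\<integral>\<^sup>+x. ennreal (h x) \<partial>null_law d N \<sigma>) = (\<Prod>i<d. \<integral>\<^sup>+c. ennreal (g i c) \<partial>PiM {..<N} (\<lambda>_. normal0 \<sigma>))"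
proof -
  have "(\<integral>\<^sup>+x. ennreal (h x) \<partial>null_law d N \<sigma>) = (\<integral>\<^sup>+x. (\<Prod>i<d. ennreal (g i (\<lambda>m\<in>{..<N}. x m i))) \<partial>null_law d N \<sigma>)"
    unfolding h using g(2) by (intro nn_integral_cong prod_ennreal[symmetric]) auto
  also have "\<dots> = (\<Prod>i<d. \<integral>\<^sup>+c. ennreal (g i c) \<partial>PiM {..<N} (\<lambda>_. normal0 \<sigma>))"
    by (rule nn_integral_columns[OF prob_space_normal0[OF \<sigma>]]) (use g(1) in measurable)
  finally show ?thesis .
qed

lemma nn_integral_mix_ratio:
  assumes \<sigma>: "0 < \<sigma>" and n: "n \<le> N"
  shows "(\<integral>\<^sup>+x. ennreal (mix_ratio d \<sigma> \<theta> n x) \<partial>null_law d N \<sigma>) = 1"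
  by (subst nn_integral_mix_columns[OF \<sigma>, where g = "\<lambda>i. sym_ratio \<sigma> (\<theta> i) n"])
     (auto simp: mix_ratio_def sym_ratio_restrict n nn_integral_sym_ratio[OF \<sigma> n] sym_ratio_pos less_imp_le
       borel_measurable_sym_ratio)

text \<open>Numerator and denominator are both products over columns, so the expectation factorizes.
  The exponents \<open>b\<close> are left free because the second and third terms of the lower bound
  estimate the factors differently.\<close>

lemma nn_integral_mix_ratio_chi_square:
  assumes \<sigma>: "0 < \<sigma>" and n: "n < N"
    and b: "\<And>i. i < d \<Longrightarrow> exp ((\<theta> i)\<^sup>2 / \<sigma>\<^sup>2) - exp (- (n * ((\<theta> i)\<^sup>2 / \<sigma>\<^sup>2))) * sinh ((\<theta> i)\<^sup>2 / \<sigma>\<^sup>2) \<le> exp (b i)"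
  shows "(\<integral>\<^sup>+x. ennreal ((mix_ratio d \<sigma> \<theta> (Suc n) x)\<^sup>2 / mix_ratio d \<sigma> \<theta> n x) \<partial>null_law d N \<sigma>) \<le> ennreal (exp (\<Sum>i<d. b i))"
proof -
  let ?g = "\<lambda>i c. (sym_ratio \<sigma> (\<theta> i) (Suc n) c)\<^sup>2 / sym_ratio \<sigma> (\<theta> i) n c"
  have "n \<le> N" "Suc n \<le> N" using n by auto
  note borel_measurable_sym_ratio[OF this(1), measurable] borel_measurable_sym_ratio[OF this(2), measurable]
  have "(\<integral>\<^sup>+x. ennreal ((mix_ratio d \<sigma> \<theta> (Suc n) x)\<^sup>2 / mix_ratio d \<sigma> \<theta> n x) \<partial>null_law d N \<sigma>)
      = (\<Prod>i<d. \<integral>\<^sup>+c. ennreal (?g i c) \<partial>PiM {..<N} (\<lambda>_. normal0 \<sigma>))"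
  proof (rule nn_integral_mix_columns[OF \<sigma>])
    show "(mix_ratio d \<sigma> \<theta> (Suc n) x)\<^sup>2 / mix_ratio d \<sigma> \<theta> n x = (\<Prod>i<d. ?g i (\<lambda>m\<in>{..<N}. x m i))" for x
      unfolding mix_ratio_def prod_power_distrib prod_dividef[symmetric] using n by (simp add: sym_ratio_restrict)
    show "?g i \<in> borel_measurable (PiM {..<N} (\<lambda>_. normal0 \<sigma>))" for i by measurable
    show "0 \<le> ?g i c" for i c by (simp add: sym_ratio_pos less_imp_le)
  qed
  also have "\<dots> \<le> (\<Prod>i<d. ennreal (exp (b i)))"
  proof (rule prod_mono_ennreal)
    fix i assume "i \<in> {..<d}"
    then show "(\<integral>\<^sup>+c. ennreal (?g i c) \<partial>PiM {..<N} (\<lambda>_. normal0 \<sigma>)) \<le> ennreal (exp (b i))"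
      using b[of i] by (intro order_trans[OF nn_integral_sym_ratio_chi_square[OF \<sigma> n]] ennreal_leI) auto
  qed
  also have "\<dots> = ennreal (exp (\<Sum>i<d. b i))" by (simp add: prod_ennreal exp_sum)
  finally show ?thesis .
qed

lemma nn_integral_mix_ratio_square:
  assumes \<sigma>: "0 < \<sigma>"
  shows "(\<integral>\<^sup>+x. ennreal ((mix_ratio d \<sigma> \<theta> N x)\<^sup>2) \<partial>null_law d N \<sigma>) \<le> ennreal (exp (\<Sum>i<d. (N * ((\<theta> i)\<^sup>2 / \<sigma>\<^sup>2))\<^sup>2))"
proof -
  note borel_measurable_sym_ratio[OF order_refl, measurable]
  have "(\<integral>\<^sup>+x. ennreal ((mix_ratio d \<sigma> \<theta> N x)\<^sup>2) \<partial>null_law d N \<sigma>)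
      = (\<Prod>i<d. \<integral>\<^sup>+c. ennreal ((sym_ratio \<sigma> (\<theta> i) N c)\<^sup>2) \<partial>PiM {..<N} (\<lambda>_. normal0 \<sigma>))"
  proof (rule nn_integral_mix_columns[OF \<sigma>])
    show "(mix_ratio d \<sigma> \<theta> N x)\<^sup>2 = (\<Prod>i<d. (sym_ratio \<sigma> (\<theta> i) N (\<lambda>m\<in>{..<N}. x m i))\<^sup>2)" for x
      unfolding mix_ratio_def prod_power_distrib by (simp add: sym_ratio_restrict)
    show "(\<lambda>c. (sym_ratio \<sigma> (\<theta> i) N c)\<^sup>2) \<in> borel_measurable (PiM {..<N} (\<lambda>_. normal0 \<sigma>))" for i by measurable
  qed simp
  also have "\<dots> \<le> (\<Prod>i<d. ennreal (exp ((N * ((\<theta> i)\<^sup>2 / \<sigma>\<^sup>2))\<^sup>2)))"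
    unfolding nn_integral_sym_ratio_square[OF \<sigma>]
    by (intro prod_mono_ennreal ennreal_leI cosh_le_exp_square) auto
  also have "\<dots> = ennreal (exp (\<Sum>i<d. (N * ((\<theta> i)\<^sup>2 / \<sigma>\<^sup>2))\<^sup>2))" by (simp add: prod_ennreal exp_sum)
  finally show ?thesis .
qed

text \<open>Multiplying out the two-term sums gives one summand per sign vector, each the likelihood
  ratio of a Gaussian law with a fixed mean.\<close>

lemma mix_ratio_eq_average:
  "mix_ratio d \<sigma> \<theta> N x
    = (\<Sum>\<eta>\<in>PiE {..<d} (\<lambda>_. {1, -1}). \<Prod>m<N. \<Prod>i<d. tilt \<sigma> (\<eta> i * \<theta> i) (x m i)) / 2 ^ d"
proof -
  have "mix_ratio d \<sigma> \<theta> N x = (\<Prod>i<d. \<Sum>s\<in>{1, -1}. \<Prod>m<N. tilt \<sigma> (s * \<theta> i) (x m i)) / 2 ^ d"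
    by (simp add: mix_ratio_def sym_ratio_def prod_dividef)
  also have "(\<Prod>i<d. \<Sum>s\<in>{1, -1}. \<Prod>m<N. tilt \<sigma> (s * \<theta> i) (x m i))
      = (\<Sum>\<eta>\<in>PiE {..<d} (\<lambda>_. {1, -1}). \<Prod>i<d. \<Prod>m<N. tilt \<sigma> (\<eta> i * \<theta> i) (x m i))"
    by (rule prod_sum_PiE) auto
  also have "\<dots> = (\<Sum>\<eta>\<in>PiE {..<d} (\<lambda>_. {1, -1}). \<Prod>m<N. \<Prod>i<d. tilt \<sigma> (\<eta> i * \<theta> i) (x m i))"
    by (intro sum.cong refl prod.swap)
  finally show ?thesis .
qed

text \<open>The mixture is the uniform average of \<open>2 ^ d\<close> clean laws, so a bound valid
  for each of them passes to it. This compares the Bayes error with the worst-case error.\<close>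

lemma emeasure_mixture_le:
  assumes \<sigma>: "0 < \<sigma>" and B[measurable]: "B \<in> sets (null_law d N \<sigma>)" and \<beta>: "0 \<le> \<beta>"
    and le: "\<And>\<eta>. \<eta> \<in> PiE {..<d} (\<lambda>_. {1, -1}) \<Longrightarrow>
      emeasure (clean_law d N \<sigma> (\<lambda>i\<in>{..<d}. \<eta> i * \<theta> i)) B \<le> ennreal \<beta>"
  shows "emeasure (density (null_law d N \<sigma>) (mix_ratio d \<sigma> \<theta> N)) B \<le> ennreal \<beta>"
proof -
  let ?H = "PiE {..<d} (\<lambda>_. {1, -1 :: real})" and ?P = "null_law d N \<sigma>"
  let ?q = "\<lambda>\<eta> x. \<Prod>m<N. \<Prod>i<d. tilt \<sigma> (\<eta> i * \<theta> i) (x m i)"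
  have H: "finite ?H" "card ?H = 2 ^ d" by (auto simp: finite_PiE card_PiE numeral_2_eq_2)
  have coord[measurable]: "(\<lambda>x. x m i) \<in> borel_measurable ?P" if "m \<in> {..<N}" "i \<in> {..<d}" for m i
    using that by (intro measurable_compose[OF measurable_component_singleton, where L = borel]) auto
  have q[measurable]: "?q \<eta> \<in> borel_measurable ?P" for \<eta> by measurable
  have "emeasure (density ?P (mix_ratio d \<sigma> \<theta> N)) B = (\<integral>\<^sup>+x. ennreal (mix_ratio d \<sigma> \<theta> N x) * indicator B x \<partial>?P)"
    using borel_measurable_mix_ratio[of N N d \<sigma> \<theta>] by (simp add: emeasure_density)
  also have "\<dots> = (\<integral>\<^sup>+x. (\<Sum>\<eta>\<in>?H. ennreal (1 / 2 ^ d) * (ennreal (?q \<eta> x) * indicator B x)) \<partial>?P)"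
  proof (rule nn_integral_cong)
    fix x
    have q0: "0 \<le> ?q \<eta> x" for \<eta> by (intro prod_nonneg tilt_nonneg)
    have "mix_ratio d \<sigma> \<theta> N x = 1 / 2 ^ d * (\<Sum>\<eta>\<in>?H. ?q \<eta> x)"
      unfolding mix_ratio_eq_average by (simp only: divide_inverse mult_1_left mult.commute)
    then have "ennreal (mix_ratio d \<sigma> \<theta> N x) = ennreal (1 / 2 ^ d) * ennreal (\<Sum>\<eta>\<in>?H. ?q \<eta> x)"
      by (simp only: ennreal_mult sum_nonneg q0 zero_le_divide_1_iff zero_le_power zero_le_numeral)
    also have "ennreal (\<Sum>\<eta>\<in>?H. ?q \<eta> x) = (\<Sum>\<eta>\<in>?H. ennreal (?q \<eta> x))"
      by (rule sum_ennreal[symmetric]) (rule q0)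
    finally show "ennreal (mix_ratio d \<sigma> \<theta> N x) * indicator B x
        = (\<Sum>\<eta>\<in>?H. ennreal (1 / 2 ^ d) * (ennreal (?q \<eta> x) * indicator B x))"
      by (simp only: sum_distrib_left sum_distrib_right mult.assoc)
  qed
  also have "\<dots> = (\<Sum>\<eta>\<in>?H. ennreal (1 / 2 ^ d) * (\<integral>\<^sup>+x. ennreal (?q \<eta> x) * indicator B x \<partial>?P))"
  proof (subst nn_integral_sum)
    have m: "(\<lambda>x. ennreal (?q \<eta> x) * indicator B x) \<in> borel_measurable ?P" for \<eta> by measurable
    then show "(\<lambda>x. ennreal (1 / 2 ^ d) * (ennreal (?q \<eta> x) * indicator B x)) \<in> borel_measurable ?P" for \<eta>
      by (rule borel_measurable_times_ennreal[OF borel_measurable_const])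
    show "(\<Sum>\<eta>\<in>?H. \<integral>\<^sup>+x. ennreal (1 / 2 ^ d) * (ennreal (?q \<eta> x) * indicator B x) \<partial>?P)
        = (\<Sum>\<eta>\<in>?H. ennreal (1 / 2 ^ d) * (\<integral>\<^sup>+x. ennreal (?q \<eta> x) * indicator B x \<partial>?P))"
      by (intro sum.cong refl nn_integral_cmult m)
  qed
  also have "\<dots> \<le> (\<Sum>\<eta>\<in>?H. ennreal (1 / 2 ^ d) * ennreal \<beta>)"
  proof (intro sum_mono mult_left_mono)
    fix \<eta> assume "\<eta> \<in> ?H"
    have "clean_law d N \<sigma> (\<lambda>i\<in>{..<d}. \<eta> i * \<theta> i) = density ?P (\<lambda>x. ennreal (?q \<eta> x))"
      unfolding clean_law_eq_density[OF \<sigma>]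
      by (intro arg_cong2[where f = density] refl ext arg_cong[where f = ennreal] prod.cong) auto
    then have "emeasure (clean_law d N \<sigma> (\<lambda>i\<in>{..<d}. \<eta> i * \<theta> i)) B = (\<integral>\<^sup>+x. ennreal (?q \<eta> x) * indicator B x \<partial>?P)"
      by (simp only:) (rule emeasure_density, measurable)
    then show "(\<integral>\<^sup>+x. ennreal (?q \<eta> x) * indicator B x \<partial>?P) \<le> ennreal \<beta>"
      using le[OF \<open>\<eta> \<in> ?H\<close>] by (simp only:)
  qed auto
  also have "\<dots> = ennreal (real (2 ^ d)) * (ennreal (1 / 2 ^ d) * ennreal \<beta>)"
    using H by (simp add: ennreal_of_nat_eq_real_of_nat)
  also have "\<dots> = ennreal \<beta>" using \<beta> by (simp add: ennreal_mult[symmetric])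
  finally show ?thesis .
qed


subsection \<open>Testing errors\<close>


text \<open>The idle adversary. It relates the type-II error to clean laws, and it is the attack
  used for the term without contamination.\<close>

lemma return_in_adversaries:
  assumes "0 \<le> \<epsilon>"
  shows "return (data_borel d N) \<in> adversaries d N \<epsilon>"
  unfolding adversaries_def
proof (intro CollectI conjI ballI)
  let ?D = "data_borel d N"
  show "return ?D \<in> ?D \<rightarrow>\<^sub>M prob_algebra ?D"
    by (rule measurable_prob_algebraI) (auto intro: prob_space_return)
  fix x assume x: "x \<in> space ?D"
  have D: "PiM {..<N} (\<lambda>_. vec_borel d) = ?D" by (simp add: data_borel_def)
  have [measurable]: "(\<lambda>y. card {n\<in>{..<N}. y n \<noteq> x n}) \<in> ?D \<rightarrow>\<^sub>M count_space UNIV"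
    using measurable_Pair2[OF measurable_hamming[OF refl, where d = d and N = N, unfolded D] x]
    by (simp only: prod.case)
  have "Measurable.pred ?D (\<lambda>y. real (card {n\<in>{..<N}. y n \<noteq> x n}) \<le> \<epsilon> * real N)" by measurable
  from AE_return[OF x this] show "AE y in return ?D x. real (card {n\<in>{..<N}. y n \<noteq> x n}) \<le> \<epsilon> * real N"
    using assms by simp
qed

lemma observed_law_return:
  "observed_law d N \<sigma> \<mu> (return (data_borel d N)) = clean_law d N \<sigma> \<mu>"
proof -
  have "return (data_borel d N) = return (clean_law d N \<sigma> \<mu>)"
    by (intro ext return_cong) (simp add: sets_clean_law)
  then show ?thesis by (simp add: observed_law_def bind_return')
qed

lemma prob_space_observed_law:
  assumes \<sigma>: "0 < \<sigma>" and C: "C \<in> adversaries d N \<epsilon>"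
  shows "prob_space (observed_law d N \<sigma> \<mu> C)"
proof -
  have C': "C \<in> clean_law d N \<sigma> \<mu> \<rightarrow>\<^sub>M prob_algebra (data_borel d N)"
    using C by (simp add: adversaries_def measurable_cong_sets[OF sets_clean_law refl])
  have cl: "clean_law d N \<sigma> \<mu> \<in> space (prob_algebra (clean_law d N \<sigma> \<mu>))"
    by (simp add: space_prob_algebra prob_space_clean_law \<sigma>)
  show ?thesis unfolding observed_law_def by (rule prob_space_bind'[OF cl C'])
qed

text \<open>The error is a supremum of reals, so boundedness has to be checked: all values are
  probabilities.\<close>

lemma measure_observed_law_le_type1_error:
  assumes \<sigma>: "0 < \<sigma>" and C: "C \<in> adversaries d N \<epsilon>"
  shows "measure (observed_law d N \<sigma> (\<lambda>i\<in>{..<d}. 0) C) {x\<in>space (data_borel d N). \<phi> x = 1}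
    \<le> type1_error d N \<sigma> \<epsilon> \<phi>"
  unfolding type1_error_def
proof (rule cSUP_upper[OF C], rule bdd_aboveI2)
  fix C assume "C \<in> adversaries d N \<epsilon>"
  then interpret prob_space "observed_law d N \<sigma> (\<lambda>i\<in>{..<d}. 0) C" by (rule prob_space_observed_law[OF \<sigma>])
  show "measure (observed_law d N \<sigma> (\<lambda>i\<in>{..<d}. 0) C) {x\<in>space (data_borel d N). \<phi> x = 1} \<le> 1" by simp
qed

lemma measure_observed_law_le_type2_error:
  assumes \<sigma>: "0 < \<sigma>" and C: "C \<in> adversaries d N \<epsilon>" and \<mu>: "\<mu> \<in> alternative p d K \<rho>"
  shows "measure (observed_law d N \<sigma> \<mu> C) {x\<in>space (data_borel d N). \<phi> x = 0}
    \<le> type2_error p d K \<rho> N \<sigma> \<epsilon> \<phi>"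
proof -
  have le1: "measure (observed_law d N \<sigma> \<mu> C) {x\<in>space (data_borel d N). \<phi> x = 0} \<le> 1"
    if "C \<in> adversaries d N \<epsilon>" for \<mu> C
  proof -
    interpret prob_space "observed_law d N \<sigma> \<mu> C" using that by (rule prob_space_observed_law[OF \<sigma>])
    show ?thesis by simp
  qed
  have "measure (observed_law d N \<sigma> \<mu> C) {x\<in>space (data_borel d N). \<phi> x = 0}
      \<le> (SUP C\<in>adversaries d N \<epsilon>. measure (observed_law d N \<sigma> \<mu> C) {x\<in>space (data_borel d N). \<phi> x = 0})"
    using le1 by (intro cSUP_upper[OF C] bdd_aboveI2) auto
  also have "\<dots> \<le> type2_error p d K \<rho> N \<sigma> \<epsilon> \<phi>"
    unfolding type2_error_def
    \<comment> \<open>The inner suprema are at most 1, where \<open>C\<close> witnesses that the set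
      of adversaries is nonempty.\<close>
    using le1 C by (intro cSUP_upper[OF \<mu>] bdd_aboveI2 cSUP_least) auto
  finally show ?thesis .
qed

text \<open>Le Cam's argument. Under the mixture the rejection and acceptance regions have total
  mass 1. The first is transferred to the attacked null at cost \<open>\<delta>\<close>, the second
  is an average of type-II errors against the idle adversary.\<close>

lemma one_le_sum_of_errors:
  assumes \<sigma>: "0 < \<sigma>" and \<epsilon>: "0 \<le> \<epsilon>" and \<phi>: "is_test d N \<phi>"
    and K: "pco_set p d K" and \<theta>: "\<theta> \<in> K" "\<rho> \<le> lp_norm p d \<theta>"
    and C: "C \<in> adversaries d N \<epsilon>" and \<delta>: "0 \<le> \<delta>"
    and le: "\<And>A. A \<in> sets (null_law d N \<sigma>) \<Longrightarrow>
      emeasure (density (null_law d N \<sigma>) (mix_ratio d \<sigma> \<theta> N)) A \<le> emeasure (null_law d N \<sigma> \<bind> C) A + ennreal \<delta>"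
  shows "1 \<le> type1_error d N \<sigma> \<epsilon> \<phi> + type2_error p d K \<rho> N \<sigma> \<epsilon> \<phi> + \<delta>"
proof -
  let ?P = "null_law d N \<sigma>" and ?D = "data_borel d N"
  let ?A = "{x\<in>space ?D. \<phi> x = 1}" and ?B = "{x\<in>space ?D. \<phi> x = 0}"
  let ?Q = "density ?P (mix_ratio d \<sigma> \<theta> N)"
  let ?t1 = "type1_error d N \<sigma> \<epsilon> \<phi>" and ?t2 = "type2_error p d K \<rho> N \<sigma> \<epsilon> \<phi>"
  have \<phi>m[measurable]: "\<phi> \<in> ?D \<rightarrow>\<^sub>M count_space {0, 1}" using \<phi> by (simp add: is_test_def)
  have sets_P: "sets ?P = sets ?D" by (rule sets_data_borel[OF sets_gauss0])
  have "\<phi> -` {v} \<inter> space ?D \<in> sets ?D" if "v \<in> {0, 1}" for v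
    by (rule measurable_sets[OF \<phi>m]) (use that in auto)
  moreover have "\<phi> -` {v} \<inter> space ?D = {x\<in>space ?D. \<phi> x = v}" for v by auto
  ultimately have AB: "?A \<in> sets ?D" "?B \<in> sets ?D" by (metis insertCI)+
  have "\<phi> x \<in> {0, 1}" if "x \<in> space ?D" for x using measurable_space[OF \<phi>m that] by simp
  then have un: "?A \<union> ?B = space ?P" unfolding sets_eq_imp_space_eq[OF sets_P] by blast
  have "emeasure ?Q ?A \<le> emeasure (?P \<bind> C) ?A + ennreal \<delta>" using AB sets_P by (intro le) simp
  also have "?P \<bind> C = observed_law d N \<sigma> (\<lambda>i\<in>{..<d}. 0) C" by (simp add: observed_law_def clean_law_zero)
  also have "emeasure (observed_law d N \<sigma> (\<lambda>i\<in>{..<d}. 0) C) ?A \<le> ennreal ?t1"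
  proof -
    interpret prob_space "observed_law d N \<sigma> (\<lambda>i\<in>{..<d}. 0) C" by (rule prob_space_observed_law[OF \<sigma> C])
    show ?thesis unfolding emeasure_eq_measure
      by (rule ennreal_leI) (rule measure_observed_law_le_type1_error[OF \<sigma> C])
  qed
  finally have QA: "emeasure ?Q ?A \<le> ennreal ?t1 + ennreal \<delta>" by (simp add: add_right_mono)
  have t2: "measure (clean_law d N \<sigma> \<mu>) ?B \<le> ?t2" if "\<mu> \<in> alternative p d K \<rho>" for \<mu>
    using measure_observed_law_le_type2_error[OF \<sigma> return_in_adversaries[OF \<epsilon>] that, where \<phi> = \<phi>]
    by (simp add: observed_law_return)
  have t1: "0 \<le> ?t1"
    using measure_observed_law_le_type1_error[OF \<sigma> C, of \<phi>] by (rule order_trans[rotated]) simp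
  have alt: "(\<lambda>i\<in>{..<d}. \<eta> i * \<theta> i) \<in> alternative p d K \<rho>" if "\<eta> \<in> PiE {..<d} (\<lambda>_. {1, -1})" for \<eta>
  proof -
    have \<eta>: "\<bar>\<eta> i\<bar> = 1" if "i < d" for i using PiE_mem[OF \<open>\<eta> \<in> _\<close>, of i] that by auto
    have "(\<lambda>i\<in>{..<d}. \<eta> i * \<theta> i) \<in> K"
      by (rule pco_solid[OF K \<theta>(1)]) (auto simp: abs_mult \<eta>)
    moreover have "lp_norm p d (\<lambda>i\<in>{..<d}. \<eta> i * \<theta> i) = lp_norm p d \<theta>"
      by (simp add: lp_norm_def abs_mult \<eta>)
    ultimately show ?thesis using \<theta>(2) by (simp add: alternative_def)
  qed
  \<comment> \<open>The all-ones sign vector supplies a member of the alternative, and with it the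
    lower bound 0 for the supremum \<open>?t2\<close>.\<close>
  have "(\<lambda>i\<in>{..<d}. 1) \<in> PiE {..<d} (\<lambda>_. {1, -1 :: real})" by auto
  from t2[OF alt[OF this]] have t2_nonneg: "0 \<le> ?t2" by (rule order_trans[rotated]) simp
  have QB: "emeasure ?Q ?B \<le> ennreal ?t2"
  proof (rule emeasure_mixture_le[OF \<sigma> _ t2_nonneg])
    show "?B \<in> sets ?P" using AB sets_P by simp
    fix \<eta> assume \<eta>: "\<eta> \<in> PiE {..<d} (\<lambda>_. {1, -1 :: real})"
    interpret prob_space "clean_law d N \<sigma> (\<lambda>i\<in>{..<d}. \<eta> i * \<theta> i)" by (rule prob_space_clean_law[OF \<sigma>])
    show "emeasure (clean_law d N \<sigma> (\<lambda>i\<in>{..<d}. \<eta> i * \<theta> i)) ?B \<le> ennreal ?t2"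
      unfolding emeasure_eq_measure by (rule ennreal_leI) (rule t2[OF alt[OF \<eta>]])
  qed
  have "1 = emeasure ?Q (space ?P)"
    using nn_integral_mix_ratio[OF \<sigma> order_refl, where d = d and N = N and \<theta> = \<theta>] borel_measurable_mix_ratio[of N N d \<sigma> \<theta>]
    by (simp add: emeasure_density cong: nn_integral_cong)
  also have "\<dots> \<le> emeasure ?Q ?A + emeasure ?Q ?B"
    unfolding un[symmetric] using AB sets_P by (intro emeasure_subadditive) auto
  also have "\<dots> \<le> ennreal ?t1 + ennreal \<delta> + ennreal ?t2" by (intro add_mono QA QB)
  also have "\<dots> = ennreal (?t1 + ?t2 + \<delta>)" using t1 t2_nonneg \<delta> by (simp add: ac_simps flip: ennreal_plus)
  finally show ?thesis by simp
qed

text \<open>The adversary is idle, and \<open>l1_le_chi_square\<close> is applied with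
  \<open>f = 1\<close>, where its hypothesis is a bound on the second moment of the likelihood
  ratio.\<close>

lemma one_le_sum_of_errors_of_chi_square:
  assumes \<sigma>: "0 < \<sigma>" and \<epsilon>: "0 \<le> \<epsilon>" and \<phi>: "is_test d N \<phi>"
    and K: "pco_set p d K" and \<theta>: "\<theta> \<in> K" "\<rho> \<le> lp_norm p d \<theta>" and l: "0 < l"
    and chi: "exp (\<Sum>i<d. (N * ((\<theta> i)\<^sup>2 / \<sigma>\<^sup>2))\<^sup>2) \<le> 1 + l\<^sup>2"
  shows "1 \<le> type1_error d N \<sigma> \<epsilon> \<phi> + type2_error p d K \<rho> N \<sigma> \<epsilon> \<phi> + l"
proof (rule one_le_sum_of_errors[OF \<sigma> \<epsilon> \<phi> K \<theta> return_in_adversaries[OF \<epsilon>]])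
  let ?P = "null_law d N \<sigma>" and ?L = "mix_ratio d \<sigma> \<theta> N"
  note borel_measurable_mix_ratio[of N N d \<sigma> \<theta>, OF order_refl, measurable]
  interpret P: prob_space ?P by (rule prob_space_null_law[OF \<sigma>])
  fix A assume A[measurable]: "A \<in> sets ?P"
  have "(\<integral>\<^sup>+x. ennreal \<bar>1 - ?L x\<bar> \<partial>?P) \<le> ennreal l"
  proof (rule l1_le_chi_square)
    show "(\<integral>\<^sup>+x. ennreal ((?L x)\<^sup>2 / 1) \<partial>?P) \<le> ennreal (1 + l\<^sup>2)"
      using order_trans[OF nn_integral_mix_ratio_square[OF \<sigma>] ennreal_leI[OF chi]] by simp
  qed (auto simp: P.emeasure_space_1 nn_integral_mix_ratio[OF \<sigma>] mix_ratio_pos less_imp_le l)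
  have "emeasure (density ?P ?L) A = (\<integral>\<^sup>+x. ennreal (?L x) * indicator A x \<partial>?P)"
    by (simp add: emeasure_density)
  also have "\<dots> \<le> (\<integral>\<^sup>+x. indicator A x + ennreal \<bar>1 - ?L x\<bar> \<partial>?P)"
  proof (rule nn_integral_mono)
    fix x
    have "ennreal (?L x) \<le> ennreal (1 + \<bar>1 - ?L x\<bar>)" by (rule ennreal_leI) simp
    then show "ennreal (?L x) * indicator A x \<le> indicator A x + ennreal \<bar>1 - ?L x\<bar>"
      by (simp split: split_indicator)
  qed
  also have "\<dots> = emeasure ?P A + (\<integral>\<^sup>+x. ennreal \<bar>1 - ?L x\<bar> \<partial>?P)" by (simp add: nn_integral_add)
  also have "\<dots> \<le> emeasure ?P A + ennreal l" by (intro add_left_mono) fact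
  finally have "emeasure (density ?P ?L) A \<le> emeasure ?P A + ennreal l" .
  moreover have "?P \<bind> return (data_borel d N) = ?P"
    using observed_law_return[of d N \<sigma> "\<lambda>i\<in>{..<d}. 0"] by (simp add: observed_law_def clean_law_zero)
  ultimately show "emeasure (density ?P ?L) A \<le> emeasure (?P \<bind> return (data_borel d N)) A + ennreal l"
    by simp
qed (use l in simp)

text \<open>Here \<open>l1_le_chi_square\<close> compares consecutive likelihood ratios with
  \<open>\<tau> = \<epsilon> * l\<close>. Each sample is then changed with probability at most
  \<open>\<epsilon> * l\<close>, and keeping within the budget costs \<open>l\<close>.\<close>

lemma one_le_sum_of_errors_of_conditional_chi_square:
  assumes \<sigma>: "0 < \<sigma>" and \<epsilon>: "0 < \<epsilon>" and \<phi>: "is_test d N \<phi>" and N: "1 \<le> N"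
    and K: "pco_set p d K" and \<theta>: "\<theta> \<in> K" "\<rho> \<le> lp_norm p d \<theta>" and l: "0 < l"
    and b: "\<And>n i. n < N \<Longrightarrow> i < d \<Longrightarrow>
      exp ((\<theta> i)\<^sup>2 / \<sigma>\<^sup>2) - exp (- (real n * ((\<theta> i)\<^sup>2 / \<sigma>\<^sup>2))) * sinh ((\<theta> i)\<^sup>2 / \<sigma>\<^sup>2) \<le> exp (b i)"
    and chi: "exp (\<Sum>i<d. b i) \<le> 1 + (\<epsilon> * l)\<^sup>2"
  shows "1 \<le> type1_error d N \<sigma> \<epsilon> \<phi> + type2_error p d K \<rho> N \<sigma> \<epsilon> \<phi> + l"
proof -
  let ?P = "null_law d N \<sigma>" and ?L = "mix_ratio d \<sigma> \<theta>"
  have "\<exists>C\<in>adversaries d N \<epsilon>. \<forall>A\<in>sets ?P. emeasure (density ?P (?L N)) A \<le> emeasure (?P \<bind> C) A + ennreal l"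
  proof (rule adversary_by_coupling[OF prob_space_gauss0[OF \<sigma>] sets_gauss0])
    fix n assume n: "n < N"
    have "(\<integral>\<^sup>+x. ennreal (?L n x - ?L (Suc n) x) \<partial>?P) \<le> (\<integral>\<^sup>+x. ennreal \<bar>?L n x - ?L (Suc n) x\<bar> \<partial>?P)"
      by (intro nn_integral_mono ennreal_leI) auto
    also have "\<dots> \<le> ennreal (\<epsilon> * l)"
    proof (rule l1_le_chi_square)
      show "(\<integral>\<^sup>+x. ennreal ((?L (Suc n) x)\<^sup>2 / ?L n x) \<partial>?P) \<le> ennreal (1 + (\<epsilon> * l)\<^sup>2)"
        using order_trans[OF nn_integral_mix_ratio_chi_square[OF \<sigma> n b[OF n]] ennreal_leI[OF chi]] by simp
    qed (use n \<epsilon> l in \<open>auto simp: nn_integral_mix_ratio[OF \<sigma>] mix_ratio_pos less_imp_le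
          intro!: borel_measurable_mix_ratio\<close>)
    finally show "(\<integral>\<^sup>+x. ennreal (?L n x - ?L (Suc n) x) \<partial>?P) \<le> ennreal (\<epsilon> * l)" .
    show "(\<integral>\<^sup>+z. ennreal (?L (Suc n) (x(n := z))) \<partial>gauss0 d \<sigma>) = ennreal (?L n x)" for x
      by (rule nn_integral_mix_ratio_Suc[OF \<sigma>])
    show "?L n (x(n := z)) = ?L n x" for x z by (rule mix_ratio_upd)
  qed (use \<epsilon> l N in \<open>auto simp: mix_ratio_pos mix_ratio_0 intro!: borel_measurable_mix_ratio\<close>)
  then obtain C where "C \<in> adversaries d N \<epsilon>"
    "\<And>A. A \<in> sets ?P \<Longrightarrow> emeasure (density ?P (?L N)) A \<le> emeasure (?P \<bind> C) A + ennreal l"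
    by blast
  then show ?thesis using \<epsilon> l by (intro one_le_sum_of_errors[OF \<sigma> _ \<phi> K \<theta>]) auto
qed

section \<open>Optimal dimensions and the choice of constants\<close>

lemma exp_le_one_plus_double:
  fixes x :: real
  assumes "0 \<le> x" "x \<le> 1"
  shows "exp x \<le> 1 + 2 * x"
proof -
  have "x\<^sup>2 \<le> x" using assms by (simp add: power2_eq_square mult_left_le)
  then show ?thesis using exp_bound[OF assms] by linarith
qed

text \<open>The set contains 0, since the width at \<open>- 1\<close> is infinite, so the maximum is
  attained. The value 0 is split off because flat points exist only for dimensions at least
  1.\<close>

lemma Max_width_cases:
  fixes d :: nat and f :: "nat \<Rightarrow> real" and p :: real and K :: "(nat \<Rightarrow> real) set"
  assumes "f 0 = 0"
  defines "k \<equiv> Max {j. j \<le> d \<and> kolmogorov_width p d K (int j - 1) > ereal (f j)}"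
  shows "k = 0 \<or> 1 \<le> k \<and> k \<le> d \<and> ereal (f k) < kolmogorov_width p d K (int k - 1)"
proof -
  let ?S = "{j. j \<le> d \<and> kolmogorov_width p d K (int j - 1) > ereal (f j)}"
  have "finite ?S" by (rule finite_subset[of _ "{..d}"]) auto
  moreover have "0 \<in> ?S" using assms(1) by (simp add: kolmogorov_width_def)
  ultimately have "k \<in> ?S" unfolding k_def by (intro Max_in) auto
  then show ?thesis by auto
qed

text \<open>The exponents of \<open>k\<close> add up to 0: the radius attached to an optimal
  dimension exactly balances the moment bound of the flat point. For \<open>k = 0\<close> the left
  side is 0, as \<open>0 powr a = 0\<close>.\<close>

lemma powr_dual_le_one:
  fixes k n :: nat
  assumes "0 < n"
  shows "(real k powr (1/p - 1/n)) ^ n * real k powr (1 - n/p) \<le> 1"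
proof (cases "k = 0")
  case False
  have "(real k powr (1/p - 1/n)) ^ n = real k powr ((1/p - 1/n) * n)"
    using False by (simp add: powr_realpow[symmetric] powr_powr)
  then have "(real k powr (1/p - 1/n)) ^ n * real k powr (1 - n/p) = real k powr ((1/p - 1/n) * n + (1 - n/p))"
    by (simp only: powr_add)
  also have "(1/p - 1/n) * n + (1 - n/p) = 0" using assms by (simp add: left_diff_distrib)
  finally show ?thesis using False by simp
qed (use assms in simp)

theorem theorem4p5:
  fixes p \<alpha> :: real
  assumes "1 \<le> p" and "p < 2" and "0 < \<alpha>" and "\<alpha> < 1/2"
  shows "\<exists>c>0. \<forall>(c0::real) (\<epsilon>::real) (\<sigma>::real) (\<rho>::real) (d::nat) (N::nat) (K::(nat \<Rightarrow> real) set).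
           0 < c0 \<longrightarrow> c0 < 1/2 \<longrightarrow> 0 \<le> \<epsilon> \<longrightarrow> \<epsilon> < c0 \<longrightarrow> 0 < \<sigma> \<longrightarrow> 1 \<le> d \<longrightarrow> 1 \<le> N \<longrightarrow>
           pco_set p d K \<longrightarrow>
           (SUP \<theta>\<in>K. ereal (lp_norm 2 d \<theta>)) > ereal (\<sigma> / sqrt (real N)) \<longrightarrow>
           alternative p d K \<rho> \<noteq> {} \<longrightarrow>
           (\<exists>\<phi>. is_test d N \<phi> \<and> type1_error d N \<sigma> \<epsilon> \<phi> < \<alpha> \<and> type2_error p d K \<rho> N \<sigma> \<epsilon> \<phi> < \<alpha>) \<longrightarrow>
           \<rho> \<ge> c * \<sigma> * Max {real (opt_dim1 p d K N \<sigma>) powr (1/p - 1/4) / sqrt (real N),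
                             sqrt \<epsilon> * real (opt_dim2 p d K N \<sigma> \<epsilon>) powr (1/p - 1/4) / real N powr (1/4),
                             \<epsilon> * real (opt_dim3 p d K \<sigma> \<epsilon>) powr (1/p - 1/2)}"
proof -
  \<comment> \<open>The slack left by two errors below \<open>\<alpha>\<close>: a bound
    \<open>1 \<le> t1 + t2 + l\<close> on the errors is contradictory.\<close>
  define l where "l = 1 - 2 * \<alpha>"
  have l: "0 < l" "l \<le> 1" using assms by (auto simp: l_def)
  have l4: "l^4 \<le> l^2" using l by (intro power_decreasing) auto
  \<comment> \<open>Chosen so that \<open>c * r\<close> is the norm of the scaled flat point of
    radius \<open>r\<close>.\<close>
  define c where "c = l * 4 powr (-1/p)"
  have c: "0 < c" using l by (simp add: c_def)
  show ?thesis
  proof (rule exI[of _ c], intro conjI allI impI c)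
    fix c0 \<epsilon> \<sigma> \<rho> :: real and d N :: nat and K :: "(nat \<Rightarrow> real) set"
    assume c0: "0 < c0" "c0 < 1/2" and \<epsilon>: "0 \<le> \<epsilon>" "\<epsilon> < c0" and \<sigma>: "0 < \<sigma>" and N: "1 \<le> N"
      and K: "pco_set p d K" and alt: "alternative p d K \<rho> \<noteq> {}"
      and "\<exists>\<phi>. is_test d N \<phi> \<and> type1_error d N \<sigma> \<epsilon> \<phi> < \<alpha> \<and> type2_error p d K \<rho> N \<sigma> \<epsilon> \<phi> < \<alpha>"
    then obtain \<phi> where \<phi>: "is_test d N \<phi>"
      and err: "type1_error d N \<sigma> \<epsilon> \<phi> < \<alpha>" "type2_error p d K \<rho> N \<sigma> \<epsilon> \<phi> < \<alpha>" by blast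
    have no: "\<not> 1 \<le> type1_error d N \<sigma> \<epsilon> \<phi> + type2_error p d K \<rho> N \<sigma> \<epsilon> \<phi> + l"
      using err by (simp add: l_def)
    have "K \<noteq> {}" using alt by (auto simp: alternative_def)
    \<comment> \<open>Common frame of the three terms: if \<open>\<rho> < c * r\<close>, the flat
      point of radius \<open>r\<close> lies in the alternative and only its moment bounds need to be
      refuted. For \<open>r = 0\<close> the zero vector takes its place.\<close>
    have bound: "c * r \<le> \<rho>"
      if r: "0 \<le> r" and k: "k = 0 \<and> r = 0 \<or> 1 \<le> k \<and> k \<le> d \<and> ereal r < kolmogorov_width p d K (int k - 1)"
        and False: "\<And>\<theta>. \<lbrakk>\<theta> \<in> K; \<rho> \<le> lp_norm p d \<theta>; (\<Sum>i<d. (\<theta> i)^2) \<le> l^2 * r^2 * real k powr (1 - 2/p) / 4;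
          (\<Sum>i<d. (\<theta> i)^4) \<le> l^4 * r^4 * real k powr (1 - 4/p) / 4\<rbrakk> \<Longrightarrow> False" for r k
    proof (rule ccontr)
      assume "\<not> c * r \<le> \<rho>"
      then have \<rho>: "\<rho> \<le> c * r" by simp
      show False
      proof (cases "r = 0")
        case True
        show False
        proof (rule False[OF zero_in_pco[OF K \<open>K \<noteq> {}\<close>]])
          show "\<rho> \<le> lp_norm p d (\<lambda>i\<in>{..<d}. 0)" using \<rho> True by (simp add: lp_norm_def)
        qed (use True in auto)
      next
        case r0: False
        then obtain \<theta> where \<theta>: "\<theta> \<in> K" "lp_norm p d \<theta> = c * r"
          "(\<Sum>i<d. (\<theta> i)^2) \<le> l^2 * r^2 * real k powr (1 - 2/p) / 4"
          "(\<Sum>i<d. (\<theta> i)^4) \<le> l^4 * r^4 * real k powr (1 - 4/p) / 4"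
          using pco_flat_point_scaled[OF K assms(1,2), of k r l] r k l unfolding c_def by auto
        show False by (rule False[OF \<theta>(1) _ \<theta>(3,4)]) (simp add: \<theta>(2) \<rho>)
      qed
    qed
    let ?k1 = "opt_dim1 p d K N \<sigma>" and ?k2 = "opt_dim2 p d K N \<sigma> \<epsilon>" and ?k3 = "opt_dim3 p d K \<sigma> \<epsilon>"
    have dual4: "(real k powr (1/p - 1/4))^4 * real k powr (1 - 4/p) \<le> 1" for k :: nat
      using powr_dual_le_one[of 4 k p] by simp
    have dual2: "(real k powr (1/p - 1/2))^2 * real k powr (1 - 2/p) \<le> 1" for k :: nat
      using powr_dual_le_one[of 2 k p] by simp
    have sum4: "(\<Sum>i<d. ((\<theta> i)\<^sup>2 / \<sigma>\<^sup>2)\<^sup>2) = (\<Sum>i<d. (\<theta> i)^4) / \<sigma>^4" for \<theta> :: "nat \<Rightarrow> real"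
      by (simp add: sum_divide_distrib power_divide flip: power_mult)
    \<comment> \<open>With this radius the fourth-moment bound gives \<open>l^4 / 4\<close> for the
      exponent of the second moment of the full likelihood ratio, and
      \<open>exp x \<le> 1 + 2 * x\<close> brings it below \<open>1 + l^2\<close>.\<close>
    have term1: "c * (real ?k1 powr (1/p - 1/4) / sqrt N * \<sigma>) \<le> \<rho>"
    proof (rule bound[of _ ?k1])
      show "?k1 = 0 \<and> real ?k1 powr (1/p - 1/4) / sqrt N * \<sigma> = 0 \<or> 1 \<le> ?k1 \<and> ?k1 \<le> d \<and>
          ereal (real ?k1 powr (1/p - 1/4) / sqrt N * \<sigma>) < kolmogorov_width p d K (int ?k1 - 1)"
      proof -
        have "?k1 = 0 \<or> 1 \<le> ?k1 \<and> ?k1 \<le> d \<and> ereal (real ?k1 powr (1/p - 1/4) / sqrt N * \<sigma>) < kolmogorov_width p d K (int ?k1 - 1)"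
          unfolding opt_dim1_def by (rule Max_width_cases[where f = "\<lambda>j. real j powr (1/p - 1/4) / sqrt N * \<sigma>"]) simp
        then show ?thesis by (elim disjE) simp_all
      qed
      have N4: "(sqrt N)^4 = (real N)^2" by (simp add: power4_eq_xxxx power2_eq_square)
      fix \<theta> assume \<theta>: "\<theta> \<in> K" "\<rho> \<le> lp_norm p d \<theta>"
      assume "(\<Sum>i<d. (\<theta> i)^4) \<le> l^4 * (real ?k1 powr (1/p - 1/4) / sqrt N * \<sigma>)^4 * real ?k1 powr (1 - 4/p) / 4"
      also have "\<dots> = (l^4 * \<sigma>^4 / (4 * N^2)) * ((real ?k1 powr (1/p - 1/4))^4 * real ?k1 powr (1 - 4/p))"
        by (simp add: power_mult_distrib power_divide N4 ac_simps)
      also have "\<dots> \<le> (l^4 * \<sigma>^4 / (4 * N^2)) * 1" using l \<sigma> by (intro mult_left_mono dual4) auto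
      finally have "(\<Sum>i<d. (\<theta> i)^4) / \<sigma>^4 \<le> l^4 * \<sigma>^4 / (4 * N^2) * 1 / \<sigma>^4"
        using \<sigma> by (intro divide_right_mono) auto
      then have "(\<Sum>i<d. ((\<theta> i)\<^sup>2 / \<sigma>\<^sup>2)\<^sup>2) \<le> l^4 / (4 * N^2)"
        unfolding sum4 using \<sigma> by simp
      then have "(real N)\<^sup>2 * (\<Sum>i<d. ((\<theta> i)\<^sup>2 / \<sigma>\<^sup>2)\<^sup>2) \<le> (real N)\<^sup>2 * (l^4 / (4 * N^2))"
        by (rule mult_left_mono) simp
      moreover have "(\<Sum>i<d. (N * ((\<theta> i)\<^sup>2 / \<sigma>\<^sup>2))\<^sup>2) = (real N)\<^sup>2 * (\<Sum>i<d. ((\<theta> i)\<^sup>2 / \<sigma>\<^sup>2)\<^sup>2)"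
        by (simp only: power_mult_distrib sum_distrib_left)
      ultimately have "(\<Sum>i<d. (N * ((\<theta> i)\<^sup>2 / \<sigma>\<^sup>2))\<^sup>2) \<le> (real N)\<^sup>2 * (l^4 / (4 * N^2))" by (simp only:)
      also have "\<dots> = l^4 / 4" using N by simp
      finally have le: "(\<Sum>i<d. (N * ((\<theta> i)\<^sup>2 / \<sigma>\<^sup>2))\<^sup>2) \<le> l^4 / 4" .
      have "l^2 \<le> 1" using l by (simp add: power_le_one)
      then have "exp (\<Sum>i<d. (N * ((\<theta> i)\<^sup>2 / \<sigma>\<^sup>2))\<^sup>2) \<le> 1 + 2 * (\<Sum>i<d. (N * ((\<theta> i)\<^sup>2 / \<sigma>\<^sup>2))\<^sup>2)"
        using le l4 by (intro exp_le_one_plus_double sum_nonneg) auto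
      also have "\<dots> \<le> 1 + l^2" using le l4 zero_le_power[of l 4] l by linarith
      finally have "1 \<le> type1_error d N \<sigma> \<epsilon> \<phi> + type2_error p d K \<rho> N \<sigma> \<epsilon> \<phi> + l"
        by (intro one_le_sum_of_errors_of_chi_square[OF \<sigma> \<epsilon>(1) \<phi> K \<theta> l(1)])
      then show False using no by contradiction
    qed (use \<sigma> in simp)
    \<comment> \<open>Again the fourth moment, now with exponents \<open>2 * N * t\<^sup>2\<close>
      from \<open>exp_minus_sinh_le\<close>, where
      \<open>t = (\<theta> i)\<^sup>2 / \<sigma>\<^sup>2\<close>. Positivity of
      \<open>\<epsilon>\<close> is what Markov's inequality requires.\<close>
    have term2: "c * (sqrt \<epsilon> * real ?k2 powr (1/p - 1/4) / real N powr (1/4) * \<sigma>) \<le> \<rho>" if \<epsilon>0: "0 < \<epsilon>"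
    proof (rule bound[of _ ?k2])
      show "?k2 = 0 \<and> sqrt \<epsilon> * real ?k2 powr (1/p - 1/4) / real N powr (1/4) * \<sigma> = 0 \<or> 1 \<le> ?k2 \<and> ?k2 \<le> d \<and>
          ereal (sqrt \<epsilon> * real ?k2 powr (1/p - 1/4) / real N powr (1/4) * \<sigma>) < kolmogorov_width p d K (int ?k2 - 1)"
      proof -
        have "?k2 = 0 \<or> 1 \<le> ?k2 \<and> ?k2 \<le> d \<and> ereal (sqrt \<epsilon> * real ?k2 powr (1/p - 1/4) / real N powr (1/4) * \<sigma>) < kolmogorov_width p d K (int ?k2 - 1)"
          unfolding opt_dim2_def by (rule Max_width_cases[where f = "\<lambda>j. sqrt \<epsilon> * real j powr (1/p - 1/4) / real N powr (1/4) * \<sigma>"]) simp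
        then show ?thesis by (elim disjE) simp_all
      qed
      have N4: "(real N powr (1/4))^4 = N" using N by (simp add: powr_realpow[symmetric] powr_powr)
      have \<epsilon>4: "(sqrt \<epsilon>)^4 = \<epsilon>^2" using \<epsilon>0 by (simp add: power4_eq_xxxx power2_eq_square)
      fix \<theta> assume \<theta>: "\<theta> \<in> K" "\<rho> \<le> lp_norm p d \<theta>"
      assume "(\<Sum>i<d. (\<theta> i)^4) \<le> l^4 * (sqrt \<epsilon> * real ?k2 powr (1/p - 1/4) / real N powr (1/4) * \<sigma>)^4 * real ?k2 powr (1 - 4/p) / 4"
      also have "\<dots> = (l^4 * \<epsilon>^2 * \<sigma>^4 / (4 * N)) * ((real ?k2 powr (1/p - 1/4))^4 * real ?k2 powr (1 - 4/p))"
        by (simp add: power_mult_distrib power_divide N4 \<epsilon>4 ac_simps)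
      also have "\<dots> \<le> (l^4 * \<epsilon>^2 * \<sigma>^4 / (4 * N)) * 1" using l \<sigma> by (intro mult_left_mono dual4) auto
      finally have "(\<Sum>i<d. (\<theta> i)^4) / \<sigma>^4 \<le> l^4 * \<epsilon>^2 * \<sigma>^4 / (4 * N) * 1 / \<sigma>^4"
        using \<sigma> by (intro divide_right_mono) auto
      then have "(\<Sum>i<d. ((\<theta> i)\<^sup>2 / \<sigma>\<^sup>2)\<^sup>2) \<le> l^4 * \<epsilon>^2 / (4 * N)"
        unfolding sum4 using \<sigma> by simp
      then have "2 * N * (\<Sum>i<d. ((\<theta> i)\<^sup>2 / \<sigma>\<^sup>2)\<^sup>2) \<le> 2 * N * (l^4 * \<epsilon>^2 / (4 * N))"
        by (intro mult_left_mono) auto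
      also have "\<dots> = l^4 * \<epsilon>^2 / 2" using N by simp
      finally have le: "(\<Sum>i<d. 2 * N * ((\<theta> i)\<^sup>2 / \<sigma>\<^sup>2)\<^sup>2) \<le> l^4 * \<epsilon>^2 / 2"
        by (simp only: sum_distrib_left)
      have l\<epsilon>: "l^4 * \<epsilon>^2 \<le> (\<epsilon> * l)^2"
        using mult_right_mono[OF l4, of "\<epsilon>^2"] by (simp add: power_mult_distrib mult.commute)
      have "\<epsilon> * l \<le> 1" using l \<epsilon> c0 by (intro mult_le_one) auto
      then have "(\<epsilon> * l)^2 \<le> 1" using l \<epsilon> by (simp add: power_le_one)
      then have "exp (\<Sum>i<d. 2 * N * ((\<theta> i)\<^sup>2 / \<sigma>\<^sup>2)\<^sup>2) \<le> 1 + 2 * (\<Sum>i<d. 2 * N * ((\<theta> i)\<^sup>2 / \<sigma>\<^sup>2)\<^sup>2)"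
        using le l\<epsilon> by (intro exp_le_one_plus_double sum_nonneg) auto
      also have "\<dots> \<le> 1 + (\<epsilon> * l)^2" using le l\<epsilon> by linarith
      finally have chi: "exp (\<Sum>i<d. 2 * N * ((\<theta> i)\<^sup>2 / \<sigma>\<^sup>2)\<^sup>2) \<le> 1 + (\<epsilon> * l)^2" .
      have "1 \<le> type1_error d N \<sigma> \<epsilon> \<phi> + type2_error p d K \<rho> N \<sigma> \<epsilon> \<phi> + l"
        by (rule one_le_sum_of_errors_of_conditional_chi_square[OF \<sigma> \<epsilon>0 \<phi> N K \<theta> l(1) _ chi])
          (rule exp_minus_sinh_le, simp_all)
      then show False using no by contradiction
    qed (use \<sigma> \<epsilon> in simp)
    have term3: "c * (\<epsilon> * \<sigma> * real ?k3 powr (1/p - 1/2)) \<le> \<rho>" if \<epsilon>0: "0 < \<epsilon>"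
    proof (rule bound[of _ ?k3])
      show "?k3 = 0 \<and> \<epsilon> * \<sigma> * real ?k3 powr (1/p - 1/2) = 0 \<or> 1 \<le> ?k3 \<and> ?k3 \<le> d \<and>
          ereal (\<epsilon> * \<sigma> * real ?k3 powr (1/p - 1/2)) < kolmogorov_width p d K (int ?k3 - 1)"
      proof -
        have "?k3 = 0 \<or> 1 \<le> ?k3 \<and> ?k3 \<le> d \<and> ereal (\<epsilon> * \<sigma> * real ?k3 powr (1/p - 1/2)) < kolmogorov_width p d K (int ?k3 - 1)"
          unfolding opt_dim3_def by (rule Max_width_cases[where f = "\<lambda>j. \<epsilon> * \<sigma> * real j powr (1/p - 1/2)"]) simp
        then show ?thesis by (elim disjE) simp_all
      qed
      fix \<theta> assume \<theta>: "\<theta> \<in> K" "\<rho> \<le> lp_norm p d \<theta>"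
      assume "(\<Sum>i<d. (\<theta> i)^2) \<le> l^2 * (\<epsilon> * \<sigma> * real ?k3 powr (1/p - 1/2))^2 * real ?k3 powr (1 - 2/p) / 4"
      also have "\<dots> = (l^2 * \<epsilon>^2 * \<sigma>^2 / 4) * ((real ?k3 powr (1/p - 1/2))^2 * real ?k3 powr (1 - 2/p))"
        by (simp add: power_mult_distrib)
      also have "\<dots> \<le> (l^2 * \<epsilon>^2 * \<sigma>^2 / 4) * 1" by (intro mult_left_mono dual2) auto
      finally have "(\<Sum>i<d. (\<theta> i)^2) / \<sigma>^2 \<le> l^2 * \<epsilon>^2 * \<sigma>^2 / 4 * 1 / \<sigma>^2"
        by (intro divide_right_mono) auto
      also have "\<dots> = (\<epsilon> * l)^2 / 4" using \<sigma> by (simp add: power_mult_distrib)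
      finally have le: "(\<Sum>i<d. (\<theta> i)\<^sup>2 / \<sigma>\<^sup>2) \<le> (\<epsilon> * l)^2 / 4"
        by (simp only: sum_divide_distrib)
      have "\<epsilon> * l \<le> 1" using l \<epsilon> c0 by (intro mult_le_one) auto
      then have "(\<epsilon> * l)^2 \<le> 1" using l \<epsilon> by (simp add: power_le_one)
      then have "exp (\<Sum>i<d. (\<theta> i)\<^sup>2 / \<sigma>\<^sup>2) \<le> 1 + 2 * (\<Sum>i<d. (\<theta> i)\<^sup>2 / \<sigma>\<^sup>2)"
        using le by (intro exp_le_one_plus_double sum_nonneg) auto
      also have "\<dots> \<le> 1 + (\<epsilon> * l)^2" using le zero_le_power2[of "\<epsilon> * l"] by linarith
      finally have chi: "exp (\<Sum>i<d. (\<theta> i)\<^sup>2 / \<sigma>\<^sup>2) \<le> 1 + (\<epsilon> * l)^2" .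
      have "1 \<le> type1_error d N \<sigma> \<epsilon> \<phi> + type2_error p d K \<rho> N \<sigma> \<epsilon> \<phi> + l"
        \<comment> \<open>Dropping the nonnegative \<open>sinh\<close> term bounds each factor by
          \<open>exp ((\<theta> i)\<^sup>2 / \<sigma>\<^sup>2)\<close>, so the second moment of
          \<open>\<theta>\<close> suffices here.\<close>
        by (rule one_le_sum_of_errors_of_conditional_chi_square[OF \<sigma> \<epsilon>0 \<phi> N K \<theta> l(1) _ chi]) simp
      then show False using no by contradiction
    qed (use \<sigma> \<epsilon> in simp)
    \<comment> \<open>For \<open>\<epsilon> = 0\<close> the last two terms vanish, and the first
      term provides the remaining claim \<open>0 \<le> \<rho>\<close>.\<close>
    have "0 \<le> c * (real ?k1 powr (1/p - 1/4) / sqrt N * \<sigma>)" using c \<sigma> by simp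
    then have "0 \<le> \<rho>" using term1 by linarith
    let ?V = "{real ?k1 powr (1/p - 1/4) / sqrt (real N),
      sqrt \<epsilon> * real ?k2 powr (1/p - 1/4) / real N powr (1/4), \<epsilon> * real ?k3 powr (1/p - 1/2)}"
    have term2': "c * \<sigma> * (sqrt \<epsilon> * real ?k2 powr (1/p - 1/4) / real N powr (1/4)) \<le> \<rho>"
      using term2 \<open>0 \<le> \<rho>\<close> \<epsilon>(1) by (cases "\<epsilon> = 0") (simp_all add: ac_simps)
    have term3': "c * \<sigma> * (\<epsilon> * real ?k3 powr (1/p - 1/2)) \<le> \<rho>"
      using term3 \<open>0 \<le> \<rho>\<close> \<epsilon>(1) by (cases "\<epsilon> = 0") (simp_all add: ac_simps)
    have "Max ?V \<in> ?V" by (rule Max_in) auto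
    then consider "Max ?V = real ?k1 powr (1/p - 1/4) / sqrt (real N)"
      | "Max ?V = sqrt \<epsilon> * real ?k2 powr (1/p - 1/4) / real N powr (1/4)"
      | "Max ?V = \<epsilon> * real ?k3 powr (1/p - 1/2)" by blast
    then show "\<rho> \<ge> c * \<sigma> * Max ?V"
    proof cases
      case 1
      show ?thesis unfolding 1 using term1 by (simp add: ac_simps)
    next
      case 2
      show ?thesis unfolding 2 by (rule term2')
    next
      case 3
      show ?thesis unfolding 3 by (rule term3')
    qed
  qed
qed

end
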